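(* For any $k\ge 3$ there exist (polynomial-time) offline scheduling algorithms for the dynamic bin packing problem with the following guarantees on the average cost (total cost divided by $T$). (1) One algorithm has average cost at most $\Pi_k\cdot \mathrm{OPT}_{avg}+O\left(\sqrt{\mathrm{OPT}_{avg}\cdot k\cdot\log\mu}\right)$ in the non-uniform size case, and at most $\mathrm{OPT}_{avg}+O\left(\sqrt{\mathrm{OPT}_{avg}\cdot\log\mu}\right)$ in the uniform size case. (2) One algorithm has average cost at most $2\Pi_k\left(1+\frac{1}{k-2}\right)\cdot \mathrm{OPT}_{avg}+k$ in the non-uniform size case, and at most $2\cdot \mathrm{OPT}_{avg}$ in the uniform size case. (For comparison, the previously known bounds were $4\cdot\mathrm{OPT}_{avg}$ in the non-uniform size case and $2\cdot\mathrm{OPT}_{avg}$ in the uniform size case.)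
   Context: Dynamic bin packing. The time horizon has length $T$. An instance $\mathcal I$ is a set of intervals (VM requests) $I=[s_I,e_I)$ with size $w_I\le 1$; $I$ is active at $t$ if $s_I\le t<e_I$. The length of $I$ is $\ell_I=e_I-s_I$; without loss of generality the minimum length is $1$, and $\mu$ denotes the maximum length (the ratio between the maximum and minimum length). Without loss of generality, at each time at least one interval is active. A schedule assigns each interval to one machine for its entire duration (no migration); at each time the total size of active intervals on a machine is at most $1$. A machine is active at $t$ if at least one interval assigned to it is active at $t$. The (total) cost of a schedule is the total active time summed over all machines; $\mathrm{OPT}$ is the minimum cost and $\mathrm{OPT}_{avg}=\mathrm{OPT}/T$. Uniform size case: all sizes equal $1/g$ for some integer $g$. Non-uniform size case: sizes are arbitrary. An offline algorithm sees the whole instance in advance. The quantity $\Pi_k$: static bin packing asks to pack items of sizes in $(0,1]$ into the minimum number of unit bins. The Harmonic algorithm with parameter $k$ splits items into classes with sizes in $(\frac1{j+1},\frac1j]$ for $j=1,\dots,k-1$, and $(0,\frac1k]$, and packs each class separately by Next-Fit (keep one active bin; if an item does not fit, close it and open a new one). $\Pi_k$ denotes its asymptotic competitive ratio (its number of bins is at most $\Pi_k$ times the optimal number of bins, plus $k$); $\Pi_k$ decreases to $\Pi_\infty\approx1.691$. *)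

theory Defs
  imports "HOL-Analysis.Analysis"
begin

section \<open>Dynamic bin packing\<close>

text \<open>An instance is a list of requests, so that several requests may share the same interval
  and size. A request stands for the half-open interval from \<open>start\<close> to \<open>finish\<close>.\<close>

datatype request = Request (start: real) (finish: real) (weight: real)

definition duration :: "request \<Rightarrow> real" where
  "duration r = finish r - start r"

definition active :: "request \<Rightarrow> real \<Rightarrow> bool" where
  "active r t \<longleftrightarrow> start r \<le> t \<and> t < finish r"

text \<open>The horizon is \<open>[0,T)\<close>. The normalisations are that the minimum duration is 1 and that
  some request is active at every time of the horizon.\<close>

definition valid_instance :: "real \<Rightarrow> request list \<Rightarrow> bool" where
  "valid_instance T I \<longleftrightarrow>
     T > 0 \<and>
     (\<forall>r\<in>set I. 0 \<le> start r \<and> start r < finish r \<and> finish r \<le> T \<and>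
                0 < weight r \<and> weight r \<le> 1) \<and>
     (\<forall>t\<in>{0..<T}. \<exists>r\<in>set I. active r t) \<and>
     Min (duration ` set I) = 1"

text \<open>This is \<open>\<mu>\<close>, the minimum duration being 1. An asymptotic bound in terms of \<open>log \<mu>\<close> is read as a
  bound in terms of \<open>max 1 (log 2 \<mu>)\<close>, which equals \<open>log 2 \<mu>\<close> whenever \<open>\<mu> \<ge> 2\<close> and does not
  degenerate as \<open>\<mu>\<close> tends to 1.\<close>

definition max_duration :: "request list \<Rightarrow> real" where
  "max_duration I = Max (duration ` set I)"

definition uniform_size :: "request list \<Rightarrow> bool" where
  "uniform_size I \<longleftrightarrow> (\<exists>g::nat. g \<ge> 1 \<and> (\<forall>r\<in>set I. weight r = 1 / real g))"

text \<open>A schedule lists the machine of each request, in the order of the instance.\<close>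

definition feasible :: "request list \<Rightarrow> nat list \<Rightarrow> bool" where
  "feasible I \<sigma> \<longleftrightarrow>
     length \<sigma> = length I \<and>
     (\<forall>m t. (\<Sum>i | i < length I \<and> \<sigma> ! i = m \<and> active (I ! i) t. weight (I ! i)) \<le> 1)"

definition active_time :: "request list \<Rightarrow> nat list \<Rightarrow> nat \<Rightarrow> real" where
  "active_time I \<sigma> m =
     measure lborel {t. \<exists>i<length I. \<sigma> ! i = m \<and> active (I ! i) t}"

definition cost :: "request list \<Rightarrow> nat list \<Rightarrow> real" where
  "cost I \<sigma> = (\<Sum>m\<in>set \<sigma>. active_time I \<sigma> m)"

definition opt :: "request list \<Rightarrow> real" where
  "opt I = Inf {cost I \<sigma> | \<sigma>. feasible I \<sigma>}"

definition avg_cost :: "real \<Rightarrow> request list \<Rightarrow> nat list \<Rightarrow> real" where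
  "avg_cost T I \<sigma> = cost I \<sigma> / T"

definition opt_avg :: "real \<Rightarrow> request list \<Rightarrow> real" where
  "opt_avg T I = opt I / T"


section \<open>Static bin packing and the Harmonic algorithm\<close>

definition packs_into :: "real list \<Rightarrow> nat \<Rightarrow> bool" where
  "packs_into xs m \<longleftrightarrow>
     (\<exists>f. (\<forall>i<length xs. f i < m) \<and>
          (\<forall>b<m. (\<Sum>i | i < length xs \<and> f i = b. xs ! i) \<le> 1))"

definition opt_bins :: "real list \<Rightarrow> nat" where
  "opt_bins xs = (LEAST m. packs_into xs m)"

text \<open>\<open>next_fit_from l xs\<close> is the number of additional bins that Next-Fit opens for \<open>xs\<close> when the
  currently open bin has level \<open>l\<close>.\<close>

fun next_fit_from :: "real \<Rightarrow> real list \<Rightarrow> nat" where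
  "next_fit_from l [] = 0"
| "next_fit_from l (x # xs) =
     (if l + x \<le> 1 then next_fit_from (l + x) xs else Suc (next_fit_from x xs))"

fun next_fit :: "real list \<Rightarrow> nat" where
  "next_fit [] = 0"
| "next_fit (x # xs) = Suc (next_fit_from x xs)"

definition in_harmonic_class :: "nat \<Rightarrow> nat \<Rightarrow> real \<Rightarrow> bool" where
  "in_harmonic_class k j x \<longleftrightarrow>
     (if j < k then 1 / real (j + 1) < x \<and> x \<le> 1 / real j else 0 < x \<and> x \<le> 1 / real k)"

definition harmonic_bins :: "nat \<Rightarrow> real list \<Rightarrow> nat" where
  "harmonic_bins k xs = (\<Sum>j=1..k. next_fit (filter (in_harmonic_class k j) xs))"

text \<open>The asymptotic competitive ratio of Harmonic with parameter \<open>k\<close>. Since \<open>n\<close>-fold repetition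
  of an input costs Harmonic at least \<open>n\<close> times (its cost minus \<open>k\<close>), the infimum does not change
  when the additive constant is fixed to \<open>k\<close>.\<close>

definition harmonic_ratio :: "nat \<Rightarrow> real" where
  "harmonic_ratio k =
     Inf {R. \<exists>c. \<forall>xs. set xs \<subseteq> {0<..1} \<longrightarrow>
                real (harmonic_bins k xs) \<le> R * real (opt_bins xs) + c}"


section \<open>Polynomial time\<close>

text \<open>Programs are while programs over S-expressions whose atoms are real numbers. The only
  numeric operations are addition, subtraction and comparison, and the only numeric constant is 1.
  Hence no information can be hidden in constants, and on rational inputs the bit length of all
  numbers stays bounded by the bit length of the input plus a linear function of the number of steps:
  counting steps with unit cost is polynomially related to Turing machine time. Ill-typed
  expressions evaluate to \<open>Null\<close>.\<close>

datatype val = Null | Atom real | Cell val val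

datatype expr =
    Var nat | NullE | One
  | Plus expr expr | Minus expr expr
  | CellE expr expr | Head expr | Tail expr

datatype test = IsCell expr | IsAtom expr | Less expr expr | Neg test | Conj test test

datatype com = Skip | Assign nat expr | Seq com com | Cond test com com | While test com

type_synonym store = "nat \<Rightarrow> val"

fun eval_expr :: "expr \<Rightarrow> store \<Rightarrow> val" where
  "eval_expr (Var x) s = s x"
| "eval_expr NullE s = Null"
| "eval_expr One s = Atom 1"
| "eval_expr (Plus a b) s =
     (case (eval_expr a s, eval_expr b s) of (Atom p, Atom q) \<Rightarrow> Atom (p + q) | _ \<Rightarrow> Null)"
| "eval_expr (Minus a b) s =
     (case (eval_expr a s, eval_expr b s) of (Atom p, Atom q) \<Rightarrow> Atom (p - q) | _ \<Rightarrow> Null)"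
| "eval_expr (CellE a b) s = Cell (eval_expr a s) (eval_expr b s)"
| "eval_expr (Head a) s = (case eval_expr a s of Cell u v \<Rightarrow> u | _ \<Rightarrow> Null)"
| "eval_expr (Tail a) s = (case eval_expr a s of Cell u v \<Rightarrow> v | _ \<Rightarrow> Null)"

fun eval_test :: "test \<Rightarrow> store \<Rightarrow> bool" where
  "eval_test (IsCell a) s = (case eval_expr a s of Cell _ _ \<Rightarrow> True | _ \<Rightarrow> False)"
| "eval_test (IsAtom a) s = (case eval_expr a s of Atom _ \<Rightarrow> True | _ \<Rightarrow> False)"
| "eval_test (Less a b) s =
     (case (eval_expr a s, eval_expr b s) of (Atom p, Atom q) \<Rightarrow> p < q | _ \<Rightarrow> False)"
| "eval_test (Neg b) s = (\<not> eval_test b s)"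
| "eval_test (Conj b c) s = (eval_test b s \<and> eval_test c s)"

text \<open>\<open>exec c s n s'\<close>: started in \<open>s\<close>, the program \<open>c\<close> terminates in \<open>s'\<close> after \<open>n\<close> steps. An
  assignment or a test is one step; the expressions in it have constant size for a fixed program.\<close>

inductive exec :: "com \<Rightarrow> store \<Rightarrow> nat \<Rightarrow> store \<Rightarrow> bool" where
  Skip: "exec Skip s 1 s"
| Assign: "exec (Assign x e) s 1 (s(x := eval_expr e s))"
| Seq: "exec c1 s n1 s1 \<Longrightarrow> exec c2 s1 n2 s2 \<Longrightarrow> exec (Seq c1 c2) s (n1 + n2) s2"
| CondTrue: "eval_test b s \<Longrightarrow> exec c1 s n s1 \<Longrightarrow> exec (Cond b c1 c2) s (Suc n) s1"
| CondFalse: "\<not> eval_test b s \<Longrightarrow> exec c2 s n s1 \<Longrightarrow> exec (Cond b c1 c2) s (Suc n) s1"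
| WhileFalse: "\<not> eval_test b s \<Longrightarrow> exec (While b c) s 1 s"
| WhileTrue: "eval_test b s \<Longrightarrow> exec c s n1 s1 \<Longrightarrow> exec (While b c) s1 n2 s2 \<Longrightarrow>
    exec (While b c) s (Suc (n1 + n2)) s2"

fun list_val :: "val list \<Rightarrow> val" where
  "list_val [] = Null"
| "list_val (v # vs) = Cell v (list_val vs)"

definition request_val :: "request \<Rightarrow> val" where
  "request_val r = list_val [Atom (start r), Atom (finish r), Atom (weight r)]"

definition input_store :: "request list \<Rightarrow> store" where
  "input_store I = (\<lambda>x. Null)(0 := list_val (map request_val I))"

definition schedule_val :: "nat list \<Rightarrow> val" where
  "schedule_val \<sigma> = list_val (map (\<lambda>m. Atom (real m)) \<sigma>)"

definition computes_in_poly_time :: "com \<Rightarrow> (request list \<Rightarrow> nat list) \<Rightarrow> bool" where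
  "computes_in_poly_time c A \<longleftrightarrow>
     (\<exists>a d::nat. \<forall>T I. valid_instance T I \<longrightarrow>
        (\<exists>n s. exec c (input_store I) n s \<and> s 0 = schedule_val (A I) \<and> n \<le> a * length I ^ d))"

definition poly_time_scheduler :: "(request list \<Rightarrow> nat list) \<Rightarrow> bool" where
  "poly_time_scheduler A \<longleftrightarrow>
     (\<forall>T I. valid_instance T I \<longrightarrow> feasible I (A I)) \<and> (\<exists>c. computes_in_poly_time c A)"

end

theory Submission
  imports Defs
begin

text \<open>
  Every feasible schedule uses, at time \<open>t\<close>, at least \<open>opt_bins\<close> of the sizes active at \<open>t\<close> many
  machines, and so at least as many as their total size. It therefore suffices to bound the number
  of active machines pointwise and to integrate.

  \<^emph>\<open>Harmonic machines.\<close> Peel off classes of requests whose durations agree up to a factor \<open>1 + 1/m\<close>,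
  split each of them into the harmonic size classes, and pack each cell by static Next-Fit in the
  order of the start times. A machine that is filled during \<open>[a,b]\<close> by requests of duration about \<open>d\<close>
  carries all its requests during its core \<open>[b,a+d)\<close>, and the filling periods of a cell are disjoint, so
  the time outside the cores is \<open>O(T)\<close> per cell plus a fraction \<open>1/m\<close> of the cores. The machines of a
  cell whose core contains \<open>t\<close> are consecutive, so they are a Next-Fit packing of their requests, and
  their number is at most \<open>harmonic_ratio k\<close> times the optimum plus \<open>O(k)\<close> per duration class. There are
  at most \<open>1 + m log \<mu>\<close> classes, and \<open>m = sqrt (OPT/(k log \<mu>))\<close> balances the two error terms. The
  algorithm tries all \<open>m \<le> n\<close>. A layered schedule takes over when \<open>OPT < k log \<mu>\<close>.

  \<^emph>\<open>Layered machines.\<close> Repeatedly remove an inclusion-minimal set of requests whose load is at least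
  \<open>min c (remaining load)\<close> at all times. In such a set each request \<open>x\<close> has a time at which the load is
  less than \<open>c + v x\<close>. Sorting the requests active at \<open>z\<close> by whether this time lies before or after \<open>z\<close>
  shows that the load never reaches \<open>2 (c + max v)\<close>, so two machines suffice for the set. Applied to
  equal sizes this costs at most twice the optimum. Sizes above 1/3, in (1/4,1/3] and
  below 1/4 are treated separately, which costs at most 16/5 times the load plus 4, or 4 times the load plus 2.
  This is enough since \<open>harmonic_ratio k \<ge> 3/2\<close>, and \<open>\<ge> 5/3\<close> for \<open>k \<ge> 7\<close>, by the
  input of repeated sizes 51/100, 34/100, 15/100.
\<close>

section \<open>Static bin packing\<close>

text \<open>Neither algorithm is told the optimum, the right \<open>m\<close>, or whether all sizes
  agree. Each builds several schedules and keeps the cheapest, so each bound has to be proved for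
  one candidate only; for this the programs evaluate costs exactly (\<open>sweep\<close>). Trying
  \<open>m <= n\<close> is enough because the average optimum is at most the number of requests. The
  comparison with Harmonic has to be made at a single time, whereas Next-Fit fills a machine over a
  period and counts requests that may have ended. In the core of a machine this does not matter: all
  its requests have started and none has ended, so the bins seen at time \<open>t\<close> are a
  genuine static packing of requests that every schedule serves at \<open>t\<close>. With the first
  two sizes of the hard input alone, \<open>2 * harmonic_ratio k >= 3\<close> falls short of 16/5;
  for \<open>k <= 6\<close> the factor \<open>1 + 1/(k-2)\<close> closes the gap, for
  \<open>k >= 7\<close> the third size does. Programs can only add, subtract and compare numbers, so
  tests are stated without division, and products with \<open>m\<close> are repeated
  additions.\<close>

lemma packs_into_append:
  assumes "packs_into xs m" "packs_into ys m'"
  shows "packs_into (xs @ ys) (m + m')"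
proof -
  obtain f where f: "\<And>i. i < length xs \<Longrightarrow> f i < m"
    "\<And>b. b < m \<Longrightarrow> (\<Sum>i | i < length xs \<and> f i = b. xs ! i) \<le> 1"
    using assms(1) unfolding packs_into_def by blast
  obtain g where g: "\<And>i. i < length ys \<Longrightarrow> g i < m'"
    "\<And>b. b < m' \<Longrightarrow> (\<Sum>i | i < length ys \<and> g i = b. ys ! i) \<le> 1"
    using assms(2) unfolding packs_into_def by blast
  define h where "h i = (if i < length xs then f i else m + g (i - length xs))" for i
  show ?thesis
    unfolding packs_into_def
  proof (intro exI[of _ h] conjI allI impI)
    fix i assume "i < length (xs @ ys)"
    then show "h i < m + m'" using f(1)[of i] g(1)[of "i - length xs"] by (auto simp: h_def)
  next
    fix b assume b: "b < m + m'"
    show "(\<Sum>i | i < length (xs @ ys) \<and> h i = b. (xs @ ys) ! i) \<le> 1"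
    proof (cases "b < m")
      case True
      have "{i. i < length (xs @ ys) \<and> h i = b} = {i. i < length xs \<and> f i = b}"
        using True by (auto simp: h_def)
      then have "(\<Sum>i | i < length (xs @ ys) \<and> h i = b. (xs @ ys) ! i)
          = (\<Sum>i | i < length xs \<and> f i = b. xs ! i)"
        by (auto intro: sum.cong simp: nth_append)
      with f(2)[OF True] show ?thesis by simp
    next
      case False
      have "bij_betw (\<lambda>i. i + length xs) {i. i < length ys \<and> g i = b - m} {i. i < length (xs @ ys) \<and> h i = b}"
      proof (rule bij_betwI[where g="\<lambda>i. i - length xs"])
        show "(\<lambda>i. i - length xs) \<in> {i. i < length (xs @ ys) \<and> h i = b} \<rightarrow> {i. i < length ys \<and> g i = b - m}"
        proof
          fix i assume "i \<in> {i. i < length (xs @ ys) \<and> h i = b}"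
          then show "i - length xs \<in> {i. i < length ys \<and> g i = b - m}"
            using False f(1)[of i] by (auto simp: h_def split: if_splits)
        qed
        show "i - length xs + length xs = i" if "i \<in> {i. i < length (xs @ ys) \<and> h i = b}" for i
          using that False f(1)[of i] by (auto simp: h_def split: if_splits)
      qed (use False in \<open>auto simp: h_def\<close>)
      from sum.reindex_bij_betw[OF this, of "\<lambda>i. (xs @ ys) ! i"]
      have "(\<Sum>i | i < length (xs @ ys) \<and> h i = b. (xs @ ys) ! i)
          = (\<Sum>i | i < length ys \<and> g i = b - m. ys ! i)"
        by (simp add: nth_append)
      with g(2)[of "b - m"] False b show ?thesis by simp
    qed
  qed
qed

lemma packs_into_Nil: "packs_into [] 0"
  by (simp add: packs_into_def)

lemma packs_into_copies: "packs_into xs m \<Longrightarrow> packs_into (concat (replicate n xs)) (n * m)"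
  by (induction n) (auto simp: packs_into_Nil intro: packs_into_append)

lemma packs_into_length:
  assumes "set xs \<subseteq> {0<..1}"
  shows "packs_into xs (length xs)"
  unfolding packs_into_def
proof (intro exI[of _ "\<lambda>i. i"] conjI allI impI)
  fix b assume "b < length xs"
  then have "{i. i < length xs \<and> i = b} = {b}" "xs ! b \<in> {0<..1}" using assms nth_mem by blast+
  then show "(\<Sum>i | i < length xs \<and> i = b. xs ! i) \<le> 1" by simp
qed

lemma packs_into_opt_bins: "set xs \<subseteq> {0<..1} \<Longrightarrow> packs_into xs (opt_bins xs)"
  unfolding opt_bins_def by (rule LeastI, rule packs_into_length)

lemma opt_bins_le: "packs_into xs m \<Longrightarrow> opt_bins xs \<le> m"
  unfolding opt_bins_def by (rule Least_le)

lemma sum_list_le_packs_into: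
  assumes "packs_into xs m"
  shows "sum_list xs \<le> real m"
proof -
  obtain f where f: "\<And>i. i < length xs \<Longrightarrow> f i < m"
    "\<And>b. b < m \<Longrightarrow> (\<Sum>i | i < length xs \<and> f i = b. xs ! i) \<le> 1"
    using assms(1) unfolding packs_into_def by blast
  have "sum_list xs = (\<Sum>i\<in>{..<length xs}. xs ! i)"
    by (simp add: sum_list_sum_nth atLeast0LessThan)
  also have "\<dots> = (\<Sum>b<m. \<Sum>i\<in>{i\<in>{..<length xs}. f i = b}. xs ! i)"
    by (rule sum.group[symmetric]) (use f(1) in auto)
  also have "\<dots> \<le> (\<Sum>b<m. 1)"
    using f(2) by (intro sum_mono) auto
  finally show ?thesis by simp
qed

text \<open>The two runs never drift apart by more than one bin: when the fuller one has to open a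
  bin, it continues with level \<open>x\<close> and the other with \<open>l + x\<close>, so the
  order of the levels is reversed. Both inequalities are proved together because this reversal
  exchanges their roles.\<close>

lemma next_fit_from_mono:
  assumes "0 \<le> l" "l \<le> l'" "\<And>x. x \<in> set xs \<Longrightarrow> 0 \<le> x"
  shows "next_fit_from l xs \<le> next_fit_from l' xs \<and> next_fit_from l' xs \<le> Suc (next_fit_from l xs)"
  using assms
proof (induction xs arbitrary: l l')
  case (Cons x xs)
  then have "0 \<le> x" by simp
  consider "l' + x \<le> 1" | "l + x \<le> 1" "\<not> l' + x \<le> 1" | "\<not> l + x \<le> 1" "\<not> l' + x \<le> 1" by linarith
  then show ?case
  proof cases
    case 1
    with Cons.prems Cons.IH[of "l + x" "l' + x"] show ?thesis by auto
  next
    case 2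
    with Cons.prems Cons.IH[of x "l + x"] show ?thesis by auto
  qed (use Cons.prems in auto)
qed simp

text \<open>Cutting the input replaces the level reached after \<open>xs\<close> by an empty bin. A
  lower level never needs more bins, so the only loss is the fresh bin opened for
  \<open>ys\<close>.\<close>

lemma next_fit_from_append:
  assumes "\<And>x. x \<in> set ys \<Longrightarrow> 0 < x \<and> x \<le> 1" "0 \<le> l" "\<And>x. x \<in> set xs \<Longrightarrow> 0 \<le> x"
  shows "next_fit_from l xs + next_fit ys \<le> Suc (next_fit_from l (xs @ ys))"
  using assms(2,3)
proof (induction xs arbitrary: l)
  case Nil
  show ?case
  proof (cases ys)
    case (Cons y zs)
    have "next_fit_from 0 ys \<le> next_fit_from l ys"
      using next_fit_from_mono[of 0 l ys] assms(1) Nil by (auto simp: less_imp_le)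
    moreover have "next_fit_from 0 ys = next_fit_from y zs"
      using assms(1) Cons by simp
    ultimately show ?thesis using Cons by simp
  qed simp
next
  case (Cons x xs)
  then show ?case by auto
qed

lemma next_fit_append:
  assumes "\<And>x. x \<in> set ys \<Longrightarrow> 0 < x \<and> x \<le> 1" "\<And>x. x \<in> set xs \<Longrightarrow> 0 \<le> x"
  shows "next_fit xs + next_fit ys \<le> Suc (next_fit (xs @ ys))"
  using next_fit_from_append[of ys] assms by (cases xs) auto

lemma next_fit_concat:
  assumes "\<And>xs x. xs \<in> set xss \<Longrightarrow> x \<in> set xs \<Longrightarrow> 0 < x \<and> x \<le> 1"
  shows "(\<Sum>xs\<leftarrow>xss. next_fit xs) \<le> next_fit (concat xss) + length xss"
  using assms
proof (induction xss)
  case (Cons xs xss)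
  have "next_fit xs + next_fit (concat xss) \<le> Suc (next_fit (xs @ concat xss))"
    by (rule next_fit_append) (use Cons.prems in \<open>fastforce simp: less_imp_le\<close>)+
  moreover have "(\<Sum>xs\<leftarrow>xss. next_fit xs) \<le> next_fit (concat xss) + length xss"
    using Cons by auto
  ultimately show ?case by simp
qed simp

text \<open>\<open>c\<close> counts the items credited to the open bin. A bin holds at most
  \<open>j\<close> of them because \<open>j + 1\<close> would exceed 1; the hypothesis
  \<open>real c * s <= l\<close> is what keeps \<open>c <= j\<close> when another item fits.\<close>

lemma length_le_next_fit_from:
  assumes "\<And>x. x \<in> set xs \<Longrightarrow> s \<le> x" "1 < real (Suc j) * s" "real c * s \<le> l" "c \<le> j" "1 \<le> j"
  shows "length xs + c \<le> j * Suc (next_fit_from l xs)"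
  using assms
proof (induction xs arbitrary: l c)
  case (Cons x xs)
  show ?case
  proof (cases "l + x \<le> 1")
    case True
    have le: "real (Suc c) * s \<le> l + x" using Cons.prems(1)[of x] Cons.prems(3) by (simp add: algebra_simps)
    have "0 < s" using Cons.prems(2) by (metis less_trans not_less_iff_gr_or_eq of_nat_0_less_iff zero_less_Suc zero_less_mult_pos zero_less_one)
    have "real (Suc c) * s < real (Suc j) * s" using le True Cons.prems(2) by linarith
    then have "Suc c \<le> j" using \<open>0 < s\<close> by (simp add: mult_less_cancel_right)
    with Cons.IH[of "Suc c" "l + x"] Cons.prems le True show ?thesis by auto
  next
    case False
    have "length xs + 1 \<le> j * Suc (next_fit_from x xs)"
      by (rule Cons.IH) (use Cons.prems in auto)
    with Cons.prems(4) False show ?thesis by simp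
  qed
qed simp

lemma length_le_next_fit:
  assumes "\<And>x. x \<in> set xs \<Longrightarrow> s \<le> x" "1 < real (Suc j) * s" "1 \<le> j"
  shows "length xs \<le> j * next_fit xs"
proof (cases xs)
  case (Cons x ys)
  with length_le_next_fit_from[of ys s j 1 x] assms show ?thesis by auto
qed simp

lemma next_fit_le_sum_list:
  assumes "\<And>x. x \<in> set xs \<Longrightarrow> 0 \<le> x"
  shows "real (next_fit xs) \<le> 2 * sum_list xs + 1"
proof -
  \<comment> \<open>The level is a potential: opening a bin for \<open>x\<close> costs 1, which is
    less than \<open>l + x\<close>; so \<open>l\<close> and one copy of \<open>x\<close> pay for the
    bin, and the other copy is the new potential.\<close>
  have "real (next_fit_from l xs) \<le> 2 * sum_list xs + l" if "0 \<le> l" "\<And>x. x \<in> set xs \<Longrightarrow> 0 \<le> x" for l xs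
    using that
  proof (induction xs arbitrary: l)
    case (Cons x xs)
    have "0 \<le> x" using Cons.prems by simp
    moreover have "real (next_fit_from (l + x) xs) \<le> 2 * sum_list xs + (l + x)"
      "real (next_fit_from x xs) \<le> 2 * sum_list xs + x"
      using Cons.prems \<open>0 \<le> x\<close> by (auto intro!: Cons.IH)
    ultimately show ?case using Cons.prems(1) by (cases "l + x \<le> 1") simp_all
  qed simp
  from this[of "hd xs" "tl xs"] assms show ?thesis
    by (cases xs) (auto intro: order_trans)
qed

lemma next_fit_uniform:
  assumes "\<And>x. x \<in> set xs \<Longrightarrow> x = 1 / real g" "g \<ge> 1"
  shows "real (next_fit xs) \<le> sum_list xs + 1"
proof -
  \<comment> \<open>Every level is a multiple \<open>c / g\<close> of the common size, and a bin is
    closed only when \<open>c = g\<close>: space is wasted in the last bin only.\<close>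
  have "real (next_fit_from (real c / real g) xs) \<le> sum_list xs + real c / real g"
    if "c \<le> g" "1 \<le> c" "\<And>x. x \<in> set xs \<Longrightarrow> x = 1 / real g" for c xs
    using that
  proof (induction xs arbitrary: c)
    case (Cons x xs)
    have x: "x = 1 / real g" using Cons.prems by simp
    have fit: "real c / real g + x \<le> 1 \<longleftrightarrow> Suc c \<le> g"
      using assms(2) by (simp add: x add_divide_distrib[symmetric] field_simps flip: of_nat_Suc)
    have sum: "real c / real g + x = real (Suc c) / real g" by (simp add: x add_divide_distrib)
    show ?case
    proof (cases "Suc c \<le> g")
      case True
      then have "real (next_fit_from (real (Suc c) / real g) xs) \<le> sum_list xs + real (Suc c) / real g"
        using Cons.prems by (intro Cons.IH) auto
      then have "real (next_fit_from (real c / real g) (x # xs)) \<le> sum_list xs + real (Suc c) / real g"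
        using True fit sum by (simp del: of_nat_Suc)
      then show ?thesis using sum by (simp del: of_nat_Suc)
    next
      case False
      then have "c = g" using Cons.prems by simp
      have "real (next_fit_from (real 1 / real g) xs) \<le> sum_list xs + real 1 / real g"
        using Cons.prems assms(2) by (intro Cons.IH) auto
      with False fit \<open>c = g\<close> assms(2) show ?thesis by (simp add: x)
    qed
  qed simp
  from this[of 1 "tl xs"] assms show ?thesis by (cases xs) fastforce+
qed

section \<open>The harmonic size classes partition the sizes\<close>

lemma in_harmonic_class_unique:
  assumes "in_harmonic_class k i x" "in_harmonic_class k j x" "i \<in> {1..k}" "j \<in> {1..k}"
  shows "i = j"
proof -
  have *: False if "in_harmonic_class k i x" "in_harmonic_class k j x" "i < j" "1 \<le> i" "j \<le> k" for i j
  proof -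
    have "1 / real (i + 1) < x" using that by (simp add: in_harmonic_class_def)
    moreover have "x \<le> 1 / real j" using that by (auto simp: in_harmonic_class_def split: if_splits)
    moreover have "1 / real j \<le> 1 / real (i + 1)" using that by (intro divide_left_mono) auto
    ultimately show False by linarith
  qed
  show ?thesis using *[of i j] *[of j i] assms by (cases i j rule: linorder_cases) auto
qed

lemma in_harmonic_class_exists:
  assumes "0 < x" "x \<le> 1" "1 \<le> k"
  shows "\<exists>j\<in>{1..k}. in_harmonic_class k j x"
proof (cases "x \<le> 1 / real k")
  case True
  then show ?thesis using assms by (intro bexI[of _ k]) (auto simp: in_harmonic_class_def)
next
  case False
  define j where "j = nat \<lfloor>1 / x\<rfloor>"
  have 1: "1 \<le> 1 / x" using assms by simp
  then have j: "1 \<le> j" unfolding j_def by linarith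
  have "real j \<le> 1 / x" "1 / x < real j + 1" unfolding j_def using 1 by linarith+
  then have "x \<le> 1 / real j" "1 / real (j + 1) < x"
    using assms j by (auto simp: field_simps)
  moreover have "j < k"
  proof (rule ccontr)
    assume "\<not> j < k"
    then have "1 / real j \<le> 1 / real k" using assms(3) by (intro divide_left_mono) auto
    with False \<open>x \<le> 1 / real j\<close> show False by linarith
  qed
  ultimately show ?thesis using j by (intro bexI[of _ j]) (auto simp: in_harmonic_class_def)
qed

lemma sum_harmonic_classes:
  assumes "set xs \<subseteq> {0<..1}" "1 \<le> k"
  shows "(\<Sum>j=1..k. \<Sum>x\<leftarrow>filter (in_harmonic_class k j) xs. (f x :: 'b :: comm_monoid_add)) = (\<Sum>x\<leftarrow>xs. f x)"
  using assms(1)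
proof (induction xs)
  case (Cons x xs)
  then obtain i where i: "i \<in> {1..k}" "in_harmonic_class k i x"
    using in_harmonic_class_exists[of x k] assms(2) by auto
  have "(\<Sum>j=1..k. \<Sum>y\<leftarrow>filter (in_harmonic_class k j) (x # xs). f y)
      = (\<Sum>j=1..k. (if in_harmonic_class k j x then f x else 0) + (\<Sum>y\<leftarrow>filter (in_harmonic_class k j) xs. f y))"
    by (intro sum.cong) auto
  also have "\<dots> = (\<Sum>j=1..k. if in_harmonic_class k j x then f x else 0) + (\<Sum>y\<leftarrow>xs. f y)"
    using Cons by (simp add: sum.distrib)
  also have "(\<Sum>j=1..k. if in_harmonic_class k j x then f x else 0) = (\<Sum>j=1..k. if j = i then f x else 0)"
  proof (intro sum.cong refl)
    fix j assume "j \<in> {1..k}"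
    then have "in_harmonic_class k j x \<longleftrightarrow> j = i" using i in_harmonic_class_unique[of k j x i] by blast
    then show "(if in_harmonic_class k j x then f x else 0) = (if j = i then f x else 0)" by simp
  qed
  also have "\<dots> = f x" using i by simp
  finally show ?case by simp
qed simp

section \<open>Bounds on the asymptotic ratio of Harmonic\<close>

definition harmonic_bound :: "nat \<Rightarrow> real \<Rightarrow> bool" where
  "harmonic_bound k R \<longleftrightarrow> (\<exists>c. \<forall>xs. set xs \<subseteq> {0<..1} \<longrightarrow>
     real (harmonic_bins k xs) \<le> R * real (opt_bins xs) + c)"

lemma harmonic_ratio_alt: "harmonic_ratio k = Inf (Collect (harmonic_bound k))"
  unfolding harmonic_ratio_def harmonic_bound_def ..

lemma sum_list_le_opt_bins: "set xs \<subseteq> {0<..1} \<Longrightarrow> sum_list xs \<le> real (opt_bins xs)"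
  by (intro sum_list_le_packs_into packs_into_opt_bins)

text \<open>Makes the set behind the infimum \<open>harmonic_ratio\<close> nonempty and bounds the
  ratio by 2, which the balancing of the error terms uses later.\<close>

lemma harmonic_bound_2:
  assumes "1 \<le> k"
  shows "harmonic_bound k 2"
  unfolding harmonic_bound_def
proof (intro exI[of _ "real k"] allI impI)
  fix xs :: "real list" assume xs: "set xs \<subseteq> {0<..1}"
  have "real (harmonic_bins k xs) = (\<Sum>j=1..k. real (next_fit (filter (in_harmonic_class k j) xs)))"
    by (simp add: harmonic_bins_def)
  also have "\<dots> \<le> (\<Sum>j=1..k. 2 * sum_list (filter (in_harmonic_class k j) xs) + 1)"
    by (intro sum_mono next_fit_le_sum_list) (use xs in \<open>auto simp: subset_iff\<close>)
  also have "\<dots> = 2 * sum_list xs + real k"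
    using sum_harmonic_classes[OF xs assms, of "\<lambda>x. x"] by (simp add: sum.distrib flip: sum_distrib_left)
  also have "\<dots> \<le> 2 * real (opt_bins xs) + real k" using sum_list_le_opt_bins[OF xs] by simp
  finally show "real (harmonic_bins k xs) \<le> 2 * real (opt_bins xs) + real k" .
qed

text \<open>Repeating an input makes the additive constant of an asymptotic bound negligible.\<close>

lemma harmonic_bins_copies:
  assumes "set xs \<subseteq> {0<..1}"
  shows "n * harmonic_bins k xs \<le> harmonic_bins k (concat (replicate n xs)) + n * k"
proof -
  have "n * next_fit (filter P xs) \<le> next_fit (filter P (concat (replicate n xs))) + n" for P
    using next_fit_concat[of "replicate n (filter P xs)"] assms
    by (auto simp: filter_concat sum_list_replicate subset_iff)
  then have "(\<Sum>j=1..k. n * next_fit (filter (in_harmonic_class k j) xs))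
      \<le> (\<Sum>j=1..k. next_fit (filter (in_harmonic_class k j) (concat (replicate n xs))) + n)"
    by (intro sum_mono)
  then show ?thesis by (simp add: harmonic_bins_def sum_distrib_left sum.distrib mult.commute)
qed

text \<open>For \<open>n\<close> copies the bins and the optimum scale with \<open>n\<close>, up to
  the loss \<open>n * k\<close> from joining the copies, whereas \<open>c\<close> stays fixed;
  letting \<open>n\<close> grow removes \<open>c\<close>. The new constant \<open>k\<close> is the
  same for all \<open>R\<close>, which is what allows passing to the infimum.\<close>

lemma harmonic_bound_explicit:
  assumes "harmonic_bound k R" "set xs \<subseteq> {0<..1}" "0 \<le> R"
  shows "real (harmonic_bins k xs) \<le> R * real (opt_bins xs) + real k"
proof -
  obtain c where c: "\<And>xs. set xs \<subseteq> {0<..1} \<Longrightarrow> real (harmonic_bins k xs) \<le> R * real (opt_bins xs) + c"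
    using assms(1) unfolding harmonic_bound_def by blast
  have "real n * (real (harmonic_bins k xs) - R * real (opt_bins xs) - real k) \<le> c" for n
  proof -
    have "real (opt_bins (concat (replicate n xs))) \<le> real n * real (opt_bins xs)"
      using opt_bins_le[OF packs_into_copies[OF packs_into_opt_bins[OF assms(2)]], of n]
      by (metis of_nat_le_iff of_nat_mult)
    then have "R * real (opt_bins (concat (replicate n xs))) \<le> R * (real n * real (opt_bins xs))"
      using assms(3) by (rule mult_left_mono)
    moreover have "real (harmonic_bins k (concat (replicate n xs))) \<le> R * real (opt_bins (concat (replicate n xs))) + c"
      by (rule c) (use assms(2) in auto)
    moreover have "real n * real (harmonic_bins k xs) \<le> real (harmonic_bins k (concat (replicate n xs))) + real n * real k"
      using harmonic_bins_copies[OF assms(2), of n k] by (metis of_nat_add of_nat_le_iff of_nat_mult)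
    ultimately show ?thesis by (simp add: algebra_simps)
  qed
  then show ?thesis
    using ex_less_of_nat_mult[of "real (harmonic_bins k xs) - R * real (opt_bins xs) - real k" c]
    by (metis diff_le_0_iff_le diff_diff_eq leD not_le_imp_less)
qed

lemma harmonic_bound_ge:
  assumes "harmonic_bound k R" "set xs \<subseteq> {0<..1}" "packs_into xs 1" "0 < a"
    "\<And>n. a * real n \<le> real (harmonic_bins k (concat (replicate n xs)))"
  shows "a \<le> R"
proof -
  obtain c where c: "\<And>xs. set xs \<subseteq> {0<..1} \<Longrightarrow> real (harmonic_bins k xs) \<le> R * real (opt_bins xs) + c"
    using assms(1) unfolding harmonic_bound_def by blast
  \<comment> \<open>\<open>R\<close> may still be negative here, and then the upper bound on
    \<open>opt_bins\<close> cannot be multiplied by it. Since \<open>a\<close> is positive, a bound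
    on \<open>max R 0\<close> is as good.\<close>
  have "real n * (a - max R 0) \<le> c" for n
  proof -
    have "real (opt_bins (concat (replicate n xs))) \<le> real n"
      using opt_bins_le[OF packs_into_copies[OF assms(3), of n]] by simp
    then have "R * real (opt_bins (concat (replicate n xs))) \<le> max R 0 * real n"
      by (intro mult_mono) auto
    moreover have "real (harmonic_bins k (concat (replicate n xs)))
        \<le> R * real (opt_bins (concat (replicate n xs))) + c"
      by (rule c) (use assms(2) in auto)
    ultimately show ?thesis using assms(5)[of n] by (simp add: algebra_simps)
  qed
  then have "a \<le> max R 0"
    using ex_less_of_nat_mult[of "a - max R 0" c] by (meson diff_gt_0_iff_gt leD not_le_imp_less)
  with assms(4) show ?thesis by linarith
qed

text \<open>One size just above 1/2, one just above 1/3 and one in (1/7,1/6], filling a bin exactly.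
  Harmonic puts at most 1, 2 and 6 of them into a bin, so a copy costs 1 + 1/2 + 1/6 = 5/3 bins. The
  sizes imitate 1/2, 1/3, 1/7, the start of the Sylvester series behind the limit 1.691.\<close>

definition hard_input :: "real list" where
  "hard_input = [51/100, 34/100, 15/100]"

lemma hard_input_bins:
  "real n \<le> real j * real (next_fit (filter (in_harmonic_class k j) (concat (replicate n hard_input))))"
  if "j \<in> {1, 2, 6}" "j < k"
proof -
  define s :: real where "s = (if j = 1 then 51/100 else if j = 2 then 34/100 else 15/100)"
  have "filter (in_harmonic_class k j) hard_input = [s]"
    using that by (auto simp: hard_input_def in_harmonic_class_def s_def)
  then have *: "filter (in_harmonic_class k j) (concat (replicate n hard_input)) = replicate n s"
    by (induction n) auto
  have "length (replicate n s) \<le> j * next_fit (replicate n s)"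
    by (rule length_le_next_fit[of _ s]) (use that in \<open>auto simp: s_def\<close>)
  then show ?thesis unfolding * by (metis length_replicate of_nat_le_iff of_nat_mult)
qed

lemma hard_input: "set hard_input \<subseteq> {0<..1}" "packs_into hard_input 1"
proof -
  show "packs_into hard_input 1"
    unfolding packs_into_def
    by (rule exI[of _ "\<lambda>_. 0"]) (auto simp: hard_input_def lessThan_def[symmetric] lessThan_Suc)
qed (auto simp: hard_input_def)

text \<open>Classes 1 and 2 are bounded away from 0 as soon as \<open>k >= 3\<close>. Class 6 is so
  only if \<open>6 < k\<close>; for smaller \<open>k\<close> the third size falls into the last
  class and is not counted.\<close>

lemma harmonic_bound_lower:
  assumes "harmonic_bound k R" "k \<ge> 3"
  shows "3/2 \<le> R" "k \<ge> 7 \<Longrightarrow> 5/3 \<le> R"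
proof -
  define nf where "nf n j = real (next_fit (filter (in_harmonic_class k j) (concat (replicate n hard_input))))" for n j
  have nf: "real n \<le> real j * nf n j" if "j \<in> {1, 2, 6}" "j < k" for n j
    unfolding nf_def using hard_input_bins[OF that] .
  have bins: "sum (nf n) J \<le> real (harmonic_bins k (concat (replicate n hard_input)))" if "J \<subseteq> {1..k}" for n J
    unfolding harmonic_bins_def nf_def of_nat_sum using that by (intro sum_mono2) auto
  show "3/2 \<le> R"
  proof (intro harmonic_bound_ge[OF assms(1) hard_input])
    fix n
    have "sum (nf n) {1,2} \<le> real (harmonic_bins k (concat (replicate n hard_input)))"
      by (rule bins) (use assms(2) in auto)
    then show "3/2 * real n \<le> real (harmonic_bins k (concat (replicate n hard_input)))"
      using nf[of 1 n] nf[of 2 n] assms(2) by simp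
  qed simp
  show "5/3 \<le> R" if "k \<ge> 7"
  proof (intro harmonic_bound_ge[OF assms(1) hard_input])
    fix n
    have "sum (nf n) {1,2,6} \<le> real (harmonic_bins k (concat (replicate n hard_input)))"
      by (rule bins) (use that in auto)
    then show "5/3 * real n \<le> real (harmonic_bins k (concat (replicate n hard_input)))"
      using nf[of 1 n] nf[of 2 n] nf[of 6 n] that by simp
  qed simp
qed

lemma harmonic_ratio_bounds:
  assumes "k \<ge> 3"
  shows "3/2 \<le> harmonic_ratio k" "k \<ge> 7 \<Longrightarrow> 5/3 \<le> harmonic_ratio k" "harmonic_ratio k \<le> 2"
proof -
  have 2: "2 \<in> Collect (harmonic_bound k)" using harmonic_bound_2 assms by simp
  show "3/2 \<le> harmonic_ratio k" "k \<ge> 7 \<Longrightarrow> 5/3 \<le> harmonic_ratio k"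
    unfolding harmonic_ratio_alt using 2 harmonic_bound_lower[OF _ assms]
    by (auto intro!: cInf_greatest simp del: divide_le_eq_numeral1)
  have "bdd_below (Collect (harmonic_bound k))"
    by (rule bdd_belowI[of _ "3/2"]) (use harmonic_bound_lower(1)[OF _ assms] in auto)
  then show "harmonic_ratio k \<le> 2"
    unfolding harmonic_ratio_alt using 2 by (rule cInf_lower[rotated])
qed

text \<open>The infimum need not be attained, but every admissible \<open>R\<close> satisfies the
  inequality with the same constant \<open>k\<close>, so it survives in the limit. Dividing by
  \<open>opt_bins\<close> turns it into a lower bound on all admissible \<open>R\<close>; hence the
  separate case of zero bins.\<close>

theorem harmonic_bins_le:
  assumes "k \<ge> 3" "set xs \<subseteq> {0<..1}"
  shows "real (harmonic_bins k xs) \<le> harmonic_ratio k * real (opt_bins xs) + real k"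
proof (cases "opt_bins xs = 0")
  case True
  then show ?thesis
    using harmonic_bound_explicit[OF harmonic_bound_2 assms(2)] assms(1) by simp
next
  case False
  have "(real (harmonic_bins k xs) - real k) / real (opt_bins xs) \<le> harmonic_ratio k"
    unfolding harmonic_ratio_alt
  proof (rule cInf_greatest)
    show "Collect (harmonic_bound k) \<noteq> {}" using harmonic_bound_2[of k] assms(1) by auto
    fix R assume "R \<in> Collect (harmonic_bound k)"
    then show "(real (harmonic_bins k xs) - real k) / real (opt_bins xs) \<le> R"
      using harmonic_bound_explicit[OF _ assms(2), of k R] harmonic_bound_lower(1)[OF _ assms(1), of R] False
      by (simp add: field_simps)
  qed
  then show ?thesis using False by (simp add: field_simps)
qed

section \<open>Loads\<close>

text \<open>The index in the instance keeps equal requests apart, so that lists of items are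
  distinct and can be treated as sets.\<close>

type_synonym item = "nat \<times> request"

abbreviation item_active :: "item \<Rightarrow> real \<Rightarrow> bool" where
  "item_active x \<equiv> active (snd x)"

text \<open>The weight is a parameter: \<open>item_weight\<close> gives the total size, the constant
  1 the number of active items, and \<open>block_weight\<close> the quantity that a layer has to
  cover.\<close>

definition load :: "(item \<Rightarrow> real) \<Rightarrow> item list \<Rightarrow> real \<Rightarrow> real" where
  "load v xs t = (\<Sum>x\<leftarrow>xs. if item_active x t then v x else 0)"

abbreviation item_weight :: "item \<Rightarrow> real" where
  "item_weight x \<equiv> weight (snd x)"

abbreviation item_start :: "item \<Rightarrow> real" where
  "item_start x \<equiv> start (snd x)"

abbreviation item_finish :: "item \<Rightarrow> real" where
  "item_finish x \<equiv> finish (snd x)"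

lemma load_Nil [simp]: "load v [] t = 0"
  and load_Cons [simp]: "load v (x # xs) t = (if item_active x t then v x else 0) + load v xs t"
  and load_append [simp]: "load v (xs @ ys) t = load v xs t + load v ys t"
  by (simp_all add: load_def)

lemma load_mset_cong: "mset xs = mset ys \<Longrightarrow> load v xs t = load v ys t"
  by (simp add: load_def flip: sum_mset_sum_list)

lemma load_nonneg: "(\<And>x. x \<in> set xs \<Longrightarrow> 0 \<le> v x) \<Longrightarrow> 0 \<le> load v xs t"
  unfolding load_def by (intro sum_list_nonneg) auto

lemma load_filter_mono:
  "(\<And>x. x \<in> set xs \<Longrightarrow> 0 \<le> v x) \<Longrightarrow> (\<And>x. x \<in> set xs \<Longrightarrow> P x \<Longrightarrow> Q x) \<Longrightarrow>
   load v (filter P xs) t \<le> load v (filter Q xs) t"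
  by (induction xs) (auto intro: add_increasing)

lemma load_split: "load v xs t = load v (filter P xs) t + load v (filter (\<lambda>x. \<not> P x) xs) t"
  by (induction xs) auto

lemma load_cong:
  "(\<And>x. x \<in> set xs \<Longrightarrow> item_active x t = item_active x t') \<Longrightarrow> load v xs t = load v xs t'"
  by (induction xs) auto

lemma load_mono_fun:
  "(\<And>x. x \<in> set xs \<Longrightarrow> item_active x t \<Longrightarrow> v x \<le> u x) \<Longrightarrow> load v xs t \<le> load u xs t"
  unfolding load_def by (intro sum_list_mono) auto

lemma load_scale: "load (\<lambda>x. a * v x) xs t = a * load v xs t"
  by (induction xs) (auto simp: algebra_simps)

lemma load_eq_sum:
  "distinct xs \<Longrightarrow> load v xs t = (\<Sum>x\<in>{x\<in>set xs. item_active x t}. v x)"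
  unfolding load_def by (simp add: sum_list_distinct_conv_sum_set sum.inter_filter)

lemma load_eq_0: "(\<And>x. x \<in> set xs \<Longrightarrow> \<not> item_active x t) \<Longrightarrow> load v xs t = 0"
  by (induction xs) auto

lemma load_pos:
  "(\<And>x. x \<in> set xs \<Longrightarrow> 0 < v x) \<Longrightarrow> x \<in> set xs \<Longrightarrow> item_active x t \<Longrightarrow> 0 < load v xs t"
proof (induction xs)
  case (Cons y ys)
  have "0 \<le> load v ys t" using Cons.prems(1) by (intro load_nonneg) (auto intro: less_imp_le)
  with Cons show ?case by (auto simp: add_pos_nonneg intro: add_nonneg_pos less_imp_le)
qed simp

section \<open>Packing by Any-Fit\<close>

text \<open>Items are placed in the order of their start times, so the load of a machine during \<open>x\<close> is
  largest at the start of \<open>x\<close>.\<close>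

definition fits :: "item list \<Rightarrow> item \<Rightarrow> bool" where
  "fits g x \<longleftrightarrow> load item_weight g (item_start x) + item_weight x \<le> 1"

text \<open>The flag says that \<open>x\<close> has already been placed, since a fold cannot stop
  early. The fold reverses the order of the machines; this is harmless because any machine with
  enough room may be taken.\<close>

definition place_step :: "item \<Rightarrow> item list \<Rightarrow> bool \<times> item list list \<Rightarrow> bool \<times> item list list" where
  "place_step x g s = (if \<not> fst s \<and> fits g x then (True, (x # g) # snd s) else (fst s, g # snd s))"

definition place :: "item \<Rightarrow> item list list \<Rightarrow> item list list" where
  "place x gs = (let s = fold (place_step x) gs (False, []) in if fst s then snd s else [x] # snd s)"

definition any_fit :: "item list \<Rightarrow> item list list" where
  "any_fit xs = fold place xs []"

lemma fold_place_step_True: "fold (place_step x) gs (True, out) = (True, rev gs @ out)"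
  by (induction gs arbitrary: out) (auto simp: place_step_def)

lemma fold_place_step_False:
  "\<forall>g\<in>set gs. \<not> fits g x \<Longrightarrow> fold (place_step x) gs (False, out) = (False, rev gs @ out)"
  by (induction gs arbitrary: out) (auto simp: place_step_def)

text \<open>Adding \<open>g\<close> on both sides expresses the replacement of \<open>g\<close> by
  \<open>x # g\<close> without subtraction of multisets.\<close>

lemma place_cases:
  obtains (fit) g where "g \<in> set gs" "fits g x" "add_mset g (mset (place x gs)) = add_mset (x # g) (mset gs)"
    | (no_fit) "\<And>g. g \<in> set gs \<Longrightarrow> \<not> fits g x" "mset (place x gs) = add_mset [x] (mset gs)"
proof (cases "\<exists>g\<in>set gs. fits g x")
  case True
  then obtain ys g zs where gs: "gs = ys @ g # zs" "fits g x" "\<forall>h\<in>set ys. \<not> fits h x"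
    using split_list_first_prop[of gs "\<lambda>g. fits g x"] by blast
  then have "place x gs = rev zs @ (x # g) # rev ys"
    by (simp add: place_def fold_place_step_False fold_place_step_True place_step_def[of x g])
  with gs show ?thesis by (intro fit[of g]) auto
next
  case False
  then have "place x gs = [x] # rev gs"
    by (simp add: place_def fold_place_step_False)
  with False show ?thesis by (intro no_fit) auto
qed

lemma mset_concat_place: "mset (concat (place x gs)) = add_mset x (mset (concat gs))"
proof (cases rule: place_cases[of gs x])
  case (fit g)
  then have "sum_mset (image_mset mset (add_mset g (mset (place x gs))))
      = sum_mset (image_mset mset (add_mset (x # g) (mset gs)))" by simp
  then show ?thesis by (simp add: mset_concat flip: sum_mset_sum_list)
next
  case no_fit
  then show ?thesis by (simp add: mset_concat flip: sum_mset_sum_list)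
qed

lemma any_fit_snoc: "any_fit (xs @ [x]) = place x (any_fit xs)"
  by (simp add: any_fit_def)

lemma any_fit_Nil [simp]: "any_fit [] = []"
  by (simp add: any_fit_def)

lemma mset_concat_any_fit: "mset (concat (any_fit xs)) = mset xs"
  by (induction xs rule: rev_induct) (simp_all add: any_fit_snoc mset_concat_place)

lemma any_fit_not_Nil: "[] \<notin> set (any_fit xs)"
proof (induction xs rule: rev_induct)
  case (snoc x xs)
  show ?case
  proof (cases rule: place_cases[of "any_fit xs" x])
    case (fit g)
    with snoc have "[] \<notin># add_mset g (mset (place x (any_fit xs)))" by simp
    then show ?thesis by (simp add: any_fit_snoc)
  qed (use snoc in \<open>simp add: any_fit_snoc flip: set_mset_mset\<close>)
qed simp

definition machine_ok :: "item list \<Rightarrow> bool" where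
  "machine_ok g \<longleftrightarrow> (\<forall>t. load item_weight g t \<le> 1)"

lemma machine_ok_Cons:
  assumes "machine_ok g" "fits g x" "\<And>y. y \<in> set g \<Longrightarrow> item_start y \<le> item_start x \<and> 0 \<le> item_weight y"
  shows "machine_ok (x # g)"
  unfolding machine_ok_def
proof
  fix t
  show "load item_weight (x # g) t \<le> 1"
  proof (cases "item_active x t")
    case True
    have "load item_weight g t \<le> load item_weight g (item_start x)"
      unfolding load_def
    proof (rule sum_list_mono)
      fix y assume "y \<in> set g"
      with assms(3)[of y] True
      show "(if item_active y t then item_weight y else 0)
          \<le> (if item_active y (item_start x) then item_weight y else 0)"
        by (auto simp: active_def)
    qed
    with assms(2) True show ?thesis by (simp add: fits_def)
  qed (use assms(1) in \<open>simp add: machine_ok_def\<close>)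
qed

lemma any_fit_ok:
  assumes "sorted (map item_start xs)" "\<And>x. x \<in> set xs \<Longrightarrow> 0 \<le> item_weight x \<and> item_weight x \<le> 1"
  shows "\<forall>g\<in>set (any_fit xs). machine_ok g"
  using assms
proof (induction xs rule: rev_induct)
  case (snoc x xs)
  then have IH: "\<forall>g\<in>set (any_fit xs). machine_ok g" by (simp add: sorted_append)
  show ?case
  proof (cases rule: place_cases[of "any_fit xs" x])
    case (fit g)
    have "y \<in> set xs" if "y \<in> set g" for y
      using mset_eq_setD[OF mset_concat_any_fit[of xs]] that fit(1) by auto
    then have "machine_ok (x # g)"
      using fit IH snoc.prems by (intro machine_ok_Cons) (auto simp: sorted_append)
    then have "\<forall>h \<in># add_mset g (mset (place x (any_fit xs))). machine_ok h"
      unfolding fit(3) using IH by auto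
    then show ?thesis by (simp add: any_fit_snoc)
  next
    case no_fit
    have "machine_ok [x]" using snoc.prems by (auto simp: machine_ok_def)
    then have "\<forall>h \<in># mset (place x (any_fit xs)). machine_ok h"
      unfolding no_fit(2) using IH by auto
    then show ?thesis by (simp add: any_fit_snoc)
  qed
qed simp

text \<open>If \<open>x\<close> fits on neither of two machines, the bounds for the two machines average to
  a load of at least \<open>V\<close>.\<close>

lemma any_fit_two:
  assumes "\<And>x. x \<in> set Q \<Longrightarrow> 0 \<le> v x" "\<And>x. x \<in> set Q \<Longrightarrow> item_active x (item_start x)"
    and "\<And>t. load v Q t < V"
    and "\<And>g x. set g \<subseteq> set Q \<Longrightarrow> x \<in> set Q \<Longrightarrow> \<not> fits g x \<Longrightarrow> V \<le> 2 * load v g (item_start x) + v x"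
  shows "length (any_fit Q) \<le> 2"
proof -
  have "length (any_fit ys) \<le> 2" if "Q = ys @ zs" for ys zs
    using that
  proof (induction ys arbitrary: zs rule: rev_induct)
    case (snoc x ys)
    then have IH: "length (any_fit ys) \<le> 2" by simp
    show ?case
    proof (cases rule: place_cases[of "any_fit ys" x])
      case (fit g)
      from arg_cong[OF fit(3), of size] IH show ?thesis by (simp add: any_fit_snoc)
    next
      case no_fit
      have False if "length (any_fit ys) = 2"
      proof -
        have "\<exists>g h. any_fit ys = [g, h]"
          using that by (cases "any_fit ys" rule: remdups_adj.cases) auto
        then obtain g h where gh: "any_fit ys = [g, h]" by blast
        have ms: "mset g + mset h = mset ys" using mset_concat_any_fit[of ys] gh by simp
        have "set g \<subseteq> set Q" "set h \<subseteq> set Q"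
          using mset_eq_setD[of "g @ h" ys] ms snoc.prems by auto
        then have "V \<le> 2 * load v g (item_start x) + v x" "V \<le> 2 * load v h (item_start x) + v x"
          using no_fit(1) gh snoc.prems by (auto intro!: assms(4))
        moreover have "load v g (item_start x) + load v h (item_start x) = load v ys (item_start x)"
          using load_mset_cong[of "g @ h" ys v] ms by simp
        moreover have "load v Q (item_start x) = load v ys (item_start x) + v x + load v zs (item_start x)"
          using assms(2)[of x] snoc.prems by simp
        moreover have "0 \<le> load v zs (item_start x)"
          using assms(1) snoc.prems by (intro load_nonneg) auto
        ultimately show False using assms(3)[of "item_start x"] by linarith
      qed
      then have "length (any_fit ys) \<noteq> 2" by blast
      with IH have "length (any_fit ys) \<le> 1" by linarith
      with arg_cong[OF no_fit(2), of size] show ?thesis by (simp add: any_fit_snoc)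
    qed
  qed simp
  then show ?thesis by simp
qed

section \<open>Irredundant covers\<close>

definition covers_at :: "(item \<Rightarrow> real) \<Rightarrow> real \<Rightarrow> item list \<Rightarrow> item list \<Rightarrow> real \<Rightarrow> bool" where
  "covers_at v c R Q t \<longleftrightarrow> c \<le> load v Q t \<or> load v R t \<le> load v Q t"

definition covers :: "(item \<Rightarrow> real) \<Rightarrow> real \<Rightarrow> item list \<Rightarrow> item list \<Rightarrow> bool" where
  "covers v c R Q \<longleftrightarrow>
     (\<forall>y\<in>set R. covers_at v c R Q (item_start y) \<and> covers_at v c R Q (item_finish y))"

definition remove_item :: "item \<Rightarrow> item list \<Rightarrow> item list" where
  "remove_item x Q = filter (\<lambda>y. fst y \<noteq> fst x) Q"

definition prune_step :: "(item \<Rightarrow> real) \<Rightarrow> real \<Rightarrow> item list \<Rightarrow> item \<Rightarrow> item list \<Rightarrow> item list" where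
  "prune_step v c R x Q = (if covers v c R (remove_item x Q) then remove_item x Q else Q)"

definition prune :: "(item \<Rightarrow> real) \<Rightarrow> real \<Rightarrow> item list \<Rightarrow> item list" where
  "prune v c R = fold (prune_step v c R) R R"

text \<open>The set of active items changes only at start and finish times.\<close>

lemma coversD:
  assumes "covers v c R Q" "set Q \<subseteq> set R" "\<And>x. x \<in> set R \<Longrightarrow> 0 \<le> v x"
  shows "covers_at v c R Q t"
proof (cases "\<exists>x\<in>set R. item_active x t")
  case False
  then have "load v R t = 0" by (intro load_eq_0) auto
  moreover have "0 \<le> load v Q t" using assms by (intro load_nonneg) auto
  ultimately show ?thesis by (simp add: covers_at_def)
next
  case True
  define P where "P = {p \<in> item_start ` set R \<union> item_finish ` set R. p \<le> t}"
  have fin: "finite P" "P \<noteq> {}" using True by (auto simp: P_def active_def)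
  define p where "p = Max P"
  have p: "p \<in> P" unfolding p_def using fin by (rule Max_in)
  have "item_active x t = item_active x p" if "x \<in> set R" for x
  proof -
    have "item_start x \<le> t \<Longrightarrow> item_start x \<le> p" "item_finish x \<le> t \<Longrightarrow> item_finish x \<le> p"
      unfolding p_def using fin that by (auto intro!: Max_ge simp: P_def)
    moreover have "p \<le> t" using p by (simp add: P_def)
    ultimately show ?thesis unfolding active_def by (meson le_less_trans not_less order_trans)
  qed
  then have "load v R t = load v R p" "load v Q t = load v Q p"
    using assms(2) by (auto intro!: load_cong)
  moreover have "covers_at v c R Q p" using p assms(1) by (auto simp: P_def covers_def)
  ultimately show ?thesis by (simp add: covers_at_def)
qed

lemma load_remove_item:
  assumes "distinct (map fst Q)" "x \<in> set Q"
  shows "load v Q t = load v (remove_item x Q) t + (if item_active x t then v x else 0)"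
  using assms
proof (induction Q)
  case (Cons y Q)
  show ?case
  proof (cases "x = y")
    case True
    then have "filter (\<lambda>z. fst z \<noteq> fst x) Q = Q"
      using Cons.prems by (intro filter_True) (metis distinct.simps(2) image_eqI list.simps(9) set_map)
    with True show ?thesis by (simp add: remove_item_def)
  next
    case False
    then have "fst y \<noteq> fst x" using Cons.prems by (auto simp: image_iff)
    with False Cons show ?thesis by (simp add: remove_item_def)
  qed
qed simp

text \<open>One pass over \<open>R\<close> yields irredundancy: an item that cannot be spared at its
  turn cannot be spared later, because further removals only lower the loads. The invariant speaks
  of the items already processed.\<close>

lemma fold_prune_step:
  fixes c :: real
  assumes "\<And>x. x \<in> set R \<Longrightarrow> 0 \<le> v x"
  defines "good (Q :: item list) ys \<equiv> (\<exists>P. Q = filter P R) \<and> covers v c R Q \<and>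
    (\<forall>x\<in>set ys \<inter> set Q. \<not> covers v c R (remove_item x Q))"
  shows "good (fold (prune_step v c R) ys R) ys"
proof (induction ys rule: rev_induct)
  case Nil
  show ?case unfolding good_def by (auto simp: covers_def covers_at_def intro: exI[of _ "\<lambda>_. True"])
next
  case (snoc x ys)
  define Q where "Q = fold (prune_step v c R) ys R"
  from snoc obtain P where Q: "Q = filter P R" and cov: "covers v c R Q"
    and irr: "\<And>y. y \<in> set ys \<Longrightarrow> y \<in> set Q \<Longrightarrow> \<not> covers v c R (remove_item y Q)"
    unfolding good_def Q_def by blast
  have step: "fold (prune_step v c R) (ys @ [x]) R
      = (if covers v c R (remove_item x Q) then remove_item x Q else Q)"
    by (simp add: Q_def prune_step_def)
  show ?case
  proof (cases "covers v c R (remove_item x Q)")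
    case True
    have "\<not> covers v c R (remove_item y (remove_item x Q))" if "y \<in> set ys" "y \<in> set Q" for y
    proof
      assume *: "covers v c R (remove_item y (remove_item x Q))"
      have "load v (remove_item y (remove_item x Q)) t \<le> load v (remove_item y Q) t" for t
        unfolding remove_item_def Q filter_filter using assms(1) by (intro load_filter_mono) auto
      with * have "covers v c R (remove_item y Q)"
        unfolding covers_def covers_at_def by (meson order_trans)
      with irr that show False by blast
    qed
    moreover have "\<exists>P. remove_item x Q = filter P R" by (auto simp: remove_item_def Q)
    ultimately show ?thesis
      using True unfolding step good_def by (auto simp: remove_item_def)
  next
    case False
    with Q cov irr show ?thesis unfolding step good_def by auto
  qed
qed

lemma fold_filter_ex:
  assumes "\<And>x Q. \<exists>P. f x Q = filter P Q"
  shows "\<exists>P. fold f ys (filter P0 R) = filter P R"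
proof (induction ys arbitrary: P0)
  case (Cons y ys)
  obtain P where "f y (filter P0 R) = filter P (filter P0 R)" using assms by blast
  with Cons[of "\<lambda>x. P0 x \<and> P x"] show ?case by simp
qed auto

text \<open>This form hands on order and distinct indices at once and makes the remainder a filter
  of \<open>R\<close> too, which is all that the peeling assumes of a selection.\<close>

lemma prune_filter: "\<exists>P. prune v c R = filter P R"
  unfolding prune_def
proof -
  have "\<exists>P. prune_step v c R x Q = filter P Q" for x Q
    by (auto simp: prune_step_def remove_item_def intro: exI[of _ "\<lambda>_. True"])
  from fold_filter_ex[of "prune_step v c R", OF this, of R "\<lambda>_. True" R]
  show "\<exists>P. fold (prune_step v c R) R R = filter P R" by simp
qed

lemma prune_covers:
  assumes "\<And>x. x \<in> set R \<Longrightarrow> 0 \<le> v x"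
  shows "covers_at v c R (prune v c R) t"
proof -
  have "covers v c R (prune v c R)"
    using fold_prune_step[of R v c R] assms unfolding prune_def by blast
  moreover have "set (prune v c R) \<subseteq> set R" using prune_filter[of v c R] by auto
  ultimately show ?thesis using assms by (intro coversD) auto
qed

text \<open>Without \<open>x\<close> the cover fails at some time, where the load is then below
  \<open>c\<close>. As the cover holds there with \<open>x\<close>, the item must be active at that
  time, and it adds only \<open>v x\<close>.\<close>

lemma prune_witness:
  assumes "\<And>x. x \<in> set R \<Longrightarrow> 0 \<le> v x" "distinct (map fst R)" "x \<in> set (prune v c R)"
  obtains t where "item_active x t" "load v (prune v c R) t < c + v x"
proof -
  define Q where "Q = prune v c R"
  obtain P where P: "Q = filter P R" unfolding Q_def using prune_filter by blast
  have dist: "distinct (map fst Q)" using assms(2) unfolding P by (rule distinct_map_filter)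
  have "\<not> covers v c R (remove_item x Q)"
    using fold_prune_step[of R v c R] assms(1,3) P unfolding prune_def Q_def by auto
  then obtain t where t: "load v (remove_item x Q) t < c" "load v (remove_item x Q) t < load v R t"
    unfolding covers_def covers_at_def using not_le_imp_less by blast
  have "covers_at v c R Q t" unfolding Q_def using assms(1) by (rule prune_covers)
  with t load_remove_item[OF dist, of x v t] assms(3) have "item_active x t"
    unfolding covers_at_def Q_def by (auto split: if_splits)
  with t load_remove_item[OF dist, of x v t] assms(3) that[of t] show ?thesis
    unfolding Q_def by auto
qed

text \<open>Choose one witness time per item. Among the items active at \<open>z\<close> with
  witness at or before \<open>z\<close>, take the latest witness: the others are active from their
  own earlier witness up to \<open>z\<close>, hence at that time as well. So their total weight is
  at most the load at a single witness, below \<open>c + \<delta>\<close>. The items with later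
  witnesses are symmetric, with the earliest one.\<close>

lemma load_irredundant:
  assumes "distinct Q" "\<And>x. x \<in> set Q \<Longrightarrow> 0 \<le> v x \<and> v x \<le> \<delta>" "0 < c + \<delta>"
    and "\<And>x. x \<in> set Q \<Longrightarrow> \<exists>t. item_active x t \<and> load v Q t < c + v x"
  shows "load v Q z < 2 * (c + \<delta>)"
proof -
  obtain \<tau> where \<tau>: "\<And>x. x \<in> set Q \<Longrightarrow> item_active x (\<tau> x) \<and> load v Q (\<tau> x) < c + v x"
    using assms(4) by metis
  have *: "sum v S < c + \<delta>"
    if S: "S \<subseteq> set Q" and x: "S \<noteq> {} \<Longrightarrow> \<exists>x\<in>S. \<forall>y\<in>S. item_active y (\<tau> x)" for S
  proof (cases "S = {}")
    case False
    then obtain x where x: "x \<in> S" "\<And>y. y \<in> S \<Longrightarrow> item_active y (\<tau> x)" using x by blast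
    have "sum v S \<le> (\<Sum>y\<in>{y\<in>set Q. item_active y (\<tau> x)}. v y)"
      using S x assms(2) by (intro sum_mono2) auto
    also have "\<dots> = load v Q (\<tau> x)" using load_eq_sum[OF assms(1)] by simp
    also have "\<dots> < c + v x" using \<tau> x S by blast
    also have "\<dots> \<le> c + \<delta>" using assms(2)[of x] subsetD[OF S x(1)] by simp
    finally show ?thesis .
  qed (use assms(3) in simp)
  define L where "L = {x\<in>set Q. item_active x z \<and> \<tau> x \<le> z}"
  define U where "U = {x\<in>set Q. item_active x z \<and> z < \<tau> x}"
  have "sum v L < c + \<delta>"
  proof (rule *)
    assume ne: "L \<noteq> {}"
    have fin: "finite L" by (simp add: L_def)
    then have "Max (\<tau> ` L) \<in> \<tau> ` L" using ne by (intro Max_in) auto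
    then obtain x where "x \<in> L" "\<tau> x = Max (\<tau> ` L)" by auto
    then have x: "x \<in> L" "\<And>y. y \<in> L \<Longrightarrow> \<tau> y \<le> \<tau> x" using fin by auto
    have "item_active y (\<tau> x)" if "y \<in> L" for y
      using x(1) x(2)[OF that] that \<tau>[of y] unfolding L_def active_def by auto
    with x show "\<exists>x\<in>L. \<forall>y\<in>L. item_active y (\<tau> x)" by blast
  qed (auto simp: L_def)
  moreover have "sum v U < c + \<delta>"
  proof (rule *)
    assume ne: "U \<noteq> {}"
    have fin: "finite U" by (simp add: U_def)
    then have "Min (\<tau> ` U) \<in> \<tau> ` U" using ne by (intro Min_in) auto
    then obtain x where "x \<in> U" "\<tau> x = Min (\<tau> ` U)" by auto
    then have x: "x \<in> U" "\<And>y. y \<in> U \<Longrightarrow> \<tau> x \<le> \<tau> y" using fin by auto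
    have "item_active y (\<tau> x)" if "y \<in> U" for y
      using x(1) x(2)[OF that] that \<tau>[of y] unfolding U_def active_def by auto
    with x show "\<exists>x\<in>U. \<forall>y\<in>U. item_active y (\<tau> x)" by blast
  qed (auto simp: U_def)
  moreover have "load v Q z = sum v L + sum v U"
  proof -
    have "{x\<in>set Q. item_active x z} = L \<union> U" "L \<inter> U = {}" "finite L" "finite U"
      unfolding L_def U_def by auto
    then show ?thesis using load_eq_sum[OF assms(1), of v z] by (simp add: sum.union_disjoint)
  qed
  ultimately show ?thesis by simp
qed

section \<open>Peeling off blocks\<close>

definition remove_items :: "item list \<Rightarrow> item list \<Rightarrow> item list" where
  "remove_items Q R = filter (\<lambda>y. \<not> (\<exists>z\<in>set Q. fst z = fst y)) R"

text \<open>\<open>n\<close> is the number of rounds; late rounds may yield empty blocks. This form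
  is for reasoning, \<open>peel_groups\<close> is the loop that is executed.\<close>

fun peel :: "(item list \<Rightarrow> item list) \<Rightarrow> nat \<Rightarrow> item list \<Rightarrow> item list list" where
  "peel sel 0 R = []"
| "peel sel (Suc n) R = sel R # peel sel n (remove_items (sel R) R)"

definition peel_step :: "(item list \<Rightarrow> item list) \<Rightarrow> (item list \<Rightarrow> item list list) \<Rightarrow>
    item list \<times> item list list \<Rightarrow> item list \<times> item list list" where
  "peel_step sel pack s = (remove_items (sel (fst s)) (fst s), pack (sel (fst s)) @ snd s)"

text \<open>The list folded over is only a clock with one tick per item, as programs iterate over
  lists. Groups come out in a different order than from \<open>peel\<close>, so they are compared as
  multisets.\<close>

definition peel_groups :: "(item list \<Rightarrow> item list) \<Rightarrow> (item list \<Rightarrow> item list list) \<Rightarrow>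
    item list \<Rightarrow> item list list" where
  "peel_groups sel pack xs = snd (fold (\<lambda>_. peel_step sel pack) xs (xs, []))"

lemma mset_peel_groups:
  "mset (peel_groups sel pack xs) = mset (concat (map pack (peel sel (length xs) xs)))"
proof -
  have "mset (snd (fold (\<lambda>_. peel_step sel pack) ys (R, acc)))
      = mset (concat (map pack (peel sel (length ys) R))) + mset acc" for R acc and ys :: "item list"
    by (induction ys arbitrary: R acc) (auto simp: peel_step_def)
  then show ?thesis by (simp add: peel_groups_def)
qed

lemma remove_items_filter:
  assumes "distinct (map fst R)" "Q = filter P R"
  shows "remove_items Q R = filter (\<lambda>x. \<not> P x) R"
  unfolding remove_items_def assms(2)
proof (rule filter_cong[OF refl])
  fix y assume "y \<in> set R"
  then show "(\<not> (\<exists>z\<in>set (filter P R). fst z = fst y)) = (\<not> P y)"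
    using assms(1) unfolding distinct_map inj_on_def by (metis (mono_tags, lifting) filter_set mem_Collect_eq set_filter)
qed

text \<open>Every round removes an item as long as one is left, so \<open>length R\<close> rounds
  exhaust \<open>R\<close>. The set \<open>U\<close> confines the nonemptiness of \<open>sel\<close>
  to items with known properties, such as positive size.\<close>

lemma mset_peel:
  assumes "\<And>R. \<exists>P. sel R = filter P R" "\<And>R. R \<noteq> [] \<Longrightarrow> set R \<subseteq> U \<Longrightarrow> sel R \<noteq> []"
    and "distinct (map fst R)" "set R \<subseteq> U" "length R \<le> n"
  shows "mset (concat (peel sel n R)) = mset R"
  using assms(3-)
proof (induction n arbitrary: R)
  case (Suc n)
  obtain P where P: "sel R = filter P R" using assms(1) by blast
  have rest: "remove_items (sel R) R = filter (\<lambda>x. \<not> P x) R"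
    using Suc.prems(1) P by (rule remove_items_filter)
  have "length (filter (\<lambda>x. \<not> P x) R) \<le> n"
  proof (cases "R = []")
    case False
    with assms(2) Suc.prems have "filter P R \<noteq> []" unfolding P[symmetric] by blast
    then have "0 < length (filter P R)" by blast
    with sum_length_filter_compl[of P R] Suc.prems(3) show ?thesis by linarith
  qed simp
  with Suc have "mset (concat (peel sel n (filter (\<lambda>x. \<not> P x) R))) = mset (filter (\<lambda>x. \<not> P x) R)"
    by (intro Suc.IH) (auto intro: distinct_map_filter)
  then show ?case unfolding peel.simps rest by (simp add: P)
qed simp

definition num_active :: "item list list \<Rightarrow> real \<Rightarrow> real" where
  "num_active gs t = (\<Sum>g\<leftarrow>gs. if \<exists>x\<in>set g. item_active x t then 1 else 0)"

lemma num_active_append: "num_active (gs @ hs) t = num_active gs t + num_active hs t"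
  by (simp add: num_active_def)

lemma num_active_mset_cong: "mset gs = mset hs \<Longrightarrow> num_active gs t = num_active hs t"
  by (simp add: num_active_def flip: sum_mset_sum_list)

lemma num_active_le_length: "num_active gs t \<le> real (length gs)"
  by (induction gs) (auto simp: num_active_def)

lemma num_active_eq_0: "(\<And>g x. g \<in> set gs \<Longrightarrow> x \<in> set g \<Longrightarrow> \<not> item_active x t) \<Longrightarrow> num_active gs t = 0"
  unfolding num_active_def by (induction gs) auto

lemma num_active_le_load: "num_active gs t \<le> load (\<lambda>_. 1) (concat gs) t"
proof (induction gs)
  case (Cons g gs)
  have "(if \<exists>x\<in>set g. item_active x t then 1 else 0) \<le> load (\<lambda>_. 1) g t"
  proof (cases "\<exists>x\<in>set g. item_active x t")
    case True
    then obtain ys x zs where "g = ys @ x # zs" "item_active x t" by (metis split_list)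
    moreover have "0 \<le> load (\<lambda>_. 1) ys t" "0 \<le> load (\<lambda>_. 1) zs t" by (simp_all add: load_nonneg)
    ultimately show ?thesis by simp
  qed (simp add: load_nonneg)
  with Cons show ?case by (simp add: num_active_def)
qed (simp add: num_active_def)

text \<open>The integrality of loads in the uniform case is the reason for two thresholds \<open>c\<close> and \<open>c'\<close>.\<close>

lemma num_active_layers:
  fixes v :: "item \<Rightarrow> real" and c c' \<delta> :: real
  assumes v: "\<And>x. x \<in> set R \<Longrightarrow> 0 < v x \<and> v x \<le> \<delta>"
    and act: "\<And>x. x \<in> set R \<Longrightarrow> item_active x (item_start x)"
    and c: "0 < c" "0 < c'" "0 < \<delta>"
    and cc': "\<And>Q t. set Q \<subseteq> set R \<Longrightarrow> c \<le> load v Q t \<Longrightarrow> c' \<le> load v Q t"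
    and fit: "\<And>g x. set g \<subseteq> set R \<Longrightarrow> x \<in> set R \<Longrightarrow> \<not> fits g x \<Longrightarrow>
       2 * (c + \<delta>) \<le> 2 * load v g (item_start x) + v x"
    and dist: "distinct (map fst R)"
  shows "num_active (concat (map any_fit (peel (prune v c) n R))) t \<le> 2 * of_int \<lceil>load v R t / c'\<rceil>"
  using v act cc' fit dist
proof (induction n arbitrary: R)
  case 0
  have "0 \<le> load v R t" using "0.prems"(1) by (intro load_nonneg) (auto intro: less_imp_le)
  then have "0 \<le> \<lceil>load v R t / c'\<rceil>" using c by (simp add: ceiling_le_iff order_less_le_trans[of "-1" 0])
  then show ?case by (simp add: num_active_def)
next
  case (Suc n)
  define Q where "Q = prune v c R"
  obtain P where P: "Q = filter P R" unfolding Q_def using prune_filter by blast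
  define S where "S = filter (\<lambda>x. \<not> P x) R"
  have rest: "remove_items (prune v c R) R = S"
    unfolding S_def using remove_items_filter[OF Suc.prems(5) P] by (simp add: Q_def)
  have v0: "0 \<le> v x" if "x \<in> set R" for x using Suc.prems(1)[OF that] by simp
  have split: "load v R t = load v Q t + load v S t" unfolding P S_def by (rule load_split)
  have IH: "num_active (concat (map any_fit (peel (prune v c) n S))) t \<le> 2 * of_int \<lceil>load v S t / c'\<rceil>"
  proof (rule Suc.IH)
    show "distinct (map fst S)" unfolding S_def using Suc.prems(5) by (rule distinct_map_filter)
    show "c' \<le> load v Q t" if "set Q \<subseteq> set S" "c \<le> load v Q t" for Q t
      using that by (intro Suc.prems(3)) (auto simp: S_def)
    show "2 * (c + \<delta>) \<le> 2 * load v g (item_start x) + v x"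
      if "set g \<subseteq> set S" "x \<in> set S" "\<not> fits g x" for g x
      using that by (intro Suc.prems(4)) (auto simp: S_def)
  qed (use Suc.prems(1,2) in \<open>auto simp: S_def\<close>)
  have Qset: "set Q \<subseteq> set R" by (auto simp: P)
  have "distinct (map fst Q)" unfolding P using Suc.prems(5) by (rule distinct_map_filter)
  then have distQ: "distinct Q" by (simp add: distinct_map)
  have "load v Q z < 2 * (c + \<delta>)" for z
  proof (rule load_irredundant[OF distQ])
    show "\<exists>t. item_active x t \<and> load v Q t < c + v x" if "x \<in> set Q" for x
      using prune_witness[of R v x c] v0 Suc.prems(5) that unfolding Q_def by metis
  qed (use Qset Suc.prems(1) c in \<open>auto intro: less_imp_le\<close>)
  then have "length (any_fit Q) \<le> 2"
  proof (intro any_fit_two[of Q v "2 * (c + \<delta>)"])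
    show "2 * (c + \<delta>) \<le> 2 * load v g (item_start x) + v x"
      if "set g \<subseteq> set Q" "x \<in> set Q" "\<not> fits g x" for g x
      using that Qset by (intro Suc.prems(4)) auto
  qed (use Qset v0 in \<open>auto intro!: Suc.prems(2)\<close>)
  then have 2: "num_active (any_fit Q) t \<le> 2" using num_active_le_length[of "any_fit Q" t] by linarith
  have "num_active (any_fit Q) t + 2 * of_int \<lceil>load v S t / c'\<rceil> \<le> 2 * of_int \<lceil>load v R t / c'\<rceil>"
  proof (cases "\<exists>x\<in>set R. item_active x t")
    \<comment> \<open>With nothing active at \<open>t\<close>, the bound 2 for this layer would be
      too weak; the layer contributes nothing then.\<close>
    case False
    have "set (concat (any_fit Q)) = set Q" by (rule mset_eq_setD[OF mset_concat_any_fit])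
    then have "num_active (any_fit Q) t = 0" using False Qset by (intro num_active_eq_0) fastforce
    moreover have "load v S t = 0" "load v R t = 0"
      using False by (auto intro!: load_eq_0 simp: S_def)
    ultimately show ?thesis by simp
  next
    case True
    then have pos: "0 < load v R t" using load_pos[of R v] Suc.prems(1) by blast
    have "covers_at v c R Q t" unfolding Q_def using v0 by (rule prune_covers)
    then consider "c' \<le> load v Q t" | "load v R t \<le> load v Q t"
      unfolding covers_at_def using Suc.prems(3)[OF Qset] by blast
    \<comment> \<open>The layer takes either \<open>c'\<close> of the load at \<open>t\<close> or
      all of it. Either way the ceiling drops by at least one, which pays for its two
      machines.\<close>
    then have "\<lceil>load v S t / c'\<rceil> + 1 \<le> \<lceil>load v R t / c'\<rceil>"
    proof cases
      case 1
      then have "load v S t / c' + 1 \<le> load v R t / c'" using c split by (simp add: field_simps)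
      then show ?thesis by (metis ceiling_add_one ceiling_mono)
    next
      case 2
      moreover have "0 \<le> load v S t" using v0 by (intro load_nonneg) (auto simp: S_def)
      ultimately have "load v S t = 0" using split by simp
      moreover have "0 < load v R t / c'" using pos c by simp
      then have "0 < \<lceil>load v R t / c'\<rceil>" by simp
      ultimately show ?thesis by simp
    qed
    then have "of_int \<lceil>load v S t / c'\<rceil> + 1 \<le> (of_int \<lceil>load v R t / c'\<rceil> :: real)"
      by (metis of_int_1 of_int_add of_int_le_iff)
    with 2 show ?thesis by simp
  qed
  with IH show ?case unfolding peel.simps rest by (simp add: num_active_append flip: Q_def)
qed

section \<open>Schedules and their cost\<close>

lemma load_weight_le_packs:
  assumes "packs_into (map item_weight (filter (\<lambda>x. item_active x t) xs)) m"
  shows "load item_weight xs t \<le> real m"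
proof -
  have "load item_weight xs t = sum_list (map item_weight (filter (\<lambda>x. item_active x t) xs))"
    by (induction xs) auto
  with sum_list_le_packs_into[OF assms] show ?thesis by simp
qed

lemma nth_concat_unique:
  "distinct (concat gs) \<Longrightarrow> m < length gs \<Longrightarrow> m' < length gs \<Longrightarrow> x \<in> set (gs ! m) \<Longrightarrow> x \<in> set (gs ! m') \<Longrightarrow> m = m'"
proof (induction gs arbitrary: m m')
  case (Cons g gs)
  show ?case
  proof (cases m; cases m')
    fix k assume "m = 0" "m' = Suc k"
    with Cons.prems have "x \<in> set g" "x \<in> set (concat gs)" by auto
    with Cons.prems(1) show ?thesis by auto
  next
    fix k assume "m' = 0" "m = Suc k"
    with Cons.prems have "x \<in> set g" "x \<in> set (concat gs)" by auto
    with Cons.prems(1) show ?thesis by auto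
  next
    fix k k' assume "m = Suc k" "m' = Suc k'"
    with Cons.prems Cons.IH[of k k'] show ?thesis by simp
  qed simp
qed simp

section \<open>Schedules obtained from groups of items\<close>

definition items :: "request list \<Rightarrow> item list" where
  "items I = List.enumerate 0 I"

lemma set_items: "x \<in> set (items I) \<longleftrightarrow> fst x < length I \<and> snd x = I ! fst x"
  by (cases x) (auto simp: items_def in_set_enumerate_eq)

lemma distinct_items: "distinct (map fst (items I))"
  by (simp add: items_def)

definition position :: "nat \<Rightarrow> item list list \<Rightarrow> nat" where
  "position i gs = length (takeWhile (\<lambda>g. \<not> (\<exists>x\<in>set g. fst x = i)) gs)"

definition schedule_of :: "request list \<Rightarrow> item list list \<Rightarrow> nat list" where
  "schedule_of I gs = map (\<lambda>x. position (fst x) gs) (items I)"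

definition partition_of :: "request list \<Rightarrow> item list list \<Rightarrow> bool" where
  "partition_of I gs \<longleftrightarrow> mset (concat gs) = mset (items I)"

definition active_set :: "item list \<Rightarrow> real set" where
  "active_set g = {t. \<exists>x\<in>set g. item_active x t}"

definition busy_time :: "item list \<Rightarrow> real" where
  "busy_time g = measure lborel (active_set g)"

lemma length_schedule_of [simp]: "length (schedule_of I gs) = length I"
  by (simp add: schedule_of_def items_def)

lemma nth_schedule_of: "i < length I \<Longrightarrow> schedule_of I gs ! i = position i gs"
  by (simp add: schedule_of_def items_def nth_enumerate_eq)

lemma position_eq_iff:
  assumes "partition_of I gs" "i < length I"
  shows "position i gs = m \<longleftrightarrow> m < length gs \<and> (i, I ! i) \<in> set (gs ! m)"
proof -
  have sets: "set (concat gs) = set (items I)"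
    using assms(1) unfolding partition_of_def by (rule mset_eq_setD)
  have dist: "distinct (concat gs)"
    using assms(1) distinct_items[of I] unfolding partition_of_def
    by (metis distinct_map mset_eq_imp_distinct_iff)
  have mem: "(\<exists>x\<in>set g. fst x = i) \<longleftrightarrow> (i, I ! i) \<in> set g" if "g \<in> set gs" for g
  proof
    assume "\<exists>x\<in>set g. fst x = i"
    then obtain x where x: "x \<in> set g" "fst x = i" by blast
    then have "x \<in> set (items I)" using sets that by auto
    with x show "(i, I ! i) \<in> set g" by (metis prod.collapse set_items)
  qed force
  have "(i, I ! i) \<in> set (concat gs)" unfolding sets by (simp add: set_items assms(2))
  then obtain g where "g \<in> set gs" "(i, I ! i) \<in> set g" by auto
  then have ex: "\<exists>g\<in>set gs. \<exists>x\<in>set g. fst x = i" by (metis fst_conv)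
  have lt: "position i gs < length gs"
    unfolding position_def using ex
    by (metis (mono_tags, lifting) length_takeWhile_le nat_less_le takeWhile_eq_all_conv takeWhile_eq_take take_all)
  then have at: "(i, I ! i) \<in> set (gs ! position i gs)"
    using mem[of "gs ! position i gs"] nth_length_takeWhile[of "\<lambda>g. \<not> (\<exists>x\<in>set g. fst x = i)" gs]
    by (auto simp: position_def)
  show ?thesis using lt at nth_concat_unique[OF dist _ lt _ at, of m] by blast
qed

lemma partition_of_mem:
  assumes "partition_of I gs" "m < length gs" "x \<in> set (gs ! m)"
  shows "fst x < length I" "snd x = I ! fst x" "position (fst x) gs = m"
proof -
  have "x \<in> set (concat gs)" using assms(2,3) nth_mem by fastforce
  then have "x \<in> set (items I)"
    using assms(1) unfolding partition_of_def by (metis mset_eq_setD)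
  then show *: "fst x < length I" "snd x = I ! fst x" by (simp_all add: set_items)
  show "position (fst x) gs = m"
    using position_eq_iff[OF assms(1) *(1), of m] *(2)[symmetric] assms(2,3) by simp
qed

lemma cost_schedule_of:
  assumes "partition_of I gs"
  shows "cost I (schedule_of I gs) = (\<Sum>g\<leftarrow>gs. busy_time g)"
proof -
  let ?\<sigma> = "schedule_of I gs"
  let ?A = "\<lambda>m. {t. \<exists>i<length I. ?\<sigma> ! i = m \<and> active (I ! i) t}"
  have A: "?A m = active_set (gs ! m)" if "m < length gs" for m
  proof (intro set_eqI iffI)
    fix t assume "t \<in> ?A m"
    then obtain i where i: "i < length I" "position i gs = m" "active (I ! i) t"
      by (auto simp: nth_schedule_of)
    then have "(i, I ! i) \<in> set (gs ! m)" using position_eq_iff[OF assms] by blast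
    with i show "t \<in> active_set (gs ! m)" by (force simp: active_set_def)
  next
    fix t assume "t \<in> active_set (gs ! m)"
    then obtain x where x: "x \<in> set (gs ! m)" "item_active x t" by (auto simp: active_set_def)
    from partition_of_mem[OF assms that x(1)] x(2) show "t \<in> ?A m"
      by (auto simp: nth_schedule_of intro!: exI[of _ "fst x"])
  qed
  have sub: "set ?\<sigma> \<subseteq> {..<length gs}"
  proof
    fix m assume "m \<in> set ?\<sigma>"
    then obtain i where "i < length I" "position i gs = m"
      by (metis in_set_conv_nth length_schedule_of nth_schedule_of)
    then show "m \<in> {..<length gs}" using position_eq_iff[OF assms] by blast
  qed
  have "cost I ?\<sigma> = (\<Sum>m<length gs. active_time I ?\<sigma> m)"
    unfolding cost_def
  \<comment> \<open>A group index that receives no request has an empty set of active times, so the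
    sum may run over all groups.\<close>
  proof (rule sum.mono_neutral_left[OF _ sub])
    show "\<forall>m\<in>{..<length gs} - set ?\<sigma>. active_time I ?\<sigma> m = 0"
    proof
      fix m assume "m \<in> {..<length gs} - set ?\<sigma>"
      then have A: "?A m = {}" 
        using nth_mem[of _ ?\<sigma>] by fastforce
      show "active_time I ?\<sigma> m = 0" unfolding active_time_def A by simp
    qed
  qed simp
  also have "\<dots> = (\<Sum>m<length gs. busy_time (gs ! m))"
    unfolding active_time_def busy_time_def using A by (intro sum.cong) auto
  also have "\<dots> = (\<Sum>g\<leftarrow>gs. busy_time g)"
    by (simp add: sum_list_sum_nth atLeast0LessThan)
  finally show ?thesis .
qed

lemma feasible_schedule_of:
  assumes "partition_of I gs" "\<And>g. g \<in> set gs \<Longrightarrow> machine_ok g"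
  shows "feasible I (schedule_of I gs)"
  unfolding feasible_def
proof (intro conjI allI)
  fix m t
  let ?A = "{i. i < length I \<and> schedule_of I gs ! i = m \<and> active (I ! i) t}"
  show "(\<Sum>i\<in>?A. weight (I ! i)) \<le> 1"
  proof (cases "m < length gs")
    case True
    have dist: "distinct (concat gs)"
      using assms(1) distinct_items[of I] unfolding partition_of_def
      by (metis distinct_map mset_eq_imp_distinct_iff)
    then have dm: "distinct (gs ! m)" using True by (simp add: distinct_concat_iff)
    have eq: "{x\<in>set (gs ! m). item_active x t} = (\<lambda>i. (i, I ! i)) ` ?A"
    proof (intro set_eqI iffI)
      fix x assume "x \<in> {x\<in>set (gs ! m). item_active x t}"
      then have "x \<in> set (gs ! m)" "item_active x t" by auto
      with partition_of_mem[OF assms(1) True this(1)]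
      have "fst x \<in> ?A" "x = (fst x, I ! fst x)" by (auto simp: nth_schedule_of prod_eq_iff)
      then show "x \<in> (\<lambda>i. (i, I ! i)) ` ?A" by blast
    next
      fix x assume "x \<in> (\<lambda>i. (i, I ! i)) ` ?A"
      then obtain i where i: "x = (i, I ! i)" "i < length I" "position i gs = m" "active (I ! i) t"
        by (auto simp: nth_schedule_of)
      then have "(i, I ! i) \<in> set (gs ! m)" using position_eq_iff[OF assms(1), of i m] by blast
      with i show "x \<in> {x\<in>set (gs ! m). item_active x t}" by simp
    qed
    have "load item_weight (gs ! m) t = (\<Sum>i\<in>?A. weight (I ! i))"
      unfolding load_eq_sum[OF dm] eq by (subst sum.reindex) (auto simp: inj_on_def)
    moreover have "machine_ok (gs ! m)" using assms(2) True by simp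
    ultimately show ?thesis unfolding machine_ok_def by metis
  next
    case False
    have "?A = {}"
    proof (rule equals0I)
      fix i assume "i \<in> ?A"
      then have "i < length I" "position i gs = m" by (auto simp: nth_schedule_of)
      with position_eq_iff[OF assms(1), of i m] False show False by blast
    qed
    then show ?thesis by (metis sum.empty zero_le_one)
  qed
qed simp

definition num_machines :: "request list \<Rightarrow> nat list \<Rightarrow> real \<Rightarrow> nat" where
  "num_machines I \<sigma> t = card {m\<in>set \<sigma>. \<exists>i<length I. \<sigma> ! i = m \<and> active (I ! i) t}"

text \<open>At time \<open>t\<close> the machines of a feasible schedule are bins for any collection
  of active items; \<open>h\<close> renumbers the machines in use. \<open>Y\<close> is left free:
  the load bound takes all active items, the harmonic analysis only those whose machine is in its
  core.\<close>

lemma packs_into_num_machines: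
  assumes "feasible I \<sigma>" "\<And>r. r \<in> set I \<Longrightarrow> 0 \<le> weight r"
    and Y: "distinct Y" "set Y \<subseteq> set (items I)" "\<And>x. x \<in> set Y \<Longrightarrow> item_active x t"
  shows "packs_into (map item_weight Y) (num_machines I \<sigma> t)"
proof -
  define M where "M = {m\<in>set \<sigma>. \<exists>i<length I. \<sigma> ! i = m \<and> active (I ! i) t}"
  have len: "length \<sigma> = length I" using assms(1) by (simp add: feasible_def)
  have "finite M" by (simp add: M_def)
  then obtain h where h: "bij_betw h M {0..<card M}" using ex_bij_betw_finite_nat by blast
  have inY: "fst (Y ! j) < length I" "Y ! j = (fst (Y ! j), I ! fst (Y ! j))" "active (I ! fst (Y ! j)) t"
    if "j < length Y" for j
  proof -
    have "Y ! j \<in> set Y" using that by simp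
    then have *: "Y ! j \<in> set (items I)" "item_active (Y ! j) t" using Y(2,3) by blast+
    with set_items[of "Y ! j" I] show "fst (Y ! j) < length I"
      "Y ! j = (fst (Y ! j), I ! fst (Y ! j))" "active (I ! fst (Y ! j)) t"
      by (simp_all add: prod_eq_iff)
  qed
  have inM: "\<sigma> ! fst (Y ! j) \<in> M" if "j < length Y" for j
    using inY[OF that] len unfolding M_def by auto
  show ?thesis
    unfolding packs_into_def num_machines_def M_def[symmetric]
  proof (intro exI[of _ "\<lambda>j. h (\<sigma> ! fst (Y ! j))"] conjI allI impI)
    fix j assume "j < length (map item_weight Y)"
    then show "h (\<sigma> ! fst (Y ! j)) < card M"
      using bij_betw_apply[OF h inM[of j]] by simp
  next
    fix b assume b: "b < card M"
    then obtain m where m: "m \<in> M" "h m = b" using h unfolding bij_betw_def by (metis atLeastLessThan_iff imageE le0)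
    let ?J = "{j. j < length Y \<and> \<sigma> ! fst (Y ! j) = m}"
    have J: "{j. j < length (map item_weight Y) \<and> h (\<sigma> ! fst (Y ! j)) = b} = ?J"
      using m inM h by (auto simp: bij_betw_def dest: inj_onD)
    have inj: "inj_on (\<lambda>j. fst (Y ! j)) ?J"
    proof (rule inj_onI)
      fix j k assume "j \<in> ?J" "k \<in> ?J" and eq: "fst (Y ! j) = fst (Y ! k)"
      then have jk: "j < length Y" "k < length Y" by auto
      have "Y ! j = Y ! k" using inY(2)[OF jk(1)] inY(2)[OF jk(2)] eq by simp
      then show "j = k" using Y(1) jk nth_eq_iff_index_eq by blast
    qed
    have "(\<Sum>j\<in>?J. map item_weight Y ! j) = (\<Sum>j\<in>?J. weight (I ! fst (Y ! j)))"
      using inY(2) by (intro sum.cong) (auto, metis snd_conv)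
    also have "\<dots> = (\<Sum>i\<in>(\<lambda>j. fst (Y ! j)) ` ?J. weight (I ! i))"
      using inj by (subst sum.reindex) auto
    also have "\<dots> \<le> (\<Sum>i | i < length I \<and> \<sigma> ! i = m \<and> active (I ! i) t. weight (I ! i))"
      using inY assms(2) by (intro sum_mono2) auto
    also have "\<dots> \<le> 1" using assms(1) by (simp add: feasible_def)
    finally show "(\<Sum>j | j < length (map item_weight Y) \<and> h (\<sigma> ! fst (Y ! j)) = b. map item_weight Y ! j) \<le> 1"
      unfolding J .
  qed
qed

section \<open>Integrating pointwise bounds over time\<close>

lemma fmeasurable_active_set: "active_set g \<in> fmeasurable lborel"
proof -
  have "active_set g = (\<Union>x\<in>set g. {item_start x..<item_finish x})"
    by (intro set_eqI) (simp add: active_set_def active_def)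
  moreover have "{a..<b} \<in> fmeasurable lborel" for a b :: real
    by (cases "a \<le> b") (auto simp: fmeasurable_def)
  ultimately show ?thesis by (auto intro: fmeasurable.finite_UN)
qed

lemma fmeasurable_indicator:
  "A \<in> fmeasurable M \<Longrightarrow> integrable M (indicat_real A) \<and> integral\<^sup>L M (indicat_real A) = measure M A"
  by (auto simp: fmeasurable_def)

lemma integral_indicator_list:
  assumes "\<And>A. A \<in> set As \<Longrightarrow> A \<in> fmeasurable lborel"
  shows "integrable lborel (\<lambda>t. \<Sum>A\<leftarrow>As. indicat_real A t)
    \<and> integral\<^sup>L lborel (\<lambda>t. \<Sum>A\<leftarrow>As. indicat_real A t) = (\<Sum>A\<leftarrow>As. measure lborel A)"
  using assms
proof (induction As)
  case (Cons A As)
  have "integrable lborel (indicat_real A)" "integral\<^sup>L lborel (indicat_real A) = measure lborel A"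
    using fmeasurable_indicator[of A] Cons.prems[of A] by simp_all
  with Cons show ?case by (auto simp: Bochner_Integration.integral_add)
qed simp

text \<open>The number of machines in use integrates to the cost and the indicator of the horizon to
  \<open>T\<close>. The sets form an arbitrary list because they will be the active times of
  machines, the cores, and the horizon itself.\<close>

lemma sum_measure_le_cost:
  assumes "length \<sigma> = length I" "0 \<le> T"
    and "\<And>A. A \<in> set As \<Longrightarrow> A \<in> fmeasurable lborel"
    and le: "\<And>t. (\<Sum>A\<leftarrow>As. indicat_real A t) \<le> \<alpha> * real (num_machines I \<sigma> t) + \<beta> * indicat_real {0..<T} t"
  shows "(\<Sum>A\<leftarrow>As. measure lborel A) \<le> \<alpha> * cost I \<sigma> + \<beta> * T"
proof -
  define B where "B m = {t. \<exists>i<length I. \<sigma> ! i = m \<and> active (I ! i) t}" for m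
  have B: "B m \<in> fmeasurable lborel" for m
  proof -
    have "B m = active_set (filter (\<lambda>x. \<sigma> ! fst x = m) (items I))"
      by (auto simp: active_set_def set_items B_def)
    then show ?thesis by (simp only: fmeasurable_active_set)
  qed
  have num: "real (num_machines I \<sigma> t) = (\<Sum>m\<in>set \<sigma>. indicat_real (B m) t)" for t
  proof -
    have "(\<Sum>m\<in>set \<sigma>. indicat_real (B m) t) = (\<Sum>m\<in>set \<sigma>. if t \<in> B m then 1 else 0)"
      by (intro sum.cong refl) (simp add: indicator_def)
    also have "\<dots> = real (card (set \<sigma> \<inter> {m. t \<in> B m}))"
      by (subst sum.If_cases) simp_all
    also have "set \<sigma> \<inter> {m. t \<in> B m} = {m\<in>set \<sigma>. \<exists>i<length I. \<sigma> ! i = m \<and> active (I ! i) t}"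
      by (auto simp: B_def)
    finally show ?thesis unfolding num_machines_def by (rule sym)
  qed
  have iB: "integrable lborel (indicat_real (B m))" "integral\<^sup>L lborel (indicat_real (B m)) = measure lborel (B m)" for m
    using fmeasurable_indicator[OF B[of m]] by simp_all
  have iN: "integrable lborel (\<lambda>t. real (num_machines I \<sigma> t))"
    unfolding num by (intro Bochner_Integration.integrable_sum iB)
  have N: "integral\<^sup>L lborel (\<lambda>t. real (num_machines I \<sigma> t)) = cost I \<sigma>"
    unfolding num cost_def active_time_def B_def[symmetric] by (subst Bochner_Integration.integral_sum) (simp_all add: iB)
  have iT: "integrable lborel (indicat_real {0..<T})" "integral\<^sup>L lborel (indicat_real {0..<T}) = T"
    using assms(2) by auto
  note A = integral_indicator_list[OF assms(3)]
  have "(\<Sum>A\<leftarrow>As. measure lborel A) = integral\<^sup>L lborel (\<lambda>t. \<Sum>A\<leftarrow>As. indicat_real A t)"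
    using A by simp
  also have "\<dots> \<le> integral\<^sup>L lborel (\<lambda>t. \<alpha> * real (num_machines I \<sigma> t) + \<beta> * indicat_real {0..<T} t)"
    using A iN iT le by (intro integral_mono) auto
  also have "\<dots> = \<alpha> * cost I \<sigma> + \<beta> * T"
    using iN iT N by simp
  finally show ?thesis .
qed

lemma cost_nonneg: "0 \<le> cost I \<sigma>"
  unfolding cost_def active_time_def by (intro sum_nonneg) simp

lemma bdd_below_costs: "bdd_below {cost I \<sigma> | \<sigma>. feasible I \<sigma>}"
  using cost_nonneg by (auto intro!: bdd_belowI)

lemma opt_le: "feasible I \<sigma> \<Longrightarrow> opt I \<le> cost I \<sigma>"
  unfolding opt_def by (intro cInf_lower bdd_below_costs) auto

text \<open>No optimal schedule is constructed: the pointwise bound is available for every feasible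
  schedule, so it passes to the infimum.\<close>

lemma sum_measure_le_opt:
  assumes "feasible I \<sigma>0" "0 \<le> T" "0 < \<alpha>"
    and "\<And>A. A \<in> set As \<Longrightarrow> A \<in> fmeasurable lborel"
    and le: "\<And>\<sigma> t. feasible I \<sigma> \<Longrightarrow>
      (\<Sum>A\<leftarrow>As. indicat_real A t) \<le> \<alpha> * real (num_machines I \<sigma> t) + \<beta> * indicat_real {0..<T} t"
  shows "(\<Sum>A\<leftarrow>As. measure lborel A) \<le> \<alpha> * opt I + \<beta> * T"
proof -
  have "((\<Sum>A\<leftarrow>As. measure lborel A) - \<beta> * T) / \<alpha> \<le> opt I"
    unfolding opt_def
  proof (rule cInf_greatest)
    show "{cost I \<sigma> | \<sigma>. feasible I \<sigma>} \<noteq> {}" using assms(1) by blast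
    fix z assume "z \<in> {cost I \<sigma> | \<sigma>. feasible I \<sigma>}"
    then obtain \<sigma> where \<sigma>: "feasible I \<sigma>" "z = cost I \<sigma>" by blast
    have "(\<Sum>A\<leftarrow>As. measure lborel A) \<le> \<alpha> * cost I \<sigma> + \<beta> * T"
      using \<sigma> assms(2,4) le by (intro sum_measure_le_cost) (auto simp: feasible_def)
    then show "((\<Sum>A\<leftarrow>As. measure lborel A) - \<beta> * T) / \<alpha> \<le> z"
      using assms(3) \<sigma> by (simp add: field_simps)
  qed
  then show ?thesis using assms(3) by (simp add: field_simps)
qed

lemma num_active_eq_indicators: "num_active gs t = (\<Sum>A\<leftarrow>map active_set gs. indicat_real A t)"
  unfolding num_active_def by (induction gs) (auto simp: active_set_def indicator_def)

lemma cost_schedule_of_le: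
  assumes "valid_instance T I" "partition_of I gs" "\<And>g. g \<in> set gs \<Longrightarrow> machine_ok g" "0 < \<alpha>"
    and "\<And>\<sigma> t. feasible I \<sigma> \<Longrightarrow> 0 \<le> t \<Longrightarrow> t < T \<Longrightarrow>
       num_active gs t \<le> \<alpha> * real (num_machines I \<sigma> t) + \<beta>"
  shows "cost I (schedule_of I gs) \<le> \<alpha> * opt I + \<beta> * T"
proof -
  have "(\<Sum>A\<leftarrow>map active_set gs. measure lborel A) \<le> \<alpha> * opt I + \<beta> * T"
  proof (rule sum_measure_le_opt[OF feasible_schedule_of[OF assms(2,3)] _ assms(4)])
    fix \<sigma> t assume \<sigma>: "feasible I \<sigma>"
    show "(\<Sum>A\<leftarrow>map active_set gs. indicat_real A t) \<le> \<alpha> * real (num_machines I \<sigma> t) + \<beta> * indicat_real {0..<T} t"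
    proof (cases "0 \<le> t \<and> t < T")
      case True
      with assms(5)[OF \<sigma>] show ?thesis by (simp add: num_active_eq_indicators)
    next
      case False
      have "num_active gs t = 0"
      proof (rule num_active_eq_0)
        fix g x assume "g \<in> set gs" "x \<in> set g"
        then have "x \<in> set (concat gs)" by auto
        then have "x \<in> set (items I)" using assms(2) unfolding partition_of_def by (metis mset_eq_setD)
        then have "snd x \<in> set I" by (auto simp: set_items)
        with assms(1) have "0 \<le> item_start x" "item_finish x \<le> T" by (auto simp: valid_instance_def)
        with False show "\<not> item_active x t" by (auto simp: active_def)
      qed
      with False assms(4) show ?thesis by (simp add: num_active_eq_indicators)
    qed
  qed (use assms(1) fmeasurable_active_set in \<open>auto simp: valid_instance_def\<close>)
  then show ?thesis
    by (simp add: cost_schedule_of[OF assms(2)] busy_time_def comp_def)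
qed

section \<open>Layered machines\<close>

definition insert_item :: "item \<Rightarrow> item list \<Rightarrow> item list" where
  "insert_item x ys = filter (\<lambda>y. item_start y < item_start x) ys @ x # filter (\<lambda>y. \<not> item_start y < item_start x) ys"

definition sort_items :: "item list \<Rightarrow> item list" where
  "sort_items xs = fold insert_item xs []"

lemma mset_insert_item: "mset (insert_item x ys) = add_mset x (mset ys)"
  by (simp add: insert_item_def mset_filter multiset_partition[symmetric])

lemma mset_sort_items: "mset (sort_items xs) = mset xs"
  unfolding sort_items_def by (induction xs rule: rev_induct) (simp_all add: mset_insert_item)

lemma sorted_sort_items: "sorted (map item_start (sort_items xs))"
  unfolding sort_items_def
proof (induction xs rule: rev_induct)
  case (snoc x xs)
  then show ?case
    by (auto simp: insert_item_def sorted_append sorted_filter not_less intro: less_imp_le)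
qed simp

text \<open>The weights are scaled such that threshold 5 and maximal weight 2 serve both the sizes in
  (1/4,1/3], which are counted, and the sizes up to 1/4; \<open>u\<close> selects the weights for equal sizes.\<close>

definition block_weight :: "bool \<Rightarrow> item \<Rightarrow> real" where
  "block_weight u x = (if u then 2 * item_weight x else if 4 * item_weight x \<le> 1 then 8 * item_weight x else 2)"

definition layers :: "bool \<Rightarrow> real \<Rightarrow> item list \<Rightarrow> item list list" where
  "layers u c L = peel_groups (prune (block_weight u) c) any_fit L"

definition mixed_machines :: "item list \<Rightarrow> item list list" where
  "mixed_machines L =
     layers False 5 (filter (\<lambda>x. 1 < 3 * item_weight x) L) @
     layers False 5 (filter (\<lambda>x. 3 * item_weight x \<le> 1 \<and> 1 < 4 * item_weight x) L) @
     layers False 5 (filter (\<lambda>x. 4 * item_weight x \<le> 1) L)"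

text \<open>The common size is read off the first item, so the construction applies to, and is
  feasible for, arbitrary nonempty instances; the algorithm need not test whether sizes
  agree.\<close>

definition uniform_machines :: "item list \<Rightarrow> item list list" where
  "uniform_machines L = layers True (2 - item_weight (hd L)) L"

lemma peel_block_filter:
  assumes "\<And>R. \<exists>P. sel R = filter P R" "Q \<in> set (peel sel n R)"
  shows "\<exists>P. Q = filter P R"
  using assms(2)
proof (induction n arbitrary: R)
  case (Suc n)
  show ?case
  proof (cases "Q = sel R")
    case False
    then obtain P where "Q = filter P (remove_items (sel R) R)" using Suc by auto
    then show ?thesis by (auto simp: remove_items_def)
  qed (use assms(1) in simp)
qed simp

lemma peel_groups_machines:
  assumes sel: "\<And>R. \<exists>P. sel R = filter P R" "\<And>R. R \<noteq> [] \<Longrightarrow> set R \<subseteq> set L \<Longrightarrow> sel R \<noteq> []"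
    and L: "distinct (map fst L)"
    and pack: "\<And>P. mset (concat (pack (filter P L))) = mset (filter P L)"
      "\<And>P g. g \<in> set (pack (filter P L)) \<Longrightarrow> machine_ok g \<and> g \<noteq> []"
  shows "mset (concat (peel_groups sel pack L)) = mset L"
    "\<forall>g\<in>set (peel_groups sel pack L). machine_ok g \<and> g \<noteq> []"
proof -
  let ?Qs = "peel sel (length L) L"
  have ms: "mset (peel_groups sel pack L) = mset (concat (map pack ?Qs))" by (rule mset_peel_groups)
  have "mset (concat (peel_groups sel pack L)) = mset (concat (concat (map pack ?Qs)))"
    using ms by (simp add: mset_concat flip: sum_mset_sum_list)
  also have "\<dots> = mset (concat ?Qs)"
  proof -
    have "mset (concat (pack Q)) = mset Q" if "Q \<in> set ?Qs" for Q
      using peel_block_filter[OF sel(1) that] pack(1) by blast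
    then have "mset (concat (concat (map pack Qs))) = mset (concat Qs)" if "set Qs \<subseteq> set ?Qs" for Qs
      using that by (induction Qs) auto
    then show ?thesis by simp
  qed
  also have "\<dots> = mset L" using sel L by (intro mset_peel[where U = "set L"]) auto
  finally show "mset (concat (peel_groups sel pack L)) = mset L" .
  show "\<forall>g\<in>set (peel_groups sel pack L). machine_ok g \<and> g \<noteq> []"
  proof
    fix g assume "g \<in> set (peel_groups sel pack L)"
    then obtain Q where Q: "Q \<in> set ?Qs" "g \<in> set (pack Q)"
      unfolding mset_eq_setD[OF ms] by auto
    with peel_block_filter[OF sel(1) Q(1)] pack(2) show "machine_ok g \<and> g \<noteq> []" by blast
  qed
qed

definition ok_items :: "item list \<Rightarrow> bool" where
  "ok_items L \<longleftrightarrow> distinct (map fst L) \<and> sorted (map item_start L) \<and>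
     (\<forall>x\<in>set L. 0 < item_weight x \<and> item_weight x \<le> 1 \<and> item_start x < item_finish x)"

lemma ok_items_filter: "ok_items L \<Longrightarrow> ok_items (filter P L)"
  unfolding ok_items_def by (auto intro: distinct_map_filter sorted_filter)

lemma ok_itemsD:
  assumes "ok_items L" "x \<in> set L"
  shows "0 < item_weight x" "item_weight x \<le> 1" "item_active x (item_start x)"
  using assms unfolding ok_items_def active_def by blast+

lemma block_weight_pos: "0 < item_weight x \<Longrightarrow> 0 < block_weight u x"
  by (simp add: block_weight_def)

lemma layers_machines:
  assumes "ok_items L" "0 < c"
  shows "mset (concat (layers u c L)) = mset L"
    "\<forall>g\<in>set (layers u c L). machine_ok g \<and> g \<noteq> []"
proof -
  \<comment> \<open>An item of \<open>R\<close> creates positive load at its own start, which an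
    empty block cannot cover.\<close>
  have ne: "prune (block_weight u) c R \<noteq> []" if R: "R \<noteq> []" "set R \<subseteq> set L" for R
  proof -
    obtain x where x: "x \<in> set R" using R(1) by (cases R) auto
    have pos: "0 < block_weight u y" if "y \<in> set R" for y
      using block_weight_pos ok_itemsD(1)[OF assms(1)] R(2) that by blast
    have "0 < load (block_weight u) R (item_start x)"
      using load_pos[of R _ x] pos x ok_itemsD(3)[OF assms(1)] R(2) by blast
    moreover have "covers_at (block_weight u) c R (prune (block_weight u) c R) (item_start x)"
      using pos by (intro prune_covers) (auto intro: less_imp_le)
    ultimately show ?thesis using assms(2) by (auto simp: covers_at_def)
  qed
  have any: "machine_ok g \<and> g \<noteq> []" if "g \<in> set (any_fit (filter P L))" for g P
  proof -
    have ok: "ok_items (filter P L)" by (rule ok_items_filter[OF assms(1)])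
    have "\<forall>g\<in>set (any_fit (filter P L)). machine_ok g"
      using ok ok_itemsD[OF ok] by (intro any_fit_ok) (simp_all add: ok_items_def less_imp_le)
    then show ?thesis using any_fit_not_Nil[of "filter P L"] that by metis
  qed
  have dist: "distinct (map fst L)" using assms(1) by (simp add: ok_items_def)
  note pgm = peel_groups_machines[of "prune (block_weight u) c" L any_fit]
  show "mset (concat (layers u c L)) = mset L"
    unfolding layers_def by (rule pgm(1)) (use ne any dist prune_filter mset_concat_any_fit in blast)+
  show "\<forall>g\<in>set (layers u c L). machine_ok g \<and> g \<noteq> []"
    unfolding layers_def by (rule pgm(2)) (use ne any dist prune_filter mset_concat_any_fit in blast)+
qed

lemma num_active_layers_le:
  assumes "ok_items L" "0 < c" "0 < c'" "\<And>x. x \<in> set L \<Longrightarrow> block_weight u x \<le> \<delta>" "0 < \<delta>"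
    and "\<And>Q t. set Q \<subseteq> set L \<Longrightarrow> c \<le> load (block_weight u) Q t \<Longrightarrow> c' \<le> load (block_weight u) Q t"
    and "\<And>g x. set g \<subseteq> set L \<Longrightarrow> x \<in> set L \<Longrightarrow> 1 - item_weight x < load item_weight g (item_start x) \<Longrightarrow>
       2 * (c + \<delta>) \<le> 2 * load (block_weight u) g (item_start x) + block_weight u x"
  shows "num_active (layers u c L) t \<le> 2 * of_int \<lceil>load (block_weight u) L t / c'\<rceil>"
proof -
  have "num_active (layers u c L) t = num_active (concat (map any_fit (peel (prune (block_weight u) c) (length L) L))) t"
    unfolding layers_def by (rule num_active_mset_cong[OF mset_peel_groups])
  also have "\<dots> \<le> 2 * of_int \<lceil>load (block_weight u) L t / c'\<rceil>"
  proof (rule num_active_layers[where \<delta> = \<delta>])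
    show "2 * (c + \<delta>) \<le> 2 * load (block_weight u) g (item_start x) + block_weight u x"
      if "set g \<subseteq> set L" "x \<in> set L" "\<not> fits g x" for g x
      using assms(7)[OF that(1,2)] that(3) by (simp add: fits_def)
  qed (use assms ok_itemsD[OF assms(1)] block_weight_pos in \<open>auto simp: ok_items_def\<close>)
  finally show ?thesis .
qed

lemma load_one: "load (\<lambda>_. 1) xs t = real (length (filter (\<lambda>x. item_active x t) xs))"
  by (induction xs) auto

lemma load_cong_fun: "(\<And>x. x \<in> set xs \<Longrightarrow> v x = u x) \<Longrightarrow> load v xs t = load u xs t"
  by (induction xs) auto

text \<open>A machine that rejects \<open>x\<close> of size \<open>w <= 1/4\<close> has load above
  \<open>1 - w\<close>, and \<open>2 * 8 * (1 - w) + 8 * w = 16 - 8 * w >= 14 = 2 * (5 + 2)\<close>.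
  Two machines per weight 5, that is per load 5/8, give the factor 16/5; rounding up costs
  2.\<close>

lemma small_layers:
  assumes "ok_items L" "\<And>x. x \<in> set L \<Longrightarrow> 4 * item_weight x \<le> 1"
  shows "num_active (layers False 5 L) t \<le> 16/5 * load item_weight L t + 2"
proof -
  have ld: "load (block_weight False) g t = 8 * load item_weight g t" if "set g \<subseteq> set L" for g t
    unfolding load_scale[symmetric]
    using assms(2) that by (intro load_cong_fun) (auto simp: block_weight_def)
  have "num_active (layers False 5 L) t \<le> 2 * of_int \<lceil>load (block_weight False) L t / 5\<rceil>"
  proof (rule num_active_layers_le[where \<delta> = 2])
    fix g x assume g: "set g \<subseteq> set L" "x \<in> set L" "1 - item_weight x < load item_weight g (item_start x)"
    with assms(2)[OF g(2)] show "2 * (5 + 2) \<le> 2 * load (block_weight False) g (item_start x) + block_weight False x"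
      by (simp add: ld[OF g(1)] block_weight_def)
  qed (use assms in \<open>auto simp: block_weight_def\<close>)
  then show ?thesis using ld[OF subset_refl, of t] by linarith
qed

text \<open>A machine that rejects an item of size at most 1/3 holds at least three active items,
  and \<open>2 * (2 * 3) + 2 = 14\<close> again. There are two machines per 5/2 items and at most 4
  items per unit of load, which gives 16/5 once more.\<close>

lemma middle_layers:
  assumes "ok_items L" "\<And>x. x \<in> set L \<Longrightarrow> 3 * item_weight x \<le> 1 \<and> 1 < 4 * item_weight x"
  shows "num_active (layers False 5 L) t \<le> 16/5 * load item_weight L t + 2"
proof -
  have ld: "load (block_weight False) g t = 2 * load (\<lambda>_. 1) g t" if "set g \<subseteq> set L" for g t
    unfolding load_scale[symmetric]
    using assms(2) that by (intro load_cong_fun) (fastforce simp: block_weight_def)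
  have "num_active (layers False 5 L) t \<le> 2 * of_int \<lceil>load (block_weight False) L t / 5\<rceil>"
  proof (rule num_active_layers_le[where \<delta> = 2])
    fix g x assume g: "set g \<subseteq> set L" "x \<in> set L" "1 - item_weight x < load item_weight g (item_start x)"
    have "load (\<lambda>y. 3 * item_weight y) g (item_start x) \<le> load (\<lambda>_. 1) g (item_start x)"
      using assms(2) g(1) by (intro load_mono_fun) auto
    then have "2 < load (\<lambda>_. 1) g (item_start x)"
      using g assms(2)[OF g(2)] unfolding load_scale by linarith
    then have "3 \<le> load (\<lambda>_. 1) g (item_start x)" unfolding load_one by simp
    then show "2 * (5 + 2) \<le> 2 * load (block_weight False) g (item_start x) + block_weight False x"
      using assms(2)[OF g(2)] by (simp add: ld[OF g(1)] block_weight_def)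
  qed (use assms in \<open>auto simp: block_weight_def\<close>)
  moreover have "load (\<lambda>_. 1) L t \<le> load (\<lambda>x. 4 * item_weight x) L t"
    using assms(2) by (intro load_mono_fun) (auto intro: less_imp_le)
  ultimately show ?thesis using ld[OF subset_refl, of t] unfolding load_scale by linarith
qed

text \<open>Every active machine holds an active item, so for large sizes counting items is enough
  and the quality of the packing does not matter.\<close>

lemma num_active_layers_le_count:
  assumes "ok_items L" "0 < c" "\<And>x. x \<in> set L \<Longrightarrow> 1 \<le> a * item_weight x"
  shows "num_active (layers u c L) t \<le> a * load item_weight L t"
proof -
  have "num_active (layers u c L) t \<le> load (\<lambda>_. 1) (concat (layers u c L)) t"
    by (rule num_active_le_load)
  also have "\<dots> = load (\<lambda>_. 1) L t" by (rule load_mset_cong[OF layers_machines(1)[OF assms(1,2)]])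
  also have "\<dots> \<le> load (\<lambda>x. a * item_weight x) L t" using assms(3) by (intro load_mono_fun)
  finally show ?thesis by (simp add: load_scale)
qed

lemma mixed_machines:
  assumes "ok_items L"
  shows "mset (concat (mixed_machines L)) = mset L"
    "\<forall>g\<in>set (mixed_machines L). machine_ok g \<and> g \<noteq> []"
proof -
  note lm = layers_machines[OF ok_items_filter[OF assms]]
  show "mset (concat (mixed_machines L)) = mset L"
    unfolding mixed_machines_def using lm(1)[of 5 False]
    by (auto simp: multiset_eq_iff)
  show "\<forall>g\<in>set (mixed_machines L). machine_ok g \<and> g \<noteq> []"
    unfolding mixed_machines_def using lm(2)[of 5 False] by auto
qed

text \<open>The bounds differ in the sizes between 1/4 and 1/3: their layers cost a second additive
  2, counting them individually costs the factor 4. The second bound serves \<open>k = 3\<close>,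
  where an additive 4 is too much.\<close>

lemma num_active_mixed:
  assumes "ok_items L"
  shows "num_active (mixed_machines L) t \<le> 16/5 * load item_weight L t + 4"
    "num_active (mixed_machines L) t \<le> 4 * load item_weight L t + 2"
proof -
  let ?A = "filter (\<lambda>x. 1 < 3 * item_weight x) L"
  let ?B = "filter (\<lambda>x. 3 * item_weight x \<le> 1 \<and> 1 < 4 * item_weight x) L"
  let ?C = "filter (\<lambda>x. 4 * item_weight x \<le> 1) L"
  note ok = ok_items_filter[OF assms]
  have n: "num_active (mixed_machines L) t =
      num_active (layers False 5 ?A) t + num_active (layers False 5 ?B) t + num_active (layers False 5 ?C) t"
    by (simp add: mixed_machines_def num_active_append)
  have l: "load item_weight L t = load item_weight ?A t + load item_weight ?B t + load item_weight ?C t"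
    by (induction L) auto
  have "0 \<le> load item_weight (filter P L) t" for P
    using ok_itemsD(1)[OF assms] by (intro load_nonneg) (auto intro: less_imp_le)
  note pos = this[of "\<lambda>x. 1 < 3 * item_weight x"]
    this[of "\<lambda>x. 3 * item_weight x \<le> 1 \<and> 1 < 4 * item_weight x"] this[of "\<lambda>x. 4 * item_weight x \<le> 1"]
  have A: "num_active (layers False 5 ?A) t \<le> 3 * load item_weight ?A t"
    by (rule num_active_layers_le_count[OF ok]) auto
  have B: "num_active (layers False 5 ?B) t \<le> 16/5 * load item_weight ?B t + 2"
    by (rule middle_layers[OF ok]) auto
  have B': "num_active (layers False 5 ?B) t \<le> 4 * load item_weight ?B t"
    by (rule num_active_layers_le_count[OF ok]) auto
  have C: "num_active (layers False 5 ?C) t \<le> 16/5 * load item_weight ?C t + 2"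
    by (rule small_layers[OF ok]) auto
  show "num_active (mixed_machines L) t \<le> 16/5 * load item_weight L t + 4"
    using n l A B C pos by linarith
  show "num_active (mixed_machines L) t \<le> 4 * load item_weight L t + 2"
    using n l A B' C pos by linarith
qed

lemma uniform_machines:
  assumes "ok_items L" "L \<noteq> []"
  shows "mset (concat (uniform_machines L)) = mset L"
    "\<forall>g\<in>set (uniform_machines L). machine_ok g \<and> g \<noteq> []"
proof -
  have "0 < 2 - item_weight (hd L)" using ok_itemsD(2)[OF assms(1), of "hd L"] assms(2) by simp
  from layers_machines[OF assms(1) this, of True]
  show "mset (concat (uniform_machines L)) = mset L"
    "\<forall>g\<in>set (uniform_machines L). machine_ok g \<and> g \<noteq> []"
    unfolding uniform_machines_def by blast+
qed

text \<open>For size \<open>1/g\<close> all weights \<open>2 * item_weight\<close> add up to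
  multiples of \<open>2/g\<close>, so a layer reaching \<open>c = 2 - 1/g\<close> reaches
  \<open>c' = 2\<close>, a full unit of size. The lower threshold is what makes two machines
  suffice: a machine that rejects an item is full, and \<open>2 * 2 + 2/g\<close> is exactly
  \<open>2 * (c + 2/g)\<close>.\<close>

lemma num_active_uniform:
  fixes k :: nat
  assumes "ok_items L" "L \<noteq> []" "k \<ge> 1" "\<And>x. x \<in> set L \<Longrightarrow> item_weight x = 1 / real k"
  shows "num_active (uniform_machines L) t \<le> 2 * of_int \<lceil>load item_weight L t\<rceil>"
proof -
  let ?w = "1 / real k"
  have w: "item_weight (hd L) = ?w" using assms(2,4) by simp
  have w01: "0 < ?w" "?w \<le> 1" using assms(3) by auto
  have ld: "load (block_weight True) g t = 2 * load item_weight g t" for g t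
    unfolding load_scale[symmetric] by (intro load_cong_fun) (auto simp: block_weight_def)
  have cnt: "real k * load item_weight g t = load (\<lambda>_. 1) g t" if "set g \<subseteq> set L" for g t
    unfolding load_scale[symmetric] using assms(3,4) that by (intro load_cong_fun) auto
  have full: "1 \<le> load item_weight g t" if g: "set g \<subseteq> set L" and gt: "1 - ?w < load item_weight g t" for g t
  proof -
    have "real k * (1 - ?w) < real k * load item_weight g t" using gt assms(3) by simp
    then have "real k - 1 < load (\<lambda>_. 1) g t" using cnt[OF g] assms(3) by (simp add: right_diff_distrib)
    then have "real k \<le> load (\<lambda>_. 1) g t"
      unfolding load_one by simp
    then have "real k * 1 \<le> real k * load item_weight g t" using cnt[OF g] by simp
    then show ?thesis using assms(3) by (simp only: mult_le_cancel_left_pos of_nat_0_less_iff)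
  qed
  have "num_active (layers True (2 - ?w) L) t \<le> 2 * of_int \<lceil>load (block_weight True) L t / 2\<rceil>"
  proof (rule num_active_layers_le[where \<delta> = "2 * ?w"])
    fix Q t assume "set Q \<subseteq> set L" "2 - ?w \<le> load (block_weight True) Q t"
    then have "1 - ?w < load item_weight Q t" using w01 unfolding ld by linarith
    with full[of Q t] \<open>set Q \<subseteq> set L\<close> show "2 \<le> load (block_weight True) Q t" by (simp add: ld)
  next
    fix g x assume g: "set g \<subseteq> set L" "x \<in> set L" "1 - item_weight x < load item_weight g (item_start x)"
    with full[OF g(1)] assms(4) show "2 * (2 - ?w + 2 * ?w) \<le> 2 * load (block_weight True) g (item_start x) + block_weight True x"
      by (simp add: ld block_weight_def)
  next
    show "0 < 2 - ?w" using w01 by linarith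
  qed (use assms w01 in \<open>auto simp: block_weight_def\<close>)
  then show ?thesis by (simp add: uniform_machines_def w ld)
qed

lemma ok_items_sort_items:
  assumes "valid_instance T I"
  shows "ok_items (sort_items (items I))"
proof -
  have ms: "mset (sort_items (items I)) = mset (items I)" by (rule mset_sort_items)
  have "distinct (map fst (sort_items (items I)))"
    using distinct_items[of I] mset_map[of fst] ms by (metis mset_eq_imp_distinct_iff)
  moreover have "0 < item_weight x \<and> item_weight x \<le> 1 \<and> item_start x < item_finish x"
    if "x \<in> set (sort_items (items I))" for x
  proof -
    have "x \<in> set (items I)" using that mset_eq_setD[OF ms] by simp
    then have "snd x \<in> set I" by (simp add: set_items)
    then show ?thesis using assms by (simp add: valid_instance_def)
  qed
  ultimately show ?thesis unfolding ok_items_def using sorted_sort_items by blast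
qed

section \<open>Harmonic machines\<close>

abbreviation item_dur :: "item \<Rightarrow> real" where
  "item_dur x \<equiv> duration (snd x)"

text \<open>Describes the bins that Next-Fit produces by conditions on neighbours only. Hence the
  description is inherited by every consecutive stretch of bins, and Next-Fit applied to the items
  of the stretch alone gives back the same bins.\<close>

fun nf_chain :: "real list list \<Rightarrow> bool" where
  "nf_chain [] \<longleftrightarrow> True"
| "nf_chain [g] \<longleftrightarrow> g \<noteq> [] \<and> sum_list g \<le> 1"
| "nf_chain (g # h # gs) \<longleftrightarrow> g \<noteq> [] \<and> sum_list g \<le> 1 \<and> 1 < sum_list g + hd h \<and> nf_chain (h # gs)"

lemma nf_chain_append: "nf_chain (xs @ ys) \<Longrightarrow> nf_chain xs \<and> nf_chain ys"
proof (induction xs rule: nf_chain.induct)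
  case (2 g)
  then show ?case by (cases ys) auto
qed auto

lemma nf_chain_takeWhile: "nf_chain (map f xs) \<Longrightarrow> nf_chain (map f (takeWhile P xs))"
  by (metis map_append nf_chain_append takeWhile_dropWhile_id)

lemma nf_chain_dropWhile: "nf_chain (map f xs) \<Longrightarrow> nf_chain (map f (dropWhile P xs))"
  by (metis map_append nf_chain_append takeWhile_dropWhile_id)

lemma next_fit_from_fits:
  assumes "\<And>x. x \<in> set xs \<Longrightarrow> 0 \<le> x" "l + sum_list xs \<le> 1"
  shows "next_fit_from l (xs @ ys) = next_fit_from (l + sum_list xs) ys"
  using assms
proof (induction xs arbitrary: l)
  case (Cons x xs)
  have "0 \<le> sum_list xs" using Cons.prems(1) by (intro sum_list_nonneg) auto
  with Cons.prems(2) have "l + x \<le> 1" by simp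
  moreover have "next_fit_from (l + x) (xs @ ys) = next_fit_from (l + x + sum_list xs) ys"
    using Cons.prems by (intro Cons.IH) (auto simp: add.assoc)
  ultimately show ?case by (simp add: add.assoc)
qed simp

lemma next_fit_chain:
  assumes "nf_chain gs" "\<And>g x. g \<in> set gs \<Longrightarrow> x \<in> set g \<Longrightarrow> 0 \<le> x"
  shows "next_fit (concat gs) = length gs"
  using assms
proof (induction gs rule: nf_chain.induct)
  case (2 g)
  then obtain x xs where g: "g = x # xs" by (cases g) auto
  with 2 have "next_fit_from x (xs @ []) = next_fit_from (x + sum_list xs) []"
    by (intro next_fit_from_fits) auto
  with g show ?case by simp
next
  case (3 g h gs)
  then obtain x xs where g: "g = x # xs" by (cases g) auto
  from 3 have "h \<noteq> []" by (cases gs) auto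
  then obtain y ys where h: "h = y # ys" by (cases h) auto
  have "next_fit (concat (g # h # gs)) = Suc (next_fit_from x (xs @ concat (h # gs)))" by (simp add: g)
  also have "next_fit_from x (xs @ concat (h # gs)) = next_fit_from (x + sum_list xs) (concat (h # gs))"
  proof (rule next_fit_from_fits)
    show "0 \<le> y" if "y \<in> set xs" for y using "3.prems"(2)[of g y] g that by simp
  qed (use 3 g in auto)
  also have "\<dots> = next_fit (concat (h # gs))" using 3 g h by auto
  also have "\<dots> = length (h # gs)" using 3 by (intro "3.IH") auto
  finally show ?case by simp
qed simp

definition nf_step :: "item \<Rightarrow> item list list \<Rightarrow> item list list" where
  "nf_step x gs = (if gs = [] then [[x]]
     else if sum_list (map item_weight (hd gs)) + item_weight x \<le> 1 then (x # hd gs) # tl gs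
     else [x] # gs)"

text \<open>The machines and the items on each of them are in reverse order.\<close>

definition nf_groups :: "item list \<Rightarrow> item list list" where
  "nf_groups xs = fold nf_step xs []"

definition nf_forward :: "item list \<Rightarrow> item list list" where
  "nf_forward xs = rev (map rev (nf_groups xs))"

lemma nf_chain_snoc:
  "nf_chain (gs @ [g]) \<Longrightarrow> h \<noteq> [] \<Longrightarrow> sum_list h \<le> 1 \<Longrightarrow> 1 < sum_list g + hd h \<Longrightarrow> nf_chain (gs @ [g, h])"
proof (induction gs rule: nf_chain.induct)
  case (3 a b gs)
  then show ?case by (cases gs) auto
qed auto

lemma nf_chain_extend:
  "nf_chain (gs @ [g]) \<Longrightarrow> sum_list g + x \<le> 1 \<Longrightarrow> nf_chain (gs @ [g @ [x]])"
  by (induction gs rule: nf_chain.induct) auto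

lemma nf_forward:
  assumes "\<And>x. x \<in> set xs \<Longrightarrow> item_weight x \<le> 1"
  shows "concat (nf_forward xs) = xs \<and> nf_chain (map (map item_weight) (nf_forward xs))"
  using assms
proof (induction xs rule: rev_induct)
  case (snoc x xs)
  then have IH: "concat (nf_forward xs) = xs" "nf_chain (map (map item_weight) (nf_forward xs))" by auto
  have x: "item_weight x \<le> 1" using snoc.prems by simp
  have step: "nf_groups (xs @ [x]) = nf_step x (nf_groups xs)" by (simp add: nf_groups_def)
  show ?case
  proof (cases "nf_groups xs")
    case Nil
    then have "xs = []" using IH(1) by (simp add: nf_forward_def)
    with Nil x show ?thesis by (simp add: nf_forward_def nf_groups_def nf_step_def)
  next
    case (Cons g gs)
    define G where "G = rev (map rev gs)"
    have old: "nf_forward xs = G @ [rev g]" by (simp add: nf_forward_def Cons G_def)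
    show ?thesis
    proof (cases "sum_list (map item_weight g) + item_weight x \<le> 1")
      case True
      then have "nf_forward (xs @ [x]) = G @ [rev g @ [x]]"
        by (simp add: nf_forward_def step nf_step_def Cons G_def)
      with IH old True show ?thesis
        by (auto intro!: nf_chain_extend simp: sum_list_rev simp flip: rev_map)
    next
      case False
      then have "nf_forward (xs @ [x]) = G @ [rev g, [x]]"
        by (simp add: nf_forward_def step nf_step_def Cons G_def)
      with IH old False x show ?thesis
        by (auto intro!: nf_chain_snoc simp: sum_list_rev simp flip: rev_map)
    qed
  qed
qed (simp add: nf_forward_def nf_groups_def)

lemma nf_chainD: "nf_chain gs \<Longrightarrow> g \<in> set gs \<Longrightarrow> g \<noteq> [] \<and> sum_list g \<le> 1"
  by (induction gs rule: nf_chain.induct) auto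

text \<open>Next-Fit is used statically here: a machine is filled to total size 1 counting requests
  that have already ended, so it can never be overloaded.\<close>

lemma machine_ok_total:
  assumes "\<And>x. x \<in> set g \<Longrightarrow> 0 \<le> item_weight x" "sum_list (map item_weight g) \<le> 1"
  shows "machine_ok g"
  unfolding machine_ok_def load_def
proof
  fix t
  have "(\<Sum>x\<leftarrow>g. if item_active x t then item_weight x else 0) \<le> sum_list (map item_weight g)"
    using assms(1) by (intro sum_list_mono) auto
  with assms(2) show "(\<Sum>x\<leftarrow>g. if item_active x t then item_weight x else 0) \<le> 1" by simp
qed

lemma nf_groups_machines:
  assumes "ok_items xs"
  shows "mset (concat (nf_groups xs)) = mset xs"
    "\<forall>g\<in>set (nf_groups xs). machine_ok g \<and> g \<noteq> []"
proof -
  have nf: "concat (nf_forward xs) = xs" "nf_chain (map (map item_weight) (nf_forward xs))"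
    using nf_forward[of xs] ok_itemsD[OF assms] by auto
  have groups: "nf_groups xs = rev (map rev (nf_forward xs))" by (simp add: nf_forward_def rev_map comp_def)
  have "mset (concat (rev (map rev gs))) = mset (concat gs)" for gs :: "item list list"
    by (induction gs) auto
  then show ms: "mset (concat (nf_groups xs)) = mset xs" by (simp add: groups nf(1))
  show "\<forall>g\<in>set (nf_groups xs). machine_ok g \<and> g \<noteq> []"
  proof
    fix g assume g: "g \<in> set (nf_groups xs)"
    then have "map item_weight (rev g) \<in> set (map (map item_weight) (nf_forward xs))"
      by (force simp: nf_forward_def)
    from nf_chainD[OF nf(2) this] have 1: "g \<noteq> []" "sum_list (map item_weight g) \<le> 1"
      by (auto simp: rev_map[symmetric] sum_list_rev)
    have "set g \<subseteq> set xs" using g mset_eq_setD[OF ms] by auto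
    then have "machine_ok g"
      using 1 ok_itemsD(1)[OF assms] by (intro machine_ok_total) (auto intro: less_imp_le)
    with 1 show "machine_ok g \<and> g \<noteq> []" by simp
  qed
qed

fun harmonic_pack :: "nat \<Rightarrow> nat \<Rightarrow> item list \<Rightarrow> item list list" where
  "harmonic_pack k 0 Q = []"
| "harmonic_pack k (Suc j) Q =
     nf_groups (filter (\<lambda>x. in_harmonic_class k (Suc j) (item_weight x)) Q) @ harmonic_pack k j Q"

lemma sum_list_harmonic_pack:
  "(\<Sum>g\<leftarrow>harmonic_pack k j Q. f g) =
   (\<Sum>i=1..j. \<Sum>g\<leftarrow>nf_groups (filter (\<lambda>x. in_harmonic_class k i (item_weight x)) Q). (f g :: 'b :: comm_monoid_add))"
  by (induction j) (auto simp: add.commute)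

lemma set_harmonic_pack:
  "g \<in> set (harmonic_pack k j Q) \<Longrightarrow>
   \<exists>i\<in>{1..j}. g \<in> set (nf_groups (filter (\<lambda>x. in_harmonic_class k i (item_weight x)) Q))"
  by (induction j) (auto, (metis atLeastAtMost_iff le_Suc_eq)+)

text \<open>Stated for commutative monoids so that, with singletons as \<open>f x\<close>, it says
  that the classes partition the multiset of items.\<close>

lemma sum_harmonic_filter:
  assumes "\<And>x. x \<in> set Q \<Longrightarrow> 0 < item_weight x \<and> item_weight x \<le> 1" "1 \<le> k"
  shows "(\<Sum>i=1..k. \<Sum>x\<leftarrow>filter (\<lambda>x. in_harmonic_class k i (item_weight x)) Q. f x)
     = (\<Sum>x\<leftarrow>Q. (f x :: 'b :: comm_monoid_add))"
  using assms(1)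
proof (induction Q)
  case (Cons x Q)
  then obtain j where j: "j \<in> {1..k}" "in_harmonic_class k j (item_weight x)"
    using in_harmonic_class_exists[of "item_weight x" k] assms(2) by fastforce
  have eq: "in_harmonic_class k i (item_weight x) \<longleftrightarrow> i = j" if "i \<in> {1..k}" for i
    using j that in_harmonic_class_unique by blast
  have "(\<Sum>i=1..k. \<Sum>y\<leftarrow>filter (\<lambda>x. in_harmonic_class k i (item_weight x)) (x # Q). f y)
     = (\<Sum>i=1..k. (if i = j then f x else 0) + (\<Sum>y\<leftarrow>filter (\<lambda>x. in_harmonic_class k i (item_weight x)) Q. f y))"
    using eq by (intro sum.cong) auto
  then show ?case using Cons j by (simp add: sum.distrib)
qed simp

lemma mset_as_sum: "mset xs = (\<Sum>x\<leftarrow>xs. {#x#})"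
  by (induction xs) auto

lemma harmonic_pack_machines:
  assumes "ok_items Q" "1 \<le> k"
  shows "mset (concat (harmonic_pack k k Q)) = mset Q"
    "\<forall>g\<in>set (harmonic_pack k k Q). machine_ok g \<and> g \<noteq> []"
proof -
  have "mset (concat (harmonic_pack k k Q)) = (\<Sum>g\<leftarrow>harmonic_pack k k Q. mset g)"
    by (simp add: mset_concat flip: sum_mset_sum_list)
  also have "\<dots> = (\<Sum>i=1..k. mset (concat (nf_groups (filter (\<lambda>x. in_harmonic_class k i (item_weight x)) Q))))"
    unfolding sum_list_harmonic_pack by (simp add: mset_concat flip: sum_mset_sum_list)
  also have "\<dots> = (\<Sum>i=1..k. mset (filter (\<lambda>x. in_harmonic_class k i (item_weight x)) Q))"
    by (intro sum.cong refl nf_groups_machines ok_items_filter assms)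
  also have "\<dots> = mset Q"
    unfolding mset_as_sum using ok_itemsD[OF assms(1)] assms(2) by (intro sum_harmonic_filter) auto
  finally show "mset (concat (harmonic_pack k k Q)) = mset Q" .
  show "\<forall>g\<in>set (harmonic_pack k k Q). machine_ok g \<and> g \<noteq> []"
    using set_harmonic_pack nf_groups_machines(2)[OF ok_items_filter[OF assms(1)]] by blast
qed

text \<open>The items within a factor \<open>1 + 1/m\<close> of the shortest one. Comparing with
  every \<open>z\<close> and multiplying by \<open>m\<close> avoids both the minimum and the
  division.\<close>

definition similar :: "nat \<Rightarrow> item list \<Rightarrow> item list" where
  "similar m R = filter (\<lambda>y. \<forall>z\<in>set R. real m * item_dur y \<le> real m * item_dur z + item_dur z) R"

definition harmonic_machines :: "nat \<Rightarrow> nat \<Rightarrow> item list \<Rightarrow> item list list" where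
  "harmonic_machines k m L = peel_groups (similar m) (harmonic_pack k k) L"

lemma item_dur_pos: "ok_items L \<Longrightarrow> x \<in> set L \<Longrightarrow> 0 < item_dur x"
  unfolding ok_items_def duration_def by force

lemma similar_ne:
  assumes "R \<noteq> []" "\<And>x. x \<in> set R \<Longrightarrow> 0 < item_dur x"
  shows "\<exists>z\<in>set (similar m R). \<forall>x\<in>set R. item_dur z \<le> item_dur x"
proof -
  have "Min (item_dur ` set R) \<in> item_dur ` set R" using assms(1) by (intro Min_in) auto
  then obtain z where z: "z \<in> set R" "item_dur z = Min (item_dur ` set R)" by auto
  then have le: "item_dur z \<le> item_dur x" if "x \<in> set R" for x using that by simp
  have "real m * item_dur z \<le> real m * item_dur x + item_dur x" if "x \<in> set R" for x
    using mult_left_mono[OF le[OF that], of "real m"] assms(2)[OF that] by simp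
  then have "z \<in> set (similar m R)" using z by (simp add: similar_def)
  with le show ?thesis by blast
qed

lemma harmonic_machines:
  assumes "ok_items L" "1 \<le> k"
  shows "mset (concat (harmonic_machines k m L)) = mset L"
    "\<forall>g\<in>set (harmonic_machines k m L). machine_ok g \<and> g \<noteq> []"
proof -
  have sel: "\<exists>P. similar m R = filter P R" for R by (auto simp: similar_def)
  have ne: "similar m R \<noteq> []" if "R \<noteq> []" "set R \<subseteq> set L" for R
    using similar_ne[OF that(1), of m] item_dur_pos[OF assms(1)] that(2) by fastforce
  have dist: "distinct (map fst L)" using assms(1) by (simp add: ok_items_def)
  note hp = harmonic_pack_machines[OF ok_items_filter[OF assms(1)] assms(2)]
  show "mset (concat (harmonic_machines k m L)) = mset L"
    unfolding harmonic_machines_def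
    by (rule peel_groups_machines(1)[OF sel ne dist hp(1)]) (use hp(2) in blast)+
  show "\<forall>g\<in>set (harmonic_machines k m L). machine_ok g \<and> g \<noteq> []"
    unfolding harmonic_machines_def
    by (rule peel_groups_machines(2)[OF sel ne dist hp(1)]) (use hp(2) in blast)+
qed

section \<open>Next-Fit machines of items of similar duration\<close>

definition core :: "real \<Rightarrow> item list \<Rightarrow> real set" where
  "core d g = {item_start (last g)..<item_start (hd g) + d}"

lemma sorted_hd_last:
  assumes "sorted (map f g)" "x \<in> set g"
  shows "f (hd g) \<le> f x" "f x \<le> (f (last g) :: real)"
proof -
  show "f (hd g) \<le> f x" using assms by (cases g) auto
  show "f x \<le> f (last g)" using assms
    by (cases g rule: rev_cases) (auto simp: sorted_append)
qed

text \<open>A machine wastes time only while it is being filled and while its items run out.\<close>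

lemma span_le_core:
  assumes "g \<noteq> []" "sorted (map item_start g)" "\<And>x. x \<in> set g \<Longrightarrow> item_dur x \<le> (1 + \<epsilon>) * d"
    "0 \<le> \<epsilon>" "\<epsilon> \<le> 1" "0 < d"
  shows "busy_time g \<le> (1 + \<epsilon>) * measure lborel (core d g) + 3 * (item_start (last g) - item_start (hd g))"
proof -
  let ?a = "item_start (hd g)" and ?b = "item_start (last g)"
  have ab: "?a \<le> ?b" using sorted_hd_last(1)[OF assms(2), of "last g"] assms(1) by simp
  have "0 \<le> (1 + \<epsilon>) * d" using assms by simp
  have sub: "active_set g \<subseteq> {?a..<?b + (1 + \<epsilon>) * d}"
  proof
    fix t assume "t \<in> active_set g"
    then obtain x where x: "x \<in> set g" "item_active x t" by (auto simp: active_set_def)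
    with sorted_hd_last[OF assms(2) x(1)] assms(3)[OF x(1)]
    show "t \<in> {?a..<?b + (1 + \<epsilon>) * d}" by (auto simp: active_def duration_def)
  qed
  have "busy_time g \<le> measure lborel {?a..<?b + (1 + \<epsilon>) * d}"
    unfolding busy_time_def using sub fmeasurable_active_set[of g] ab \<open>0 \<le> (1 + \<epsilon>) * d\<close>
    by (intro measure_mono_fmeasurable) (auto simp: fmeasurable_def)
  also have "\<dots> = ?b - ?a + (1 + \<epsilon>) * d" using ab \<open>0 \<le> (1 + \<epsilon>) * d\<close> by simp
  \<comment> \<open>Let \<open>x\<close> be the filling time \<open>?b - ?a\<close>. If
    \<open>x <= d\<close>, the left side is
    \<open>(1 + \<epsilon>) * (d - x) + (2 + \<epsilon>) * x\<close>; otherwise the core is empty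
    and \<open>(1 + \<epsilon>) * d <= 2 * x\<close>. Both cases need \<open>\<epsilon> <= 1\<close>
    and give the factor 3.\<close>
  also have "\<dots> \<le> (1 + \<epsilon>) * max 0 (?a + d - ?b) + 3 * (?b - ?a)"
  proof (cases "?b - ?a \<le> d")
    case True
    have "\<epsilon> * (?b - ?a) \<le> 1 * (?b - ?a)" using assms ab by (intro mult_right_mono) auto
    with True ab show ?thesis by (simp add: algebra_simps max_def)
  next
    case False
    have "\<epsilon> * d \<le> 1 * d" using assms by (intro mult_right_mono) auto
    with False show ?thesis by (simp add: algebra_simps max_def)
  qed
  also have "max 0 (?a + d - ?b) = measure lborel (core d g)"
    unfolding core_def by (cases "?b \<le> ?a + d") (auto simp: max_def)
  finally show ?thesis .
qed

text \<open>No request starts after the last one, and none can end before the first start plus the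
  minimal duration.\<close>

lemma active_in_core:
  assumes "sorted (map item_start g)" "x \<in> set g" "d \<le> item_dur x" "t \<in> core d g"
  shows "item_active x t"
  using sorted_hd_last[OF assms(1,2)] assms(3,4) by (auto simp: core_def active_def duration_def)

text \<open>Next-Fit never returns to a closed bin, so the filling periods follow one another in
  time and the sum telescopes.\<close>

lemma sum_fill_times:
  assumes "sorted (map item_start (concat G))" "[] \<notin> set G"
    "\<And>x. x \<in> set (concat G) \<Longrightarrow> lo \<le> item_start x \<and> item_start x \<le> hi" "lo \<le> hi"
  shows "(\<Sum>g\<leftarrow>G. item_start (last g) - item_start (hd g)) \<le> hi - lo"
  using assms
proof (induction G arbitrary: lo)
  case (Cons g G)
  have g: "g \<noteq> []" using Cons.prems(2) by auto
  have "(\<Sum>g\<leftarrow>G. item_start (last g) - item_start (hd g)) \<le> hi - item_start (last g)"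
  proof (rule Cons.IH)
    fix x assume "x \<in> set (concat G)"
    moreover have "last g \<in> set g" using g by simp
    ultimately have "item_start (last g) \<le> item_start x"
      using Cons.prems(1) by (auto simp del: set_concat simp: sorted_append)
    then show "item_start (last g) \<le> item_start x \<and> item_start x \<le> hi"
      using Cons.prems(3)[of x] \<open>x \<in> set (concat G)\<close> by simp
  qed (use Cons.prems(1,2) Cons.prems(3)[of "last g"] g in \<open>auto simp: sorted_append\<close>)
  moreover have "lo \<le> item_start (hd g)" using Cons.prems(3)[of "hd g"] g by simp
  ultimately show ?case by simp
qed simp

lemma sorted_first_last:
  assumes "sorted (map item_start (concat G))" "[] \<notin> set G"
  shows "sorted (map (\<lambda>g. item_start (hd g)) G)" "sorted (map (\<lambda>g. item_start (last g)) G)"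
proof -
  have "sorted (map (\<lambda>g. item_start (hd g)) G) \<and> sorted (map (\<lambda>g. item_start (last g)) G)"
    using assms
  proof (induction G)
    case (Cons g G)
    have g: "g \<noteq> []" using Cons.prems(2) by auto
    have le: "item_start x \<le> item_start y" if "x \<in> set g" "h \<in> set G" "y \<in> set h" for x h y
      using Cons.prems(1) that by (auto simp: sorted_append)
    have "sorted (map item_start (concat G))" "[] \<notin> set G" using Cons.prems by (auto simp: sorted_append)
    with Cons.IH have IH: "sorted (map (\<lambda>g. item_start (hd g)) G)" "sorted (map (\<lambda>g. item_start (last g)) G)"
      by auto
    have "item_start (hd g) \<le> item_start (hd h)" "item_start (last g) \<le> item_start (last h)" if "h \<in> set G" for h
      using that g Cons.prems(2) by (auto intro!: le[of _ h] intro: hd_in_set last_in_set)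
    with IH show ?case by auto
  qed simp
  then show "sorted (map (\<lambda>g. item_start (hd g)) G)" "sorted (map (\<lambda>g. item_start (last g)) G)" by auto
qed

lemma filter_le_sorted: "sorted (map f xs) \<Longrightarrow> filter (\<lambda>x. f x \<le> (t :: real)) xs = takeWhile (\<lambda>x. f x \<le> t) xs"
proof (induction xs)
  case (Cons x xs)
  show ?case
  proof (cases "f x \<le> t")
    case False
    then have "filter (\<lambda>x. f x \<le> t) xs = []" using Cons.prems by (fastforce simp: filter_empty_conv)
    with False show ?thesis by simp
  qed (use Cons in simp)
qed simp

lemma filter_gt_sorted: "sorted (map f xs) \<Longrightarrow> filter (\<lambda>x. (t :: real) < f x) xs = dropWhile (\<lambda>x. \<not> t < f x) xs"
proof (induction xs)
  case (Cons x xs)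
  show ?case
  proof (cases "t < f x")
    case True
    then have "filter (\<lambda>x. t < f x) xs = xs" using Cons.prems by (fastforce simp: filter_id_conv)
    with True show ?thesis by simp
  qed (use Cons in simp)
qed simp

lemma sorted_sublist_concat: "sorted (map f (concat G)) \<Longrightarrow> g \<in> set G \<Longrightarrow> sorted (map f g)"
  by (induction G) (auto simp: sorted_append)

text \<open>The machines whose core contains \<open>t\<close> are consecutive, hence they are what Next-Fit
  makes of their items.\<close>

lemma length_filter_core:
  fixes t :: real
  assumes "ok_items xs" "\<And>x. x \<in> set xs \<Longrightarrow> d \<le> item_dur x"
  defines "F \<equiv> filter (\<lambda>g. t \<in> core d g) (nf_forward xs)"
  shows "length F = next_fit (map item_weight (concat F))"
    "mset (concat F) \<subseteq># mset xs" "\<And>x. x \<in> set (concat F) \<Longrightarrow> item_active x t"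
proof -
  let ?G = "nf_forward xs"
  have nf: "concat ?G = xs" "nf_chain (map (map item_weight) ?G)"
    using nf_forward[of xs] ok_itemsD[OF assms(1)] by auto
  have ne: "[] \<notin> set ?G" using nf_chainD[OF nf(2)] by fastforce
  have sorted: "sorted (map item_start (concat ?G))" using assms(1) nf(1) by (simp add: ok_items_def)
  have "sorted (map (\<lambda>g. item_start (hd g) + d) (filter (\<lambda>g. item_start (last g) \<le> t) ?G))"
    using sorted_first_last(1)[OF sorted ne]
    by (intro sorted_filter) (auto simp: sorted_iff_nth_mono)
  \<comment> \<open>Membership in the core means that the last start is at most \<open>t\<close> and
    the first start is after \<open>t - d\<close>. Both starts increase along the machines, so the
    first condition selects a prefix and the second a suffix of it.\<close>
  then have F: "F = dropWhile (\<lambda>g. \<not> t < item_start (hd g) + d) (takeWhile (\<lambda>g. item_start (last g) \<le> t) ?G)"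
    unfolding F_def core_def
    by (subst filter_gt_sorted[symmetric])
      (simp_all add: filter_le_sorted[OF sorted_first_last(2)[OF sorted ne], symmetric] conj_commute)
  have chain: "nf_chain (map (map item_weight) F)"
    unfolding F by (intro nf_chain_dropWhile nf_chain_takeWhile nf(2))
  have inF: "x \<in> set xs" if "g \<in> set F" "x \<in> set g" for g x
  proof -
    have "x \<in> set (concat ?G)" using that unfolding F_def by auto
    then show ?thesis using nf(1) by simp
  qed
  have "next_fit (concat (map (map item_weight) F)) = length (map (map item_weight) F)"
  proof (rule next_fit_chain[OF chain])
    fix g' w assume "g' \<in> set (map (map item_weight) F)" "w \<in> set g'"
    then obtain g x where "g \<in> set F" "x \<in> set g" "w = item_weight x" by auto
    then show "0 \<le> w" using ok_itemsD(1)[OF assms(1) inF, of g x] by simp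
  qed
  then show "length F = next_fit (map item_weight (concat F))" by (simp add: map_concat)
  have "mset (concat (filter P G)) \<subseteq># mset (concat G)" for P and G :: "item list list"
    by (induction G) (auto intro: subset_mset.add_mono subset_mset.add_increasing)
  then show "mset (concat F) \<subseteq># mset xs" unfolding F_def using nf(1) by metis
  show "item_active x t" if x: "x \<in> set (concat F)" for x
  proof -
    obtain g where g: "g \<in> set ?G" "t \<in> core d g" "x \<in> set g" using x unfolding F_def by auto
    moreover have "x \<in> set xs" using inF[of g x] g unfolding F_def by simp
    ultimately show ?thesis
      using sorted_sublist_concat[OF sorted g(1)] assms(2) by (intro active_in_core[of g x d]) auto
  qed
qed

lemma sum_span_nf:
  assumes "ok_items xs" "\<And>x. x \<in> set xs \<Longrightarrow> d \<le> item_dur x \<and> item_dur x \<le> (1 + \<epsilon>) * d"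
    "\<And>x. x \<in> set xs \<Longrightarrow> 0 \<le> item_start x \<and> item_start x \<le> T" "0 \<le> T" "0 \<le> \<epsilon>" "\<epsilon> \<le> 1" "0 < d"
  shows "(\<Sum>g\<leftarrow>nf_groups xs. busy_time g) \<le> (1 + \<epsilon>) * (\<Sum>g\<leftarrow>nf_forward xs. measure lborel (core d g)) + 3 * T"
proof -
  let ?G = "nf_forward xs"
  have nf: "concat ?G = xs" "nf_chain (map (map item_weight) ?G)"
    using nf_forward[of xs] ok_itemsD[OF assms(1)] by auto
  have ne: "[] \<notin> set ?G" using nf_chainD[OF nf(2)] by fastforce
  have sorted: "sorted (map item_start (concat ?G))" using assms(1) nf(1) by (simp add: ok_items_def)
  have "(\<Sum>g\<leftarrow>nf_groups xs. busy_time g) = (\<Sum>g\<leftarrow>?G. busy_time g)"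
    by (simp add: nf_forward_def comp_def sum_list_rev busy_time_def active_set_def flip: rev_map)
  also have "\<dots> \<le> (\<Sum>g\<leftarrow>?G. (1 + \<epsilon>) * measure lborel (core d g) + 3 * (item_start (last g) - item_start (hd g)))"
  proof (rule sum_list_mono)
    fix g assume g: "g \<in> set ?G"
    have "x \<in> set xs" if "x \<in> set g" for x using g that nf(1) by (metis UN_I set_concat)
    with g ne sorted_sublist_concat[OF sorted g] assms
    show "busy_time g \<le> (1 + \<epsilon>) * measure lborel (core d g) + 3 * (item_start (last g) - item_start (hd g))"
      by (intro span_le_core) auto
  qed
  also have "\<dots> = (1 + \<epsilon>) * (\<Sum>g\<leftarrow>?G. measure lborel (core d g)) + 3 * (\<Sum>g\<leftarrow>?G. item_start (last g) - item_start (hd g))"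
    unfolding sum_list_addf sum_list_const_mult ..
  also have "(\<Sum>g\<leftarrow>?G. item_start (last g) - item_start (hd g)) \<le> T - 0"
    using sorted ne assms(3,4) nf(1) by (intro sum_fill_times) auto
  finally show ?thesis by simp
qed

section \<open>The number of duration classes\<close>

text \<open>An item survives a round only if it exceeds some present item by more than the factor
  \<open>1 + 1/m\<close>, so the lower bound \<open>d\<close> grows by this factor in every round
  while durations stay below \<open>\<mu>\<close>. Rounds with empty blocks are filtered out,
  because \<open>peel\<close> runs for a fixed number of rounds.\<close>

lemma count_peel_similar:
  assumes "distinct (map fst R)" "\<And>x. x \<in> set R \<Longrightarrow> d \<le> item_dur x \<and> item_dur x \<le> \<mu>" "0 < d" "1 \<le> m"
    and C: "C = length (filter (\<lambda>Q. Q \<noteq> []) (peel (similar m) n R))" "0 < C"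
  shows "(1 + 1 / real m) ^ (C - 1) * d \<le> \<mu>"
  using assms(1-3) C
proof (induction n arbitrary: R d C)
  case (Suc n)
  let ?S = "remove_items (similar m R) R"
  have S: "?S = filter (\<lambda>y. \<not> (\<forall>z\<in>set R. real m * item_dur y \<le> real m * item_dur z + item_dur z)) R"
    by (rule remove_items_filter[OF Suc.prems(1)]) (rule similar_def)
  define C' where "C' = length (filter (\<lambda>Q. Q \<noteq> []) (peel (similar m) n ?S))"
  have C: "C = (if similar m R \<noteq> [] then 1 else 0) + C'"
    unfolding Suc.prems(4) C'_def by simp
  have S_dur: "(1 + 1 / real m) * d \<le> item_dur y \<and> item_dur y \<le> \<mu>" if "y \<in> set ?S" for y
  proof -
    from that obtain z where z: "z \<in> set R" "real m * item_dur z + item_dur z < real m * item_dur y" "y \<in> set R"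
      unfolding S by auto
    have "(1 + 1 / real m) * d \<le> (1 + 1 / real m) * item_dur z"
      using Suc.prems(2)[OF z(1)] by (intro mult_left_mono) auto
    also have "\<dots> \<le> item_dur y" using z(2) assms(4) by (simp add: field_simps)
    finally show ?thesis using Suc.prems(2)[OF z(3)] by simp
  qed
  have R: "R \<noteq> []"
  proof
    assume R: "R = []"
    have "length (filter (\<lambda>Q. Q \<noteq> []) (peel (similar m) i [])) = 0" for i
      by (induction i) (auto simp: similar_def remove_items_def)
    from this[of "Suc n"] Suc.prems(4,5) R show False by (simp del: peel.simps)
  qed
  then obtain x where x: "x \<in> set R" by (cases R) auto
  show ?case
  proof (cases "C' = 0")
    case True
    then have "C = 1" using C Suc.prems(5) by (auto split: if_splits)
    with Suc.prems(2)[OF x] show ?thesis by simp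
  next
    case False
    have "(1 + 1 / real m) ^ (C' - 1) * ((1 + 1 / real m) * d) \<le> \<mu>"
    proof (rule Suc.IH[OF _ S_dur _ C'_def])
      show "distinct (map fst ?S)" unfolding S using Suc.prems(1) by (rule distinct_map_filter)
    qed (use False Suc.prems(3) in \<open>auto intro!: mult_pos_pos add_pos_nonneg\<close>)
    then have *: "(1 + 1 / real m) ^ C' * d \<le> \<mu>" using False by (cases C') (simp_all add: mult.assoc mult.left_commute)
    \<comment> \<open>\<open>C\<close> is \<open>C'\<close> or \<open>C' + 1\<close> according to
      whether this round yields an empty block; \<open>C - 1 <= C'\<close> in both cases.\<close>
    have "(1 + 1 / real m) ^ (C - 1) * d \<le> (1 + 1 / real m) ^ C' * d"
      using C Suc.prems(3) by (intro mult_right_mono power_increasing) auto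
    with * show ?thesis by linarith
  qed
qed simp

text \<open>By Bernoulli \<open>(1 + 1/m)^m >= 2\<close>, so the durations at least double every
  \<open>m\<close> classes.\<close>

lemma log_count_bound:
  assumes "(1 + 1 / real m) ^ (C - 1) \<le> \<mu>" "1 \<le> m" "0 < C"
  shows "real C \<le> 1 + real m * log 2 \<mu>"
proof -
  have "1 + real m * (1 / real m) \<le> (1 + 1 / real m) ^ m"
    by (rule Bernoulli_inequality) (simp add: order_trans[of "-1" 0])
  then have "2 \<le> (1 + 1 / real m) ^ m" using assms(2) by simp
  then have "2 ^ (C - 1) \<le> ((1 + 1 / real m) ^ m) ^ (C - 1)" by (intro power_mono) auto
  also have "\<dots> = ((1 + 1 / real m) ^ (C - 1)) ^ m" by (simp add: mult.commute flip: power_mult)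
  also have "\<dots> \<le> \<mu> ^ m" using assms(1) by (intro power_mono) auto
  finally have le: "2 ^ (C - 1) \<le> \<mu> ^ m" .
  have "1 \<le> (1 + 1 / real m) ^ (C - 1)" by (rule one_le_power) simp
  then have \<mu>: "0 < \<mu>" using assms(1) by linarith
  have "log 2 (2 ^ (C - 1)) \<le> log 2 (\<mu> ^ m)" using le \<mu> by (subst log_le_cancel_iff) auto
  then have "real (C - 1) \<le> real m * log 2 \<mu>" using \<mu> by (simp add: log_nat_power)
  then show ?thesis using assms(3) by (simp add: of_nat_diff)
qed

section \<open>Cost of the harmonic machines\<close>

lemma num_machines_ge:
  assumes "valid_instance T I" "feasible I \<sigma>" "distinct Y" "set Y \<subseteq> set (items I)"
    "\<And>x. x \<in> set Y \<Longrightarrow> item_active x t"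
  shows "packs_into (map item_weight Y) (num_machines I \<sigma> t)"
  using assms by (intro packs_into_num_machines) (auto simp: valid_instance_def less_imp_le)

lemma sum_list_concat: "sum_list (concat xss) = sum_list (map sum_list xss)"
  by (induction xss) auto

lemma real_sum_list: "real (\<Sum>x\<leftarrow>xs. f x) = (\<Sum>x\<leftarrow>xs. real (f x))"
  by (induction xs) auto

lemma distinct_mset_mono: "mset ys \<subseteq># mset xs \<Longrightarrow> distinct xs \<Longrightarrow> distinct ys"
proof -
  assume sub: "mset ys \<subseteq># mset xs" and dist: "distinct xs"
  then obtain M where "mset xs = mset ys + M" by (auto simp: mset_subset_eq_exists_conv)
  then obtain zs where "mset xs = mset (ys @ zs)" by (metis ex_mset mset_append)
  with dist have "distinct (ys @ zs)" by (metis mset_eq_imp_distinct_iff)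
  then show ?thesis by simp
qed

lemma load_le_num_machines:
  assumes "valid_instance T I" "feasible I \<sigma>" "mset L = mset (items I)"
  shows "load item_weight L t \<le> real (num_machines I \<sigma> t)"
proof -
  have "distinct L" using assms(3) distinct_items[of I]
    by (metis distinct_map mset_eq_imp_distinct_iff)
  moreover have "set L = set (items I)" using assms(3) by (rule mset_eq_setD)
  ultimately show ?thesis
    by (intro load_weight_le_packs num_machines_ge[OF assms(1,2)]) auto
qed

text \<open>Some machine is in use at every time of the horizon. With the average optimum at least
  1, additive constants can be absorbed into multiples of it.\<close>

lemma horizon_le_opt:
  assumes "valid_instance T I" "feasible I \<sigma>0"
  shows "T \<le> opt I"
proof -
  have "(\<Sum>A\<leftarrow>[{0..<T}]. measure lborel A) \<le> 1 * opt I + 0 * T"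
  proof (rule sum_measure_le_opt[OF assms(2)])
    fix \<sigma> t assume \<sigma>: "feasible I \<sigma>"
    show "(\<Sum>A\<leftarrow>[{0..<T}]. indicat_real A t) \<le> 1 * real (num_machines I \<sigma> t) + 0 * indicat_real {0..<T} t"
    proof (cases "t \<in> {0..<T}")
      case True
      then have "\<exists>r\<in>set I. active r t" using assms(1) by (simp add: valid_instance_def)
      then obtain r where "r \<in> set I" "active r t" by blast
      then obtain i where i: "i < length I" "active (I ! i) t" by (metis in_set_conv_nth)
      have "length \<sigma> = length I" using \<sigma> by (simp add: feasible_def)
      with i have "\<sigma> ! i \<in> {m\<in>set \<sigma>. \<exists>i<length I. \<sigma> ! i = m \<and> active (I ! i) t}" by auto
      then have "0 < num_machines I \<sigma> t"
        unfolding num_machines_def by (subst card_gt_0_iff) auto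
      with True show ?thesis by simp
    qed simp
  qed (use assms(1) in \<open>auto simp: valid_instance_def fmeasurable_def\<close>)
  then show ?thesis using assms(1) by (simp add: valid_instance_def)
qed

text \<open>This is the reason why candidates \<open>m <= n\<close> suffice: the ideal
  \<open>m\<close> is at most the average optimum.\<close>

lemma opt_le_length:
  assumes "valid_instance T I" "feasible I \<sigma>"
  shows "opt I \<le> real (length I) * T"
proof -
  have "active_time I \<sigma> m \<le> T" for m
  proof -
    let ?A = "active_set (filter (\<lambda>x. \<sigma> ! fst x = m) (items I))"
    have A: "{t. \<exists>i<length I. \<sigma> ! i = m \<and> active (I ! i) t} = ?A"
      by (auto simp: active_set_def set_items)
    have "?A \<subseteq> {0..<T}"
    proof
      fix t assume "t \<in> ?A"
      then obtain x where "x \<in> set (items I)" "item_active x t" by (auto simp: active_set_def)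
      moreover from this have "snd x \<in> set I" by (simp add: set_items)
      ultimately show "t \<in> {0..<T}" using assms(1) by (force simp: valid_instance_def active_def)
    qed
    then have "measure lborel ?A \<le> measure lborel {0..<T}"
      using fmeasurable_active_set[of "filter (\<lambda>x. \<sigma> ! fst x = m) (items I)"] assms(1)
      by (intro measure_mono_fmeasurable) (auto simp: fmeasurable_def valid_instance_def)
    then show ?thesis unfolding active_time_def A using assms(1) by (simp add: valid_instance_def)
  qed
  then have "cost I \<sigma> \<le> (\<Sum>m\<in>set \<sigma>. T)" unfolding cost_def by (intro sum_mono)
  also have "\<dots> \<le> real (length I) * T"
    using assms card_length[of \<sigma>] by (auto simp: valid_instance_def feasible_def intro!: mult_right_mono)
  finally show ?thesis using opt_le[OF assms(2)] by linarith
qed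

text \<open>Excluding empty groups bounds the number of machines by the number of items, which the
  running times need.\<close>

definition valid_machines :: "item list \<Rightarrow> item list list \<Rightarrow> bool" where
  "valid_machines L gs \<longleftrightarrow> mset (concat gs) = mset L \<and> (\<forall>g\<in>set gs. machine_ok g \<and> g \<noteq> [])"

abbreviation sorted_items :: "request list \<Rightarrow> item list" where
  "sorted_items I \<equiv> sort_items (items I)"

lemma valid_machinesD:
  assumes "valid_machines (sorted_items I) gs"
  shows "partition_of I gs" "\<And>g. g \<in> set gs \<Longrightarrow> machine_ok g"
  using assms by (auto simp: valid_machines_def partition_of_def mset_sort_items)

lemma peel_ex: "Q \<in> set (peel sel n R) \<Longrightarrow> \<exists>R'. Q = sel R'"
  by (induction n arbitrary: R) auto

lemma nf_Nil [simp]: "nf_groups [] = []" "nf_forward [] = []"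
  by (simp_all add: nf_groups_def nf_forward_def)

lemma harmonic_pack_Nil: "harmonic_pack k j [] = []"
  by (induction j) auto

text \<open>The core items are listed block by block and class by class. Next-Fit depends on the
  order, so selecting one class must return precisely the sublists of that class in their original
  order.\<close>

lemma filter_concat_classes:
  assumes "distinct Js" "\<And>i x. i \<in> set Js \<Longrightarrow> x \<in> set (f i) \<Longrightarrow> P i x"
    and "\<And>i x. i \<in> set Js \<Longrightarrow> x \<in> set (f i) \<Longrightarrow> P j x \<Longrightarrow> i = j"
  shows "filter (P j) (concat (map f Js)) = (if j \<in> set Js then f j else [])"
  using assms
proof (induction Js)
  case (Cons i Js)
  then have IH: "filter (P j) (concat (map f Js)) = (if j \<in> set Js then f j else [])" by auto
  show ?case
  proof (cases "i = j")
    case True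
    then have "filter (P j) (f i) = f j" using Cons.prems(2)[of i] by (auto intro: filter_True)
    with IH True Cons.prems(1) show ?thesis by simp
  next
    case False
    then have "filter (P j) (f i) = []" using Cons.prems(3)[of i] by (auto simp: filter_empty_conv)
    with IH False show ?thesis by simp
  qed
qed simp

text \<open>For equal sizes a singleton \<open>Js\<close> avoids the factor \<open>k\<close> in the error term.\<close>

locale harmonic_analysis =
  fixes T :: real and I :: "request list" and k m :: nat and Js :: "nat list"
  assumes valid: "valid_instance T I" and m: "1 \<le> m" and k: "1 \<le> k"
    and Js: "distinct Js" "set Js \<subseteq> {1..k}"
    and occurs: "\<And>x j. x \<in> set (items I) \<Longrightarrow> j \<in> {1..k} \<Longrightarrow> in_harmonic_class k j (item_weight x) \<Longrightarrow> j \<in> set Js"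
begin

definition "L = sorted_items I"
definition "blocks = peel (similar m) (length L) L"
definition "Bs = filter (\<lambda>Q. Q \<noteq> []) blocks"
definition "cell B j = filter (\<lambda>x. in_harmonic_class k j (item_weight x)) B"
definition "d B = Min (item_dur ` set B)"
definition "cores = concat (map (\<lambda>B. concat (map (\<lambda>j. map (core (d B)) (nf_forward (cell B j))) Js)) Bs)"

lemma ok_L: "ok_items L"
  unfolding L_def by (rule ok_items_sort_items[OF valid])

lemma set_L: "set L = set (items I)"
  unfolding L_def by (rule mset_eq_setD[OF mset_sort_items])

lemma similar_filter: "\<exists>P. similar m R = filter P R" for R
  by (auto simp: similar_def)

lemma mset_blocks: "mset (concat Bs) = mset L"
proof -
  have "mset (concat blocks) = mset L"
    unfolding blocks_def
  proof (rule mset_peel[where U = "set L", OF similar_filter])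
    show "similar m R \<noteq> []" if "R \<noteq> []" "set R \<subseteq> set L" for R
      using similar_ne[OF that(1), of m] item_dur_pos[OF ok_L] that(2) by fastforce
  qed (use ok_L in \<open>auto simp: ok_items_def\<close>)
  moreover have "concat (filter (\<lambda>Q. Q \<noteq> []) Qs) = concat Qs" for Qs :: "item list list"
    by (induction Qs) auto
  ultimately show ?thesis by (simp add: Bs_def)
qed

lemma block:
  assumes "B \<in> set Bs"
  shows "ok_items B" "set B \<subseteq> set L" "0 < d B"
    "\<And>x. x \<in> set B \<Longrightarrow> d B \<le> item_dur x \<and> item_dur x \<le> (1 + 1 / real m) * d B"
proof -
  have B: "B \<in> set blocks" "B \<noteq> []" using assms by (auto simp: Bs_def)
  obtain P where P: "B = filter P L"
    using peel_block_filter[OF similar_filter] B(1) unfolding blocks_def by blast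
  show "ok_items B" unfolding P by (rule ok_items_filter[OF ok_L])
  show sub: "set B \<subseteq> set L" unfolding P by auto
  have "d B \<in> item_dur ` set B" unfolding d_def using B(2) by (intro Min_in) auto
  then obtain z where z: "z \<in> set B" "d B = item_dur z" by auto
  with sub show "0 < d B" using item_dur_pos[OF ok_L, of z] by auto
  show "d B \<le> item_dur x \<and> item_dur x \<le> (1 + 1 / real m) * d B" if "x \<in> set B" for x
  proof -
    obtain R where "B = similar m R" using peel_ex B(1) unfolding blocks_def by blast
    then have "real m * item_dur x \<le> real m * item_dur z + item_dur z"
      using that z(1) by (auto simp: similar_def)
    then have "item_dur x \<le> (1 + 1 / real m) * d B" unfolding z(2) using m by (simp add: field_simps)
    moreover have "d B \<le> item_dur x" unfolding d_def using that by simp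
    ultimately show ?thesis by simp
  qed
qed

lemma cell_Nil: "B \<in> set Bs \<Longrightarrow> j \<in> {1..k} - set Js \<Longrightarrow> cell B j = []"
  unfolding cell_def filter_empty_conv using block(2) set_L occurs by blast

lemma cell: "B \<in> set Bs \<Longrightarrow> ok_items (cell B j)" "set (cell B j) \<subseteq> set B"
  unfolding cell_def by (auto intro: ok_items_filter block(1))

lemma starts: "x \<in> set L \<Longrightarrow> 0 \<le> item_start x \<and> item_start x \<le> T"
  using valid unfolding set_L set_items valid_instance_def by (metis less_imp_le nth_mem order_trans)

lemma Bs_sum_list_Js: "(\<Sum>j=1..k. f j) = (\<Sum>j\<leftarrow>Js. f j)" if "\<And>j. j \<in> {1..k} - set Js \<Longrightarrow> f j = (0 :: 'b :: comm_monoid_add)"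
  using that Js by (subst sum_list_distinct_conv_sum_set) (auto intro!: sum.mono_neutral_right)

text \<open>A cell loses at most \<open>3 * T\<close> outside the cores, apart from the fraction
  \<open>1/m\<close>; there are at most \<open>length Bs * length Js\<close> nonempty cells.\<close>

lemma sum_span_le:
  "(\<Sum>g\<leftarrow>harmonic_machines k m L. busy_time g) \<le>
     (1 + 1 / real m) * (\<Sum>A\<leftarrow>cores. measure lborel A) + 3 * real (length Bs) * real (length Js) * T"
proof -
  have "(\<Sum>g\<leftarrow>harmonic_machines k m L. busy_time g) = (\<Sum>g\<leftarrow>concat (map (harmonic_pack k k) blocks). busy_time g)"
    unfolding harmonic_machines_def blocks_def
    by (metis mset_map mset_peel_groups sum_mset_sum_list)
  also have "\<dots> = (\<Sum>B\<leftarrow>Bs. \<Sum>g\<leftarrow>harmonic_pack k k B. busy_time g)"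
  proof -
    have "(\<Sum>g\<leftarrow>concat (map (harmonic_pack k k) Qs). busy_time g)
        = (\<Sum>B\<leftarrow>filter (\<lambda>Q. Q \<noteq> []) Qs. \<Sum>g\<leftarrow>harmonic_pack k k B. busy_time g)" for Qs
      by (induction Qs) (auto simp: harmonic_pack_Nil)
    then show ?thesis unfolding Bs_def by blast
  qed
  also have "\<dots> \<le> (\<Sum>B\<leftarrow>Bs. \<Sum>j\<leftarrow>Js. (1 + 1 / real m) * (\<Sum>g\<leftarrow>nf_forward (cell B j). measure lborel (core (d B) g)) + 3 * T)"
  proof (rule sum_list_mono)
    fix B assume B: "B \<in> set Bs"
    have "(\<Sum>g\<leftarrow>harmonic_pack k k B. busy_time g) = (\<Sum>j=1..k. \<Sum>g\<leftarrow>nf_groups (cell B j). busy_time g)"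
      unfolding sum_list_harmonic_pack cell_def ..
    also have "\<dots> = (\<Sum>j\<leftarrow>Js. \<Sum>g\<leftarrow>nf_groups (cell B j). busy_time g)"
      by (rule Bs_sum_list_Js) (simp add: cell_Nil[OF B])
    also have "\<dots> \<le> (\<Sum>j\<leftarrow>Js. (1 + 1 / real m) * (\<Sum>g\<leftarrow>nf_forward (cell B j). measure lborel (core (d B) g)) + 3 * T)"
    proof (rule sum_list_mono, rule sum_span_nf)
      fix j x assume "x \<in> set (cell B j)"
      then have "x \<in> set B" using cell(2) by blast
      then show "d B \<le> item_dur x \<and> item_dur x \<le> (1 + 1 / real m) * d B" "0 \<le> item_start x \<and> item_start x \<le> T"
        using block[OF B] starts by blast+
    qed (use valid cell(1)[OF B] block(3)[OF B] m in \<open>auto simp: valid_instance_def\<close>)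
    finally show "(\<Sum>g\<leftarrow>harmonic_pack k k B. busy_time g) \<le> (\<Sum>j\<leftarrow>Js. (1 + 1 / real m) * (\<Sum>g\<leftarrow>nf_forward (cell B j). measure lborel (core (d B) g)) + 3 * T)" .
  qed
  also have "\<dots> = (1 + 1 / real m) * (\<Sum>A\<leftarrow>cores. measure lborel A) + 3 * real (length Bs) * real (length Js) * T"
  proof -
    have "(\<Sum>j\<leftarrow>Js. (1 + 1 / real m) * f j + 3 * T) = (1 + 1 / real m) * (\<Sum>j\<leftarrow>Js. f j) + 3 * real (length Js) * T" for f :: "nat \<Rightarrow> real"
      unfolding sum_list_addf sum_list_const_mult sum_list_triv by simp
    then show ?thesis unfolding cores_def
      by (simp only: sum_list_addf sum_list_const_mult sum_list_triv)
        (simp add: map_concat sum_list_concat comp_def)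
  qed
  finally show ?thesis .
qed

definition "at_core t B j = concat (filter (\<lambda>g. t \<in> core (d B) g) (nf_forward (cell B j)))"
definition "core_items t = concat (map (\<lambda>B. concat (map (at_core t B) Js)) Bs)"

lemma count_cores:
  "(\<Sum>A\<leftarrow>cores. indicat_real A t) = (\<Sum>B\<leftarrow>Bs. \<Sum>j\<leftarrow>Js. real (next_fit (map item_weight (at_core t B j))))"
proof -
  have "(\<Sum>A\<leftarrow>map (core (d B)) (nf_forward (cell B j)). indicat_real A t) = real (next_fit (map item_weight (at_core t B j)))"
    if B: "B \<in> set Bs" for B j
  proof -
    have "(\<Sum>A\<leftarrow>map (core e) gs. indicat_real A t) = real (length (filter (\<lambda>g. t \<in> core e g) gs))" for e gs
      by (induction gs) (auto simp: indicator_def)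
    moreover have "length (filter (\<lambda>g. t \<in> core (d B) g) (nf_forward (cell B j))) = next_fit (map item_weight (at_core t B j))"
      unfolding at_core_def using cell(1)[OF B] cell(2) block(4)[OF B] by (intro length_filter_core(1)) blast+
    ultimately show ?thesis by simp
  qed
  then have "(\<Sum>B\<leftarrow>Bs. \<Sum>j\<leftarrow>Js. \<Sum>A\<leftarrow>map (core (d B)) (nf_forward (cell B j)). indicat_real A t)
     = (\<Sum>B\<leftarrow>Bs. \<Sum>j\<leftarrow>Js. real (next_fit (map item_weight (at_core t B j))))"
    by (intro arg_cong[of _ _ sum_list] map_cong) auto
  then show ?thesis unfolding cores_def by (simp add: map_concat sum_list_concat comp_def)
qed

lemma at_core:
  assumes "B \<in> set Bs"
  shows "mset (at_core t B j) \<subseteq># mset (cell B j)" "\<And>x. x \<in> set (at_core t B j) \<Longrightarrow> item_active x t"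
proof -
  have dur: "d B \<le> item_dur x" if "x \<in> set (cell B j)" for x
    using cell(2) block(4)[OF assms] that by blast
  show "mset (at_core t B j) \<subseteq># mset (cell B j)"
    unfolding at_core_def by (rule length_filter_core(2)[OF cell(1)[OF assms] dur])
  show "item_active x t" if "x \<in> set (at_core t B j)" for x
    using length_filter_core(3)[OF cell(1)[OF assms] dur] that unfolding at_core_def by blast
qed

text \<open>Blocks partition \<open>L\<close> and classes partition a block, so no item is listed
  twice.\<close>

lemma mset_core_items: "mset (core_items t) \<subseteq># mset L"
proof -
  have "(\<Sum>j\<leftarrow>Js. mset (cell B j)) = mset B" if B: "B \<in> set Bs" for B
  proof -
    have "(\<Sum>j\<leftarrow>Js. mset (cell B j)) = (\<Sum>j=1..k. mset (cell B j))"
      by (rule Bs_sum_list_Js[symmetric]) (simp add: cell_Nil[OF B])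
    also have "\<dots> = mset B"
      unfolding cell_def mset_as_sum using ok_itemsD[OF block(1)[OF B]] k by (intro sum_harmonic_filter) auto
    finally show ?thesis .
  qed
  moreover have "mset (concat (map (at_core t B) js)) \<subseteq># (\<Sum>j\<leftarrow>js. mset (cell B j))" if "B \<in> set Bs" for B js
    using at_core(1)[OF that] by (induction js) (auto intro: subset_mset.add_mono)
  ultimately have "mset (concat (map (at_core t B) Js)) \<subseteq># mset B" if "B \<in> set Bs" for B
    using that by metis
  then have "mset (concat (map (\<lambda>B. concat (map (at_core t B) Js)) bs)) \<subseteq># mset (concat bs)" if "set bs \<subseteq> set Bs" for bs
    using that by (induction bs) (auto intro: subset_mset.add_mono simp del: mset_concat)
  from this[of Bs] mset_blocks show ?thesis unfolding core_items_def by simp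
qed

text \<open>The core items of all cells are active at the same time, so together they form one
  static input that the machines of any feasible schedule pack.\<close>

lemma core_items_packing:
  assumes "feasible I \<sigma>"
  shows "packs_into (map item_weight (core_items t)) (num_machines I \<sigma> t)"
proof (rule num_machines_ge[OF valid assms])
  have "distinct L" using ok_L by (simp add: ok_items_def distinct_map)
  with mset_core_items show "distinct (core_items t)" by (rule distinct_mset_mono)
  show "set (core_items t) \<subseteq> set (items I)"
    using set_mset_mono[OF mset_core_items[of t]] set_L by simp
  show "item_active x t" if "x \<in> set (core_items t)" for x
  proof -
    from that obtain B j where "B \<in> set Bs" "x \<in> set (at_core t B j)" unfolding core_items_def by auto
    then show ?thesis by (rule at_core(2))
  qed
qed

lemma core_items_weights: "set (map item_weight (core_items t)) \<subseteq> {0<..1}"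
  using set_mset_mono[OF mset_core_items[of t]] ok_itemsD[OF ok_L] by auto

text \<open>What remains is a pointwise comparison of Next-Fit bins of core items with the machines
  of a feasible schedule; general and equal sizes differ in \<open>\<alpha>\<close> and
  \<open>\<beta>\<close> only.\<close>

lemma cost_le:
  assumes "0 < \<alpha>"
    and le: "\<And>\<sigma> t. feasible I \<sigma> \<Longrightarrow>
      (\<Sum>B\<leftarrow>Bs. \<Sum>j\<leftarrow>Js. real (next_fit (map item_weight (at_core t B j)))) \<le> \<alpha> * real (num_machines I \<sigma> t) + \<beta>"
  shows "cost I (schedule_of I (harmonic_machines k m L)) \<le>
     (1 + 1 / real m) * (\<alpha> * opt I + \<beta> * T) + 3 * real (length Bs) * real (length Js) * T"
proof -
  have vm: "valid_machines (sorted_items I) (harmonic_machines k m L)"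
    using harmonic_machines[OF ok_L k] unfolding valid_machines_def L_def by blast
  have "(\<Sum>A\<leftarrow>cores. measure lborel A) \<le> \<alpha> * opt I + \<beta> * T"
  proof (rule sum_measure_le_opt[OF feasible_schedule_of[OF valid_machinesD[OF vm]] _ assms(1)])
    fix \<sigma> t assume \<sigma>: "feasible I \<sigma>"
    show "(\<Sum>A\<leftarrow>cores. indicat_real A t) \<le> \<alpha> * real (num_machines I \<sigma> t) + \<beta> * indicat_real {0..<T} t"
    proof (cases "0 \<le> t \<and> t < T")
      case True
      with le[OF \<sigma>, of t] show ?thesis by (simp add: count_cores)
    next
      case False
      \<comment> \<open>Core items at \<open>t\<close> are active at \<open>t\<close>, which is
        impossible outside the horizon.\<close>
      have "at_core t B j = []" if "B \<in> set Bs" for B j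
      proof (rule ccontr)
        assume "at_core t B j \<noteq> []"
        then obtain x where x: "x \<in> set (at_core t B j)" by (cases "at_core t B j") auto
        then have "x \<in> set L"
          using set_mset_mono[OF at_core(1)[OF that]] cell(2)[of B j] block(2)[OF that] by (metis set_mset_mset subsetD)
        then have "snd x \<in> set I" unfolding set_L by (simp add: set_items)
        with valid have "0 \<le> item_start x" "item_finish x \<le> T" by (auto simp: valid_instance_def)
        with False at_core(2)[OF that x] show False by (auto simp: active_def)
      qed
      then have "(\<Sum>B\<leftarrow>bs. \<Sum>j\<leftarrow>Js. real (next_fit (map item_weight (at_core t B j)))) = 0" if "set bs \<subseteq> set Bs" for bs
        using that by (induction bs) (auto simp: comp_def)
      then show ?thesis using False assms(1) by (simp add: count_cores)
    qed
  next
    fix A assume "A \<in> set cores"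
    then obtain e g where "A = core e g" unfolding cores_def by auto
    then show "A \<in> fmeasurable lborel" unfolding core_def by (cases "item_start (last g) \<le> item_start (hd g) + e") (auto simp: fmeasurable_def)
  qed (use valid in \<open>auto simp: valid_instance_def\<close>)
  then have "(1 + 1 / real m) * (\<Sum>A\<leftarrow>cores. measure lborel A) \<le> (1 + 1 / real m) * (\<alpha> * opt I + \<beta> * T)"
    by (rule mult_left_mono) simp
  with sum_span_le show ?thesis unfolding cost_schedule_of[OF valid_machinesD(1)[OF vm]] by linarith
qed

lemma length_Bs: "real (length Bs) \<le> 1 + real m * log 2 (max_duration I)"
proof -
  have I: "I \<noteq> []" using valid by (force simp: valid_instance_def)
  have min: "Min (duration ` set I) = 1" using valid by (simp add: valid_instance_def)
  have dur: "1 \<le> item_dur x \<and> item_dur x \<le> max_duration I" if "x \<in> set L" for x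
  proof -
    have "snd x \<in> set I" using that unfolding set_L by (simp add: set_items)
    then show ?thesis using min Min_le[of "duration ` set I" "item_dur x"] unfolding max_duration_def by simp
  qed
  have "items I \<noteq> []" using I by (simp add: items_def List.enumerate_eq_zip) 
  then have "L \<noteq> []" using set_L by (metis set_empty)
  then have "Bs \<noteq> []" using mset_blocks by (metis concat.simps(1) mset_zero_iff mset.simps(1))
  then have pos: "0 < length Bs" by simp
  have "(1 + 1 / real m) ^ (length Bs - 1) * 1 \<le> max_duration I"
    using dur m pos ok_L by (intro count_peel_similar[of L]) (auto simp: Bs_def blocks_def ok_items_def)
  then show ?thesis using m pos by (intro log_count_bound) auto
qed

end

lemma sum_list_swap: "(\<Sum>x\<leftarrow>xs. \<Sum>y\<leftarrow>ys. f x y) = (\<Sum>y\<leftarrow>ys. \<Sum>x\<leftarrow>xs. (f x y :: 'b :: comm_monoid_add))"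
  by (induction xs) (auto simp: sum_list_addf)

text \<open>The core items of one size class are packed separately in each of the \<open>C\<close>
  blocks. Joining the blocks saves at most one bin per block and class, \<open>k * C\<close> in
  total, and the joined classes are what Harmonic packs for the static input \<open>?Y\<close>;
  passing to its optimum costs another \<open>k\<close>. The term with \<open>3 * C\<close> is time
  outside the cores.\<close>

theorem harmonic_cost:
  assumes valid: "valid_instance T I" and "3 \<le> k" "1 \<le> m"
  obtains C :: nat where "real C \<le> 1 + real m * log 2 (max_duration I)"
    "cost I (schedule_of I (harmonic_machines k m (sorted_items I))) \<le>
      (1 + 1 / real m) * (harmonic_ratio k * opt I + (real k + real k * real C) * T) + 3 * real C * real k * T"
proof -
  let ?Js = "[1..<Suc k]"
  interpret harmonic_analysis T I k m ?Js
    by standard (use assms in auto)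
  have "(\<Sum>B\<leftarrow>Bs. \<Sum>j\<leftarrow>?Js. real (next_fit (map item_weight (at_core t B j))))
      \<le> harmonic_ratio k * real (num_machines I \<sigma> t) + (real k + real k * real (length Bs))"
    if \<sigma>: "feasible I \<sigma>" for \<sigma> t
  proof -
    let ?Y = "map item_weight (core_items t)"
    let ?ys = "\<lambda>B j. map item_weight (at_core t B j)"
    have cls: "in_harmonic_class k j w \<and> 0 < w \<and> w \<le> 1" if "B \<in> set Bs" "w \<in> set (?ys B j)" for B j w
    proof -
      from that(2) obtain x where x: "w = item_weight x" "x \<in> set (at_core t B j)" by auto
      then have "x \<in> set (cell B j)" using set_mset_mono[OF at_core(1)[OF that(1)]] by auto
      then show ?thesis using x(1) ok_itemsD[OF block(1)[OF that(1)]] by (auto simp: cell_def)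
    qed
    have Y: "filter (in_harmonic_class k j) ?Y = concat (map (\<lambda>B. ?ys B j) Bs)" if j: "j \<in> {1..k}" for j
    proof -
      have "filter (in_harmonic_class k j) (concat (map (?ys B) ?Js)) = ?ys B j" if B: "B \<in> set Bs" for B
      proof -
        have "filter (in_harmonic_class k j) (concat (map (?ys B) ?Js)) = (if j \<in> set ?Js then ?ys B j else [])"
        proof (rule filter_concat_classes)
          fix i w assume iw: "i \<in> set ?Js" "w \<in> set (?ys B i)"
          with cls[OF B] show "in_harmonic_class k i w" by blast
          with iw show "i = j" if "in_harmonic_class k j w"
            using in_harmonic_class_unique[of k i w j] that j by auto
        qed simp
        with j show ?thesis by auto
      qed
      then have "filter (in_harmonic_class k j) (concat (map (\<lambda>B. concat (map (?ys B) ?Js)) bs)) = concat (map (\<lambda>B. ?ys B j) bs)"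
        if "set bs \<subseteq> set Bs" for bs using that by (induction bs) auto
      from this[of Bs] show ?thesis unfolding core_items_def by (simp only: map_concat map_map comp_def)
    qed
    have "(\<Sum>B\<leftarrow>Bs. \<Sum>j\<leftarrow>?Js. next_fit (?ys B j)) = (\<Sum>j=1..k. \<Sum>B\<leftarrow>Bs. next_fit (?ys B j))"
      by (subst sum_list_swap, subst sum_list_distinct_conv_sum_set) (auto intro!: sum.cong)
    also have "\<dots> \<le> (\<Sum>j=1..k. next_fit (filter (in_harmonic_class k j) ?Y) + length Bs)"
    proof (rule sum_mono)
      fix j assume j: "j \<in> {1..k}"
      have "(\<Sum>ys\<leftarrow>map (\<lambda>B. ?ys B j) Bs. next_fit ys) \<le> next_fit (concat (map (\<lambda>B. ?ys B j) Bs)) + length (map (\<lambda>B. ?ys B j) Bs)"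
        by (rule next_fit_concat) (use cls in auto)
      then show "(\<Sum>B\<leftarrow>Bs. next_fit (?ys B j)) \<le> next_fit (filter (in_harmonic_class k j) ?Y) + length Bs"
        unfolding Y[OF j] by (simp add: comp_def)
    qed
    also have "\<dots> = harmonic_bins k ?Y + k * length Bs"
      by (simp add: harmonic_bins_def sum.distrib)
    finally have "real (\<Sum>B\<leftarrow>Bs. \<Sum>j\<leftarrow>?Js. next_fit (?ys B j)) \<le> real (harmonic_bins k ?Y + k * length Bs)"
      by (rule of_nat_mono)
    also have "\<dots> = real (harmonic_bins k ?Y) + real k * real (length Bs)" by simp
    also have "real (harmonic_bins k ?Y) \<le> harmonic_ratio k * real (opt_bins ?Y) + real k"
      by (rule harmonic_bins_le[OF assms(2) core_items_weights])
    also have "harmonic_ratio k * real (opt_bins ?Y) \<le> harmonic_ratio k * real (num_machines I \<sigma> t)"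
      using opt_bins_le[OF core_items_packing[OF \<sigma>]] harmonic_ratio_bounds(1)[OF assms(2)] by (intro mult_left_mono) auto
    finally show ?thesis unfolding real_sum_list by simp
  qed
  then have "cost I (schedule_of I (harmonic_machines k m L)) \<le>
      (1 + 1 / real m) * (harmonic_ratio k * opt I + (real k + real k * real (length Bs)) * T)
      + 3 * real (length Bs) * real (length ?Js) * T"
    using harmonic_ratio_bounds(1)[OF assms(2)] by (intro cost_le) auto
  moreover have "length ?Js = k" by simp
  ultimately show ?thesis by (intro that[OF length_Bs]) (simp only: L_def)
qed

text \<open>Only one class occurs, so there is one nonempty cell per block, and Next-Fit on it
  exceeds the load by at most one bin. The comparison goes through the load, hence with ratio
  1.\<close>

theorem harmonic_cost_uniform:
  assumes valid: "valid_instance T I" and "1 \<le> k" "1 \<le> m" "uniform_size I"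
  obtains C :: nat where "real C \<le> 1 + real m * log 2 (max_duration I)"
    "cost I (schedule_of I (harmonic_machines k m (sorted_items I))) \<le>
      (1 + 1 / real m) * (opt I + real C * T) + 3 * real C * T"
proof -
  obtain g :: nat where g: "g \<ge> 1" "\<And>r. r \<in> set I \<Longrightarrow> weight r = 1 / real g"
    using assms(4) by (auto simp: uniform_size_def)
  obtain j where j: "j \<in> {1..k}" "in_harmonic_class k j (1 / real g)"
    using in_harmonic_class_exists[of "1 / real g" k] g(1) assms(2) by auto
  have w: "item_weight x = 1 / real g" if "x \<in> set (items I)" for x
    using that g(2) by (simp add: set_items)
  interpret harmonic_analysis T I k m "[j]"
  proof
    fix x i assume "x \<in> set (items I)" "i \<in> {1..k}" "in_harmonic_class k i (item_weight x)"
    with w[of x] j in_harmonic_class_unique[of k i "1 / real g" j] show "i \<in> set [j]" by simp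
  qed (use assms j in simp_all)
  have "(\<Sum>B\<leftarrow>Bs. \<Sum>j\<leftarrow>[j]. real (next_fit (map item_weight (at_core t B j))))
      \<le> 1 * real (num_machines I \<sigma> t) + real (length Bs)" if \<sigma>: "feasible I \<sigma>" for \<sigma> t
  proof -
    have nf: "real (next_fit (map item_weight (at_core t B j))) \<le> sum_list (map item_weight (at_core t B j)) + 1"
      if B: "B \<in> set Bs" for B
    proof (rule next_fit_uniform[OF _ g(1)])
      fix y assume "y \<in> set (map item_weight (at_core t B j))"
      then obtain x where x: "x \<in> set (at_core t B j)" "y = item_weight x" by auto
      then have "x \<in> set L"
        using set_mset_mono[OF at_core(1)[OF B]] cell(2)[of B j] block(2)[OF B] by (metis set_mset_mset subsetD)
      then show "y = 1 / real g" using w x(2) unfolding set_L by blast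
    qed
    have "(\<Sum>B\<leftarrow>Bs. \<Sum>j\<leftarrow>[j]. real (next_fit (map item_weight (at_core t B j))))
        \<le> (\<Sum>B\<leftarrow>Bs. sum_list (map item_weight (at_core t B j)) + 1)"
      using nf by (intro sum_list_mono) simp
    also have "\<dots> = sum_list (map item_weight (core_items t)) + real (length Bs)"
      by (simp add: core_items_def sum_list_addf sum_list_triv map_concat sum_list_concat comp_def)
    also have "sum_list (map item_weight (core_items t)) \<le> real (num_machines I \<sigma> t)"
      by (rule sum_list_le_packs_into[OF core_items_packing[OF \<sigma>]])
    finally show ?thesis by simp
  qed
  then have "cost I (schedule_of I (harmonic_machines k m L)) \<le>
      (1 + 1 / real m) * (1 * opt I + real (length Bs) * T) + 3 * real (length Bs) * real (length [j]) * T"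
    by (intro cost_le) auto
  then show ?thesis using that[OF length_Bs] by (simp add: L_def)
qed

section \<open>The two algorithms\<close>

text \<open>Length of a union of intervals by scanning in the order of start times: the first
  component is the latest finish so far, the second the length covered.\<close>

definition sweep_step :: "item \<Rightarrow> real \<times> real \<Rightarrow> real \<times> real" where
  "sweep_step x s = (let e = (if fst s < item_start x then item_start x else fst s) in
     if e < item_finish x then (item_finish x, snd s + (item_finish x - e)) else s)"

definition sweep :: "item list \<Rightarrow> real" where
  "sweep g = snd (fold sweep_step (sort_items g) (0, 0))"

lemma active_set_snoc: "active_set (ys @ [x]) = active_set ys \<union> {item_start x..<item_finish x}"
  by (auto simp: active_set_def active_def)

lemma fold_sweep_step:
  assumes "sorted (map item_start xs)" "\<And>x. x \<in> set xs \<Longrightarrow> 0 \<le> item_start x \<and> item_start x < item_finish x"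
  defines "s \<equiv> fold sweep_step xs (0, 0)"
  shows "0 \<le> fst s \<and> (\<forall>x\<in>set xs. item_finish x \<le> fst s) \<and> (fst s = 0 \<or> (\<exists>x\<in>set xs. item_finish x = fst s))
    \<and> snd s = busy_time xs"
  unfolding s_def using assms(1,2)
proof (induction xs rule: rev_induct)
  case Nil
  then show ?case by (simp add: busy_time_def active_set_def)
next
  case (snoc x ys)
  define s where "s = fold sweep_step ys (0, 0)"
  have IH: "0 \<le> fst s" "\<And>y. y \<in> set ys \<Longrightarrow> item_finish y \<le> fst s"
    "fst s = 0 \<or> (\<exists>y\<in>set ys. item_finish y = fst s)" "snd s = busy_time ys"
  proof -
    have "0 \<le> fst s \<and> (\<forall>x\<in>set ys. item_finish x \<le> fst s) \<and> (fst s = 0 \<or> (\<exists>x\<in>set ys. item_finish x = fst s))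
      \<and> snd s = busy_time ys"
      unfolding s_def using snoc.prems by (intro snoc.IH) (simp_all add: sorted_append)
    then show "0 \<le> fst s" "\<And>y. y \<in> set ys \<Longrightarrow> item_finish y \<le> fst s"
      "fst s = 0 \<or> (\<exists>y\<in>set ys. item_finish y = fst s)" "snd s = busy_time ys" by simp_all
  qed
  have le: "item_start y \<le> item_start x" if "y \<in> set ys" for y
    using snoc.prems(1) that by (auto simp: sorted_append)
  have x: "0 \<le> item_start x" "item_start x < item_finish x" using snoc.prems(2) by auto
  define e where "e = max (fst s) (item_start x)"
  \<comment> \<open>The item that finishes last has started no later than \<open>x\<close>, so it
    covers everything from the start of \<open>x\<close> up to \<open>fst s\<close>. Only the part
    of \<open>x\<close> beyond \<open>e\<close> is new.\<close>
  have cov: "t \<in> active_set ys" if "item_start x \<le> t" "t < fst s" for t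
  proof -
    from that x IH(3) obtain y where "y \<in> set ys" "item_finish y = fst s" by auto
    with le[of y] that show ?thesis unfolding active_set_def active_def by (intro CollectI bexI[of _ y]) auto
  qed
  have before: "t < e" if "t \<in> active_set ys" for t
  proof -
    from that obtain y where "y \<in> set ys" "t < item_finish y" by (auto simp: active_set_def active_def)
    with IH(2)[of y] show ?thesis by (simp add: e_def less_max_iff_disj)
  qed
  have "active_set (ys @ [x]) = active_set ys \<union> {e..<item_finish x}"
    unfolding active_set_snoc using cov by (auto simp: e_def)
  moreover have "active_set ys \<inter> {e..<item_finish x} = {}" using before by force
  moreover have "{e..<item_finish x} \<in> fmeasurable lborel"
    by (cases "e \<le> item_finish x") (auto simp: fmeasurable_def)
  ultimately have "busy_time (ys @ [x]) = busy_time ys + measure lborel {e..<item_finish x}"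
    unfolding busy_time_def using fmeasurable_active_set[of ys] by (simp add: measure_Un3)
  then have bt: "busy_time (ys @ [x]) = busy_time ys + max 0 (item_finish x - e)"
    by (cases "e \<le> item_finish x") auto
  have step: "fold sweep_step (ys @ [x]) (0, 0) = (if e < item_finish x then (item_finish x, snd s + (item_finish x - e)) else s)"
    by (simp add: s_def[symmetric] sweep_step_def Let_def e_def max_def not_less)
  show ?case
  proof (cases "e < item_finish x")
    case True
    have "fst s \<le> e" by (simp add: e_def)
    with True have lt: "fst s < item_finish x" by linarith
    then have "item_finish y \<le> item_finish x" if "y \<in> set ys" for y
      using IH(2)[OF that] by linarith
    with True bt IH x show ?thesis unfolding step by auto
  next
    case False
    with x have "item_finish x \<le> fst s" by (auto simp: e_def max_def split: if_splits)
    with False bt IH show ?thesis unfolding step by (auto simp: max_def)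
  qed
qed

lemma busy_time_cong: "set g = set h \<Longrightarrow> busy_time g = busy_time h"
  by (simp add: busy_time_def active_set_def)

lemma sweep_eq:
  assumes "\<And>x. x \<in> set g \<Longrightarrow> 0 \<le> item_start x \<and> item_start x < item_finish x"
  shows "sweep g = busy_time g"
proof -
  have set: "set (sort_items g) = set g" by (rule mset_eq_setD[OF mset_sort_items])
  have "sweep g = busy_time (sort_items g)"
    unfolding sweep_def using fold_sweep_step[OF sorted_sort_items, of g] assms set by blast
  then show ?thesis using busy_time_cong[OF set] by simp
qed

definition total_sweep :: "item list list \<Rightarrow> real" where
  "total_sweep gs = (\<Sum>g\<leftarrow>gs. sweep g)"

definition better :: "item list list \<Rightarrow> item list list \<Rightarrow> item list list" where
  "better gs hs = (if total_sweep hs < total_sweep gs then hs else gs)"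

lemma total_sweep_better: "total_sweep (better gs hs) = min (total_sweep gs) (total_sweep hs)"
  by (simp add: better_def)

lemma total_sweep_eq:
  assumes "valid_instance T I" "valid_machines (sorted_items I) gs"
  shows "total_sweep gs = cost I (schedule_of I gs)"
proof -
  have "sweep g = busy_time g" if g: "g \<in> set gs" for g
  proof (rule sweep_eq)
    fix x assume "x \<in> set g"
    with g have "x \<in> set (concat gs)" by auto
    then have "x \<in> set (items I)"
      using valid_machinesD(1)[OF assms(2)] unfolding partition_of_def by (metis mset_eq_setD)
    then have "snd x \<in> set I" by (simp add: set_items)
    then show "0 \<le> item_start x \<and> item_start x < item_finish x" using assms(1) by (simp add: valid_instance_def)
  qed
  then have "total_sweep gs = (\<Sum>g\<leftarrow>gs. busy_time g)"
    unfolding total_sweep_def by (intro arg_cong[of _ _ sum_list] map_cong) auto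
  then show ?thesis using cost_schedule_of[OF valid_machinesD(1)[OF assms(2)]] by simp
qed

text \<open>The minimum inherits both guarantees: the mixed machines are good on all instances, the
  uniform ones on equal sizes.\<close>

definition two_approx_machines :: "item list \<Rightarrow> item list list" where
  "two_approx_machines L = better (mixed_machines L) (uniform_machines L)"

definition best_step :: "nat \<Rightarrow> item list \<Rightarrow> item \<Rightarrow> item list \<times> item list list \<Rightarrow> item list \<times> item list list" where
  "best_step k L x s = (x # fst s, better (snd s) (harmonic_machines k (length (x # fst s)) L))"

text \<open>The parameter of the next candidate is the length of the list of processed items.\<close>

definition best_machines :: "nat \<Rightarrow> item list \<Rightarrow> item list list" where
  "best_machines k L = snd (fold (best_step k L) L ([], mixed_machines L))"

text \<open>The last part records the origin of the current best, which gives its feasibility and,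
  during the loop, a bound on its size.\<close>

lemma fold_best_step:
  fixes k :: nat and L :: "item list"
  defines "s xs \<equiv> fold (best_step k L) xs ([], mixed_machines L)"
  shows "length (fst (s xs)) = length xs"
    "total_sweep (snd (s xs)) \<le> total_sweep (mixed_machines L)"
    "m \<in> {1..length xs} \<Longrightarrow> total_sweep (snd (s xs)) \<le> total_sweep (harmonic_machines k m L)"
    "snd (s xs) = mixed_machines L \<or> (\<exists>m. snd (s xs) = harmonic_machines k m L)"
proof -
  have "length (fst (s xs)) = length xs \<and> total_sweep (snd (s xs)) \<le> total_sweep (mixed_machines L) \<and>
    (\<forall>m\<in>{1..length xs}. total_sweep (snd (s xs)) \<le> total_sweep (harmonic_machines k m L)) \<and>
    (snd (s xs) = mixed_machines L \<or> (\<exists>m. snd (s xs) = harmonic_machines k m L))"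
  proof (induction xs rule: rev_induct)
    case (snoc x xs)
    have step: "s (xs @ [x]) = best_step k L x (s xs)" by (simp add: s_def)
    have len: "length (x # fst (s xs)) = Suc (length xs)" using snoc by simp
    show ?case
      unfolding step best_step_def fst_conv snd_conv total_sweep_better len
      using snoc by (auto simp: better_def le_Suc_eq min_le_iff_disj)
  qed (simp add: s_def)
  then show "length (fst (s xs)) = length xs"
    "total_sweep (snd (s xs)) \<le> total_sweep (mixed_machines L)"
    "m \<in> {1..length xs} \<Longrightarrow> total_sweep (snd (s xs)) \<le> total_sweep (harmonic_machines k m L)"
    "snd (s xs) = mixed_machines L \<or> (\<exists>m. snd (s xs) = harmonic_machines k m L)"
    by blast+
qed

definition two_approx :: "request list \<Rightarrow> nat list" where
  "two_approx I = schedule_of I (two_approx_machines (sorted_items I))"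

definition near_optimal :: "nat \<Rightarrow> request list \<Rightarrow> nat list" where
  "near_optimal k I = schedule_of I (best_machines k (sorted_items I))"

lemma items_ne: "valid_instance T I \<Longrightarrow> sorted_items I \<noteq> []"
proof -
  assume v: "valid_instance T I"
  then have "I \<noteq> []" by (force simp: valid_instance_def)
  then have "0 < length (items I)" by (simp add: items_def)
  moreover have "length (sorted_items I) = length (items I)"
    using mset_sort_items by (metis size_mset)
  ultimately show ?thesis by auto
qed

section \<open>Feasibility and cost guarantees of the two algorithms\<close>

lemma valid_machines_algorithms:
  assumes "valid_instance T I"
  shows "valid_machines (sorted_items I) (mixed_machines (sorted_items I))"
    "valid_machines (sorted_items I) (uniform_machines (sorted_items I))"
    "1 \<le> k \<Longrightarrow> valid_machines (sorted_items I) (harmonic_machines k m (sorted_items I))"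
    "valid_machines (sorted_items I) (two_approx_machines (sorted_items I))"
    "1 \<le> k \<Longrightarrow> valid_machines (sorted_items I) (best_machines k (sorted_items I))"
proof -
  note ok = ok_items_sort_items[OF assms]
  show 1: "valid_machines (sorted_items I) (mixed_machines (sorted_items I))"
    using mixed_machines[OF ok] by (simp add: valid_machines_def)
  show 2: "valid_machines (sorted_items I) (uniform_machines (sorted_items I))"
    using uniform_machines[OF ok items_ne[OF assms]] by (simp add: valid_machines_def)
  show 3: "valid_machines (sorted_items I) (harmonic_machines k m (sorted_items I))" if "1 \<le> k" for m
    using harmonic_machines[OF ok that] by (simp add: valid_machines_def)
  show "valid_machines (sorted_items I) (two_approx_machines (sorted_items I))"
    using 1 2 by (simp add: two_approx_machines_def better_def)
  show "valid_machines (sorted_items I) (best_machines k (sorted_items I))" if "1 \<le> k"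
    using 1 3[OF that] fold_best_step(4)[of k "sorted_items I" "sorted_items I"] unfolding best_machines_def by metis
qed

lemma feasible_algorithms:
  assumes "valid_instance T I"
  shows "feasible I (two_approx I)" "1 \<le> k \<Longrightarrow> feasible I (near_optimal k I)"
  unfolding two_approx_def near_optimal_def
  by (intro feasible_schedule_of valid_machinesD(1) valid_machines_algorithms[OF assms],
      erule valid_machinesD(2)[OF valid_machines_algorithms(4)[OF assms]])
    (intro feasible_schedule_of valid_machinesD(1) valid_machines_algorithms[OF assms], assumption,
      rule valid_machinesD(2)[OF valid_machines_algorithms(5)[OF assms]])

lemma mixed_cost:
  assumes "valid_instance T I"
  shows "total_sweep (mixed_machines (sorted_items I)) \<le> 16/5 * opt I + 4 * T"
    "total_sweep (mixed_machines (sorted_items I)) \<le> 4 * opt I + 2 * T"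
proof -
  let ?L = "sorted_items I"
  note ok = ok_items_sort_items[OF assms]
  note vm = valid_machines_algorithms(1)[OF assms]
  have load: "load item_weight ?L t \<le> real (num_machines I \<sigma> t)" if "feasible I \<sigma>" for \<sigma> t
    by (rule load_le_num_machines[OF assms that mset_sort_items])
  show "total_sweep (mixed_machines ?L) \<le> 16/5 * opt I + 4 * T"
    unfolding total_sweep_eq[OF assms vm]
    using load num_active_mixed(1)[OF ok]
    by (intro cost_schedule_of_le[OF assms valid_machinesD[OF vm]]) (simp_all, fastforce intro: order_trans)
  show "total_sweep (mixed_machines ?L) \<le> 4 * opt I + 2 * T"
    unfolding total_sweep_eq[OF assms vm]
    using load num_active_mixed(2)[OF ok]
    by (intro cost_schedule_of_le[OF assms valid_machinesD[OF vm]]) (simp_all, fastforce intro: order_trans)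
qed

text \<open>The number of machines in use is an integer and at least the load, hence at least its
  ceiling; this is why no additive term remains.\<close>

lemma uniform_cost:
  assumes "valid_instance T I" "uniform_size I"
  shows "total_sweep (uniform_machines (sorted_items I)) \<le> 2 * opt I"
proof -
  let ?L = "sorted_items I"
  note ok = ok_items_sort_items[OF assms(1)]
  note vm = valid_machines_algorithms(2)[OF assms(1)]
  obtain g :: nat where g: "g \<ge> 1" "\<And>r. r \<in> set I \<Longrightarrow> weight r = 1 / real g"
    using assms(2) by (auto simp: uniform_size_def)
  have w: "item_weight x = 1 / real g" if "x \<in> set ?L" for x
  proof -
    have "x \<in> set (items I)" using that mset_eq_setD[OF mset_sort_items] by blast
    then show ?thesis using g(2) by (simp add: set_items)
  qed
  have "cost I (schedule_of I (uniform_machines ?L)) \<le> 2 * opt I + 0 * T"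
  proof (rule cost_schedule_of_le[OF assms(1) valid_machinesD[OF vm]])
    fix \<sigma> t assume "feasible I \<sigma>"
    then have "load item_weight ?L t \<le> real (num_machines I \<sigma> t)"
      by (rule load_le_num_machines[OF assms(1) _ mset_sort_items])
    then have "\<lceil>load item_weight ?L t\<rceil> \<le> int (num_machines I \<sigma> t)" by (simp add: ceiling_le_iff)
    then have "real_of_int \<lceil>load item_weight ?L t\<rceil> \<le> real (num_machines I \<sigma> t)" by linarith
    with num_active_uniform[OF ok items_ne[OF assms(1)] g(1) w, of t]
    show "num_active (uniform_machines ?L) t \<le> 2 * real (num_machines I \<sigma> t) + 0" by linarith
  next
    show "(0 :: real) < 2" by simp
  qed
  then show ?thesis by (simp add: total_sweep_eq[OF assms(1) vm])
qed

lemma opt_avg_bounds: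
  assumes "valid_instance T I"
  shows "1 \<le> opt_avg T I" "opt_avg T I \<le> real (length I)" "0 < T"
proof -
  show T: "0 < T" using assms by (simp add: valid_instance_def)
  note f = feasible_algorithms(1)[OF assms]
  show "1 \<le> opt_avg T I" "opt_avg T I \<le> real (length I)"
    using horizon_le_opt[OF assms f] opt_le_length[OF assms f] T by (simp_all add: opt_avg_def field_simps)
qed

lemma cost_two_approx:
  assumes "valid_instance T I"
  shows "cost I (two_approx I) = min (total_sweep (mixed_machines (sorted_items I))) (total_sweep (uniform_machines (sorted_items I)))"
  unfolding two_approx_def
  by (metis assms total_sweep_better total_sweep_eq two_approx_machines_def valid_machines_algorithms(4))

theorem two_approx_bounds:
  assumes "valid_instance T I" "k \<ge> 3"
  shows "avg_cost T I (two_approx I) \<le> 2 * harmonic_ratio k * (1 + 1 / (real k - 2)) * opt_avg T I + real k"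
    "uniform_size I \<Longrightarrow> avg_cost T I (two_approx I) \<le> 2 * opt_avg T I"
proof -
  note o = opt_avg_bounds[OF assms(1)]
  have avg: "avg_cost T I (two_approx I) \<le> 16/5 * opt_avg T I + 4" "avg_cost T I (two_approx I) \<le> 4 * opt_avg T I + 2"
    using mixed_cost[OF assms(1)] cost_two_approx[OF assms(1)] o(3)
    by (simp_all add: avg_cost_def opt_avg_def field_simps)
  show "avg_cost T I (two_approx I) \<le> 2 * opt_avg T I" if "uniform_size I"
    using uniform_cost[OF assms(1) that] cost_two_approx[OF assms(1)] o(3)
    by (simp add: avg_cost_def opt_avg_def field_simps)
  define f where "f = 1 + 1 / (real k - 2)"
  note R = harmonic_ratio_bounds[OF assms(2)]
  show "avg_cost T I (two_approx I) \<le> 2 * harmonic_ratio k * (1 + 1 / (real k - 2)) * opt_avg T I + real k"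
  proof (cases "k = 3")
    case True
    \<comment> \<open>The factor is at least \<open>2 * (3/2) * 2 = 6\<close> here, so 4 is
      affordable, whereas the additive 4 of the other bound would exceed \<open>k\<close>.\<close>
    then have "4 * 1 \<le> 2 * harmonic_ratio k * (1 + 1 / (real k - 2))" using R(1) by simp
    then have "4 * opt_avg T I \<le> 2 * harmonic_ratio k * (1 + 1 / (real k - 2)) * opt_avg T I"
      using o(1) by (intro mult_right_mono) auto
    with avg(2) True show ?thesis by simp
  next
    case False
    with assms(2) have k: "4 \<le> k" by simp
    have "16/5 \<le> 2 * harmonic_ratio k * f"
    proof (cases "k \<ge> 7")
      case True
      have "16/5 \<le> 2 * harmonic_ratio k * 1" using R(2)[OF True] by simp
      also have "\<dots> \<le> 2 * harmonic_ratio k * f" using R(1) k by (intro mult_left_mono) (auto simp: f_def)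
      finally show ?thesis .
    next
      case False
      \<comment> \<open>Now \<open>4 <= k <= 6\<close>: the ratio is only known to be at least 3/2,
        but with \<open>1 / (k - 2) >= 1/4\<close> the product is at least 15/4.\<close>
      then have "5/4 \<le> f" using k by (simp add: f_def field_simps)
      then have "3 * (5/4) \<le> (2 * harmonic_ratio k) * f" using R(1) by (intro mult_mono) auto
      then show ?thesis by linarith
    qed
    then have "16/5 * opt_avg T I \<le> 2 * harmonic_ratio k * f * opt_avg T I"
      using o(1) by (intro mult_right_mono) auto
    with avg(1) k show ?thesis unfolding f_def by linarith
  qed
qed

text \<open>With \<open>q = \<kappa> * lam\<close> the errors are of order \<open>o' / m\<close> and
  \<open>m * q\<close>. They balance at \<open>m = sqrt (o' / q)\<close>, which is
  \<open>s = w / q\<close>, and both become \<open>w\<close>. If \<open>o' < q\<close> this value is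
  below 1, but then \<open>o' <= w\<close> and the fallback \<open>8 * o'\<close> is good enough.
  Equal sizes use the lemma with \<open>R\<close> and \<open>\<kappa>\<close> equal to 1.\<close>

lemma sqrt_tradeoff:
  fixes o' \<kappa> lam R X l :: real and n :: nat
  assumes o': "1 \<le> o'" "o' \<le> real n" and \<kappa>: "1 \<le> \<kappa>" and lam: "1 \<le> lam" "l \<le> lam" and R: "0 \<le> R" "R \<le> 2"
    and small: "X \<le> 8 * o'"
    and cand: "\<And>m. m \<in> {1..n} \<Longrightarrow> \<exists>C :: nat. real C \<le> 1 + real m * l \<and>
       X \<le> (1 + 1 / real m) * (R * o' + (\<kappa> + \<kappa> * real C)) + 3 * real C * \<kappa>"
  shows "X \<le> R * o' + 30 * sqrt (o' * \<kappa> * lam)"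
proof -
  define q where "q = \<kappa> * lam"
  define w where "w = sqrt (o' * \<kappa> * lam)"
  have "1 * 1 \<le> \<kappa> * lam" using \<kappa> lam(1) by (intro mult_mono) auto
  then have q: "1 \<le> q" by (simp add: q_def)
  have w2: "w * w = o' * q" unfolding w_def q_def using o' \<kappa> lam by (simp add: mult.assoc)
  have w0: "0 < w" unfolding w_def using o' \<kappa> lam by simp
  show ?thesis
  proof (cases "o' < q")
    case True
    have "o' * o' \<le> w * w" unfolding w2 using True o' by (intro mult_left_mono) auto
    then have "o' \<le> w" using w0 by (metis abs_le_square_iff abs_of_nonneg less_imp_le o'(1) order_trans power2_eq_square zero_le_one)
    moreover have "0 \<le> R * o'" using R o' by simp
    ultimately show ?thesis using small o'(1) unfolding w_def[symmetric] by linarith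
  next
    case False
    define s where "s = w / q"
    have sw: "s * q = w" using q by (simp add: s_def)
    have os: "o' = s * w"
    proof -
      have "s * w * q = w * (s * q)" by (simp add: ac_simps)
      then have "s * w * q = o' * q" by (simp add: sw w2)
      then show ?thesis using q by simp
    qed
    have "q * q \<le> w * w" unfolding w2 using False q by (intro mult_right_mono) auto
    then have "q \<le> w" using w0 q by (metis abs_le_square_iff abs_of_nonneg less_imp_le order_trans power2_eq_square zero_le_one)
    then have s1: "1 \<le> s" using q by (simp add: s_def)
    define m where "m = nat \<lceil>s\<rceil>"
    have m: "s \<le> real m" "real m < s + 1" unfolding m_def using s1 by linarith+
    \<comment> \<open>From \<open>s <= s * s <= s * s * q = o' <= n\<close> the rounded
      \<open>m\<close> is among the candidates.\<close>
    have "s * s \<le> real n"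
    proof -
      have "s * s * 1 \<le> s * s * q" using q s1 by (intro mult_left_mono) auto
      also have "\<dots> = o'" using os sw by (simp add: mult.assoc)
      finally show ?thesis using o' by simp
    qed
    moreover have "s * 1 \<le> s * s" using s1 by (intro mult_left_mono) auto
    ultimately have "s \<le> real n" by simp
    then have "\<lceil>s\<rceil> \<le> int n" by (simp add: ceiling_le_iff)
    then have mn: "m \<in> {1..n}" unfolding m_def using s1 by (auto simp: le_nat_iff) linarith
    obtain C :: nat where C: "real C \<le> 1 + real m * l"
      and X: "X \<le> (1 + 1 / real m) * (R * o' + (\<kappa> + \<kappa> * real C)) + 3 * real C * \<kappa>"
      using cand[OF mn] by blast
    have m1: "1 \<le> real m" using mn by simp
    have m2: "real m \<le> 2 * s" using m s1 by simp
    have "real m * l \<le> real m * lam" using lam m1 by (intro mult_left_mono) auto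
    moreover have ml: "1 * 1 \<le> real m * lam" using m1 lam by (intro mult_mono) auto
    ultimately have C2: "real C \<le> 2 * (real m * lam)" using C by linarith
    have A: "R * o' / real m \<le> 2 * w"
    proof -
      have "R * o' \<le> 2 * (real m * w)"
        unfolding os using R m(1) s1 w0 by (intro mult_mono) auto
      then show ?thesis using m1 by (simp add: field_simps)
    qed
    have B: "\<kappa> * (real m * lam) \<le> 2 * w"
    proof -
      have "\<kappa> * (real m * lam) = real m * q" by (simp add: q_def)
      also have "\<dots> \<le> 2 * s * q" using m2 q by (intro mult_right_mono) auto
      finally show ?thesis using sw by (simp add: mult.assoc)
    qed
    have kC: "\<kappa> * real C \<le> 2 * (\<kappa> * (real m * lam))" using mult_left_mono[OF C2, of \<kappa>] \<kappa> by simp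
    have k1: "\<kappa> \<le> \<kappa> * (real m * lam)" using mult_left_mono[OF ml, of \<kappa>] \<kappa> by simp
    have "(1 + 1 / real m) * (\<kappa> + \<kappa> * real C) \<le> 2 * (\<kappa> + \<kappa> * real C)"
      using m1 \<kappa> by (intro mult_right_mono) auto
    with X have "X \<le> R * o' + R * o' / real m + 2 * (\<kappa> + \<kappa> * real C) + 3 * (\<kappa> * real C)"
      by (simp add: distrib_left distrib_right algebra_simps)
    moreover have "\<kappa> \<le> 2 * w" using k1 B by (rule order_trans)
    moreover have "\<kappa> * real C \<le> 4 * w" using kC B by linarith
    \<comment> \<open>The errors add up to \<open>26 * w\<close>; 30 is a round number above
      this.\<close>
    ultimately have "X \<le> R * o' + 2 * w + 2 * (2 * w + 4 * w) + 3 * (4 * w)"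
      using A by (smt (verit))
    with w0 show ?thesis unfolding w_def[symmetric] by simp
  qed
qed

theorem near_optimal_bounds:
  assumes "valid_instance T I" "k \<ge> 3"
  shows "avg_cost T I (near_optimal k I) \<le> harmonic_ratio k * opt_avg T I
      + 30 * sqrt (opt_avg T I * real k * max 1 (log 2 (max_duration I)))"
    "uniform_size I \<Longrightarrow> avg_cost T I (near_optimal k I) \<le> opt_avg T I
      + 30 * sqrt (opt_avg T I * max 1 (log 2 (max_duration I)))"
proof -
  let ?L = "sorted_items I" and ?X = "avg_cost T I (near_optimal k I)" and ?l = "log 2 (max_duration I)"
  note o = opt_avg_bounds[OF assms(1)]
  note vm = valid_machines_algorithms[OF assms(1)]
  have cost: "cost I (near_optimal k I) = total_sweep (best_machines k ?L)"
    unfolding near_optimal_def using assms by (intro total_sweep_eq[symmetric] vm(5)) auto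
  have "total_sweep (best_machines k ?L) \<le> total_sweep (mixed_machines ?L)"
    unfolding best_machines_def by (rule fold_best_step(2))
  \<comment> \<open>\<open>16/5 * a + 4 <= 8 * a\<close> for an average optimum
    \<open>a >= 1\<close>.\<close>
  then have small: "?X \<le> 8 * opt_avg T I"
    using mixed_cost(1)[OF assms(1)] o cost by (simp add: avg_cost_def opt_avg_def field_simps)
  have "length ?L = length I" using mset_sort_items[of "items I"] by (metis length_enumerate items_def size_mset)
  then have harm: "cost I (near_optimal k I) \<le> cost I (schedule_of I (harmonic_machines k m ?L))" if "m \<in> {1..length I}" for m
    unfolding cost using that assms fold_best_step(3)[of m ?L k ?L] total_sweep_eq[OF assms(1) vm(3)[of k m]]
    by (simp add: best_machines_def)
  show "?X \<le> harmonic_ratio k * opt_avg T I + 30 * sqrt (opt_avg T I * real k * max 1 ?l)"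
  proof (rule sqrt_tradeoff[OF o(1,2) _ _ _ _ _ small, of _ _ ?l])
    fix m assume m: "m \<in> {1..length I}"
    obtain C :: nat where C: "real C \<le> 1 + real m * ?l"
      "cost I (schedule_of I (harmonic_machines k m ?L)) \<le>
      (1 + 1 / real m) * (harmonic_ratio k * opt I + (real k + real k * real C) * T) + 3 * real C * real k * T"
      using harmonic_cost[OF assms, of m] m by auto
    have "cost I (near_optimal k I) \<le>
      (1 + 1 / real m) * (harmonic_ratio k * opt I + (real k + real k * real C) * T) + 3 * real C * real k * T"
      using harm[OF m] C(2) by linarith
    then have "cost I (near_optimal k I) / T \<le>
      ((1 + 1 / real m) * (harmonic_ratio k * opt I + (real k + real k * real C) * T) + 3 * real C * real k * T) / T"
      using o(3) by (intro divide_right_mono) auto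
    also have "\<dots> = (1 + 1 / real m) * (harmonic_ratio k * opt_avg T I + (real k + real k * real C)) + 3 * real C * real k"
      using o(3) by (simp add: opt_avg_def add_divide_distrib distrib_left)
    finally show "\<exists>C :: nat. real C \<le> 1 + real m * ?l \<and>
       ?X \<le> (1 + 1 / real m) * (harmonic_ratio k * opt_avg T I + (real k + real k * real C)) + 3 * real C * real k"
      using C(1) unfolding avg_cost_def by blast
  qed (use assms(2) harmonic_ratio_bounds[OF assms(2)] in auto)
  assume unif: "uniform_size I"
  \<comment> \<open>The same schedule is analysed again, now with ratio 1 and without the factor
    \<open>k\<close> in the errors.\<close>
  have "?X \<le> 1 * opt_avg T I + 30 * sqrt (opt_avg T I * 1 * max 1 ?l)"
  proof (rule sqrt_tradeoff[OF o(1,2) _ _ _ _ _ small, of _ _ ?l])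
    fix m assume m: "m \<in> {1..length I}"
    obtain C :: nat where C: "real C \<le> 1 + real m * ?l"
      "cost I (schedule_of I (harmonic_machines k m ?L)) \<le> (1 + 1 / real m) * (opt I + real C * T) + 3 * real C * T"
      using harmonic_cost_uniform[OF assms(1) _ _ unif, of k m] m assms(2) by auto
    have "cost I (near_optimal k I) \<le> (1 + 1 / real m) * (opt I + real C * T) + 3 * real C * T"
      using harm[OF m] C(2) by linarith
    then have "cost I (near_optimal k I) / T \<le> ((1 + 1 / real m) * (opt I + real C * T) + 3 * real C * T) / T"
      using o(3) by (intro divide_right_mono) auto
    also have "\<dots> = (1 + 1 / real m) * (opt_avg T I + real C) + 3 * real C"
      using o(3) by (simp add: opt_avg_def add_divide_distrib distrib_left)
    also have "\<dots> \<le> (1 + 1 / real m) * (1 * opt_avg T I + (1 + 1 * real C)) + 3 * real C * 1"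
      by (simp add: mult_left_mono)
    finally show "\<exists>C :: nat. real C \<le> 1 + real m * ?l \<and>
       ?X \<le> (1 + 1 / real m) * (1 * opt_avg T I + (1 + 1 * real C)) + 3 * real C * 1"
      using C(1) unfolding avg_cost_def by blast
  qed auto
  then show "?X \<le> opt_avg T I + 30 * sqrt (opt_avg T I * max 1 ?l)" by simp
qed

section \<open>Programs with polynomial running time\<close>

context
  notes One_nat_def [simp del]
begin

text \<open>The base \<open>Suc n\<close> is at least 1, so exponents can be raised also for
  \<open>n = 0\<close>.\<close>

definition poly_bounded :: "(nat \<Rightarrow> nat) \<Rightarrow> bool" where
  "poly_bounded p \<longleftrightarrow> (\<exists>a d. \<forall>n. p n \<le> a * Suc n ^ d)"

lemma poly_bounded_const [intro!]: "poly_bounded (\<lambda>_. c)"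
  unfolding poly_bounded_def by (rule exI[of _ c], rule exI[of _ 0]) simp

lemma poly_bounded_id [intro!]: "poly_bounded (\<lambda>n. n)"
  unfolding poly_bounded_def by (rule exI[of _ 1], rule exI[of _ 1]) simp

lemma poly_bounded_add [intro!]:
  assumes "poly_bounded p" "poly_bounded q"
  shows "poly_bounded (\<lambda>n. p n + q n)"
proof -
  obtain a d a' d' where p: "\<And>n. p n \<le> a * Suc n ^ d" and q: "\<And>n. q n \<le> a' * Suc n ^ d'"
    using assms unfolding poly_bounded_def by blast
  have "p n + q n \<le> (a + a') * Suc n ^ (d + d')" for n
  proof -
    have "a * Suc n ^ d \<le> a * Suc n ^ (d + d')" "a' * Suc n ^ d' \<le> a' * Suc n ^ (d + d')"
      by (intro mult_le_mono2 power_increasing; simp)+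
    then show ?thesis using p[of n] q[of n] unfolding add_mult_distrib by linarith
  qed
  then show ?thesis unfolding poly_bounded_def by blast
qed

lemma poly_bounded_mult [intro!]:
  assumes "poly_bounded p" "poly_bounded q"
  shows "poly_bounded (\<lambda>n. p n * q n)"
proof -
  obtain a d a' d' where p: "\<And>n. p n \<le> a * Suc n ^ d" and q: "\<And>n. q n \<le> a' * Suc n ^ d'"
    using assms unfolding poly_bounded_def by blast
  have "p n * q n \<le> (a * a') * Suc n ^ (d + d')" for n
    using mult_le_mono[OF p[of n] q[of n]] by (simp add: power_add algebra_simps)
  then show ?thesis unfolding poly_bounded_def by blast
qed

text \<open>A weakest precondition for total correctness with a bound \<open>b\<close> on the number
  of steps.\<close>

definition wp :: "com \<Rightarrow> nat \<Rightarrow> (store \<Rightarrow> bool) \<Rightarrow> store \<Rightarrow> bool" where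
  "wp c b Q s \<longleftrightarrow> (\<exists>n s'. exec c s n s' \<and> n \<le> b \<and> Q s')"

lemma wp_mono: "wp c b Q s \<Longrightarrow> b \<le> b' \<Longrightarrow> (\<And>s. Q s \<Longrightarrow> Q' s) \<Longrightarrow> wp c b' Q' s"
  unfolding wp_def by (meson le_trans)

lemma wp_Assign: "Q (s(x := eval_expr E s)) \<Longrightarrow> wp (Assign x E) 1 Q s"
  unfolding wp_def using exec.Assign by blast

lemma wp_Seq: "wp c1 b1 (wp c2 b2 Q) s \<Longrightarrow> wp (Seq c1 c2) (b1 + b2) Q s"
  unfolding wp_def using exec.Seq by (metis add_mono)

lemma wp_Cond:
  assumes "eval_test b s \<Longrightarrow> wp c1 n Q s" "\<not> eval_test b s \<Longrightarrow> wp c2 n Q s"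
  shows "wp (Cond b c1 c2) (Suc n) Q s"
  using assms unfolding wp_def
  by (cases "eval_test b s") (metis exec.CondTrue Suc_le_mono, metis exec.CondFalse Suc_le_mono)

lemma wp_WhileFalse: "\<not> eval_test b s \<Longrightarrow> Q s \<Longrightarrow> wp (While b c) 1 Q s"
  unfolding wp_def by (intro exI[of _ 1] exI[of _ s] conjI exec.WhileFalse) auto

lemma wp_WhileTrue:
  "eval_test b s \<Longrightarrow> wp c n1 (wp (While b c) n2 Q) s \<Longrightarrow> wp (While b c) (Suc (n1 + n2)) Q s"
proof -
  assume b: "eval_test b s" and "wp c n1 (wp (While b c) n2 Q) s"
  then obtain n s1 n' s2 where "exec c s n s1" "n \<le> n1" "exec (While b c) s1 n' s2" "n' \<le> n2" "Q s2"
    unfolding wp_def by (elim exE conjE) (rule that)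
  then show ?thesis
    unfolding wp_def
    by (intro exI[of _ "Suc (n + n')"] exI[of _ s2] conjI exec.WhileTrue[OF b]) auto
qed

text \<open>Register 0 holds the argument and the result, register 1 a stack that is restored at the end; all
  other registers may be overwritten.\<close>

definition runs :: "com \<Rightarrow> val \<Rightarrow> nat \<Rightarrow> val \<Rightarrow> bool" where
  "runs c v b v' \<longleftrightarrow> (\<forall>s. s 0 = v \<longrightarrow> wp c b (\<lambda>s'. s' 0 = v' \<and> s' 1 = s 1) s)"

lemma runs_mono: "runs c v b v' \<Longrightarrow> b \<le> b' \<Longrightarrow> runs c v b' v'"
  unfolding runs_def by (auto elim: wp_mono)

lemma wp_runs: "runs c (s 0) b v' \<Longrightarrow> (\<And>s'. s' 0 = v' \<Longrightarrow> s' 1 = s 1 \<Longrightarrow> Q s') \<Longrightarrow> wp c b Q s"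
  unfolding runs_def by (drule spec[of _ s], drule mp[OF _ refl], erule wp_mono) auto

lemma runs_Seq: "runs c1 v b1 u \<Longrightarrow> runs c2 u b2 w \<Longrightarrow> runs (Seq c1 c2) v (b1 + b2) w"
  unfolding runs_def[of "Seq c1 c2"]
  by (intro allI impI wp_Seq, rule wp_runs[of c1], simp, rule wp_runs[of c2], simp_all)

lemma runs_Assign: "(\<And>s. s 0 = v \<Longrightarrow> eval_expr E s = v') \<Longrightarrow> runs (Assign 0 E) v 1 v'"
  unfolding runs_def by (intro allI impI wp_Assign) simp

text \<open>The argument waits on the stack while \<open>c1\<close> runs; then the result of
  \<open>c1\<close> takes its place while \<open>c2\<close> runs. Register 2 only bridges two
  assignments, so both parts may overwrite it.\<close>

definition pair_com :: "com \<Rightarrow> com \<Rightarrow> com" where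
  "pair_com c1 c2 =
     Seq (Assign 1 (CellE (Var 0) (Var 1))) (Seq c1 (Seq (Assign 2 (Var 0)) (Seq (Assign 0 (Head (Var 1)))
      (Seq (Assign 1 (CellE (Var 2) (Tail (Var 1)))) (Seq c2
      (Seq (Assign 0 (CellE (Head (Var 1)) (Var 0))) (Assign 1 (Tail (Var 1)))))))))"

lemma runs_pair_com:
  assumes "runs c1 v b1 u" "runs c2 v b2 w"
  shows "runs (pair_com c1 c2) v (1 + (b1 + (1 + (1 + (1 + (b2 + (1 + 1))))))) (Cell u w)"
  unfolding runs_def pair_com_def
  apply (intro allI impI)
  apply (rule wp_Seq, rule wp_Assign, rule wp_Seq, rule wp_runs[of c1 _ b1 u])
   apply (simp add: assms(1))
  apply (rule wp_Seq, rule wp_Assign, rule wp_Seq, rule wp_Assign, rule wp_Seq, rule wp_Assign,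
      rule wp_Seq, rule wp_runs[of c2 _ b2 w])
   apply (simp add: assms(2))
  apply (rule wp_Seq, rule wp_Assign, rule wp_Assign)
  apply simp
  done

definition truth :: "bool \<Rightarrow> val" where
  "truth b = (if b then Cell Null Null else Null)"

text \<open>Pairing the result of the test with the argument preserves the argument for the chosen
  branch.\<close>

definition if_com :: "com \<Rightarrow> com \<Rightarrow> com \<Rightarrow> com" where
  "if_com c c1 c2 = Seq (pair_com c (Assign 0 (Var 0)))
     (Cond (IsCell (Head (Var 0))) (Seq (Assign 0 (Tail (Var 0))) c1) (Seq (Assign 0 (Tail (Var 0))) c2))"

lemma runs_if_com:
  assumes "runs c v b (truth t)" "t \<Longrightarrow> runs c1 v b1 u" "\<not> t \<Longrightarrow> runs c2 v b1 u"
  shows "runs (if_com c c1 c2) v (1 + (b + (1 + (1 + (1 + (1 + (1 + 1)))))) + Suc (1 + b1)) u"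
proof -
  have "runs (Cond (IsCell (Head (Var 0))) (Seq (Assign 0 (Tail (Var 0))) c1) (Seq (Assign 0 (Tail (Var 0))) c2))
     (Cell (truth t) v) (Suc (1 + b1)) u"
    unfolding runs_def
    apply (intro allI impI)
    apply (rule wp_Cond; rule wp_Seq; rule wp_Assign)
     apply (rule wp_runs[of c1 _ b1 u])
      apply (use assms(2) in \<open>auto simp: truth_def split: if_splits\<close>)[1]
     apply simp
    apply (rule wp_runs[of c2 _ b1 u])
     apply (use assms(3) in \<open>auto simp: truth_def split: if_splits\<close>)[1]
    apply simp
    done
  moreover have "runs (Assign 0 (Var 0)) v 1 v" by (rule runs_Assign) simp
  ultimately show ?thesis
    unfolding if_com_def using runs_Seq[OF runs_pair_com[OF assms(1)]] by blast
qed

definition enc_list :: "('a \<Rightarrow> val) \<Rightarrow> 'a list \<Rightarrow> val" where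
  "enc_list ea xs = list_val (map ea xs)"

lemma enc_list_simps [simp]:
  "enc_list ea [] = Null" "enc_list ea (x # xs) = Cell (ea x) (enc_list ea xs)"
  by (simp_all add: enc_list_def)

text \<open>Register 0 holds the remaining list, the accumulator and the environment. The body
  receives element, accumulator and environment and leaves only the new accumulator, so the rest of
  the list and the environment wait on the stack.\<close>

definition fold_com :: "com \<Rightarrow> com" where
  "fold_com c = While (IsCell (Head (Var 0)))
     (Seq (Assign 1 (CellE (CellE (Tail (Head (Var 0))) (Tail (Tail (Var 0)))) (Var 1)))
     (Seq (Assign 0 (CellE (Head (Head (Var 0))) (Tail (Var 0))))
     (Seq c
     (Seq (Assign 0 (CellE (Head (Head (Var 1))) (CellE (Var 0) (Tail (Head (Var 1))))))
     (Assign 1 (Tail (Var 1)))))))"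

text \<open>The body has to be correct only on accumulators that actually occur, with one time bound
  \<open>m\<close> for all of them. A round adds five steps to the body: the test and four
  assignments.\<close>

lemma runs_fold_com:
  assumes "\<And>ys a zs. xs = ys @ a # zs \<Longrightarrow>
     runs c (Cell (ea a) (Cell (eb (fold f ys b0)) env)) m (eb (f a (fold f ys b0)))"
  shows "runs (fold_com c) (Cell (enc_list ea xs) (Cell (eb b0) env)) (length xs * (m + 5) + 1)
     (Cell Null (Cell (eb (fold f xs b0)) env))"
  using assms
proof (induction xs arbitrary: b0)
  case Nil
  have "runs (fold_com c) (Cell Null (Cell (eb b0) env)) 1 (Cell Null (Cell (eb b0) env))"
    unfolding runs_def fold_com_def by (intro allI impI wp_WhileFalse) simp_all
  then show ?case by simp
next
  case (Cons a xs)
  have IH: "runs (fold_com c) (Cell (enc_list ea xs) (Cell (eb (f a b0)) env)) (length xs * (m + 5) + 1)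
     (Cell Null (Cell (eb (fold f xs (f a b0))) env))"
    by (rule Cons.IH) (use Cons.prems[of "a # ys" for ys] in auto)
  have c: "runs c (Cell (ea a) (Cell (eb b0) env)) m (eb (f a b0))"
    using Cons.prems[of "[]" a xs] by simp
  have "length (a # xs) * (m + 5) + 1 =
      Suc ((1 + (1 + (m + (1 + 1)))) + (length xs * (m + 5) + 1))" by simp
  moreover have "runs (fold_com c) (Cell (enc_list ea (a # xs)) (Cell (eb b0) env))
     (Suc ((1 + (1 + (m + (1 + 1)))) + (length xs * (m + 5) + 1)))
     (Cell Null (Cell (eb (fold f xs (f a b0))) env))"
    unfolding runs_def
    apply (intro allI impI)
    apply (subst fold_com_def)
    apply (rule wp_WhileTrue)
     apply simp
    apply (fold fold_com_def)
    apply (rule wp_Seq, rule wp_Assign, rule wp_Seq, rule wp_Assign, rule wp_Seq, rule wp_runs[of c _ m "eb (f a b0)"])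
     apply (simp add: c)
    apply (rule wp_Seq, rule wp_Assign, rule wp_Assign)
    apply (rule wp_runs[of _ _ _ "Cell Null (Cell (eb (fold f xs (f a b0))) env)"])
    using IH apply simp
    apply simp
    done
  ultimately show ?case by (simp only: fold_simps)
qed

text \<open>\<open>ptime D e f\<close>: from the environment \<open>e x\<close> a program computes \<open>f x\<close>, in time polynomial in \<open>n\<close>, for all
  \<open>x\<close> that \<open>D n\<close> admits. The index \<open>x\<close> collects the values of all variables in scope.\<close>

definition ptime :: "(nat \<Rightarrow> 'x \<Rightarrow> bool) \<Rightarrow> ('x \<Rightarrow> val) \<Rightarrow> ('x \<Rightarrow> val) \<Rightarrow> bool" where
  "ptime D e f \<longleftrightarrow> (\<exists>c p. poly_bounded p \<and> (\<forall>n x. D n x \<longrightarrow> runs c (e x) (p n) (f x)))"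

definition pbound :: "(nat \<Rightarrow> 'x \<Rightarrow> bool) \<Rightarrow> ('x \<Rightarrow> nat) \<Rightarrow> bool" where
  "pbound D f \<longleftrightarrow> (\<exists>p. poly_bounded p \<and> (\<forall>n x. D n x \<longrightarrow> f x \<le> p n))"

section \<open>Closure properties of polynomial-time functions\<close>

lemma ptimeE:
  assumes "ptime D e f"
  obtains c p where "poly_bounded p" "\<And>n x. D n x \<Longrightarrow> runs c (e x) (p n) (f x)"
  using assms unfolding ptime_def by blast

lemma ptimeI:
  "poly_bounded p \<Longrightarrow> (\<And>n x. D n x \<Longrightarrow> runs c (e x) (p n) (f x)) \<Longrightarrow> ptime D e f"
  unfolding ptime_def by blast

lemma ptime_cong:
  "ptime D e f \<Longrightarrow> (\<And>n x. D n x \<Longrightarrow> f x = g x) \<Longrightarrow> ptime D e g"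
  unfolding ptime_def by metis

lemma ptime_expr:
  assumes "ptime D e f" "\<And>n x s. D n x \<Longrightarrow> s 0 = f x \<Longrightarrow> eval_expr E s = g x"
  shows "ptime D e g"
proof -
  obtain c p where p: "poly_bounded p" "\<And>n x. D n x \<Longrightarrow> runs c (e x) (p n) (f x)"
    using assms(1) by (rule ptimeE) blast
  show ?thesis
    by (rule ptimeI[of "\<lambda>n. p n + 1" _ "Seq c (Assign 0 E)"])
      (intro poly_bounded_add poly_bounded_const p(1), rule runs_Seq[OF p(2) runs_Assign[OF assms(2)]])
qed

lemma ptime_self: "ptime D e e"
  by (rule ptimeI[of "\<lambda>_. 1" _ "Assign 0 (Var 0)"]) (rule poly_bounded_const, rule runs_Assign, simp)

lemma ptime_Null [intro]: "ptime D e (\<lambda>_. Null)"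
  by (rule ptime_expr[OF ptime_self, where E=NullE]) simp

lemma ptime_one [intro]: "ptime D e (\<lambda>_. Atom 1)"
  by (rule ptime_expr[OF ptime_self, where E=One]) simp

lemma ptime_zero [intro]: "ptime D e (\<lambda>_. Atom 0)"
  by (rule ptime_expr[OF ptime_self, where E="Minus One One"]) simp

lemma ptime_Cell [intro]:
  assumes "ptime D e f" "ptime D e g"
  shows "ptime D e (\<lambda>x. Cell (f x) (g x))"
proof -
  obtain c p c' p' where p: "poly_bounded p" "\<And>n x. D n x \<Longrightarrow> runs c (e x) (p n) (f x)"
    "poly_bounded p'" "\<And>n x. D n x \<Longrightarrow> runs c' (e x) (p' n) (g x)"
    using assms by (metis ptimeE)
  show ?thesis
    by (rule ptimeI[of "\<lambda>n. 1 + (p n + (1 + (1 + (1 + (p' n + (1 + 1))))))" _ "pair_com c c'"])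
      (intro poly_bounded_add poly_bounded_const p, rule runs_pair_com[OF p(2) p(4)])
qed

lemma ptime_Head: "ptime D e f \<Longrightarrow> (\<And>n x. D n x \<Longrightarrow> \<exists>u. f x = Cell (g x) u) \<Longrightarrow> ptime D e g"
  by (rule ptime_expr[where E="Head (Var 0)"]) (fastforce split: val.splits)+

lemma ptime_Tail: "ptime D e f \<Longrightarrow> (\<And>n x. D n x \<Longrightarrow> \<exists>u. f x = Cell u (g x)) \<Longrightarrow> ptime D e g"
  by (rule ptime_expr[where E="Tail (Var 0)"]) (fastforce split: val.splits)+

lemma ptime_add [intro]:
  assumes "ptime D e (\<lambda>x. Atom (f x))" "ptime D e (\<lambda>x. Atom (g x))"
  shows "ptime D e (\<lambda>x. Atom (f x + g x))"
  by (rule ptime_expr[OF ptime_Cell[OF assms], where E="Plus (Head (Var 0)) (Tail (Var 0))"]) simp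

lemma ptime_diff [intro]:
  assumes "ptime D e (\<lambda>x. Atom (f x))" "ptime D e (\<lambda>x. Atom (g x))"
  shows "ptime D e (\<lambda>x. Atom (f x - g x))"
  by (rule ptime_expr[OF ptime_Cell[OF assms], where E="Minus (Head (Var 0)) (Tail (Var 0))"]) simp

text \<open>The factor is fixed, so the repeated addition is unrolled in the program text.\<close>

lemma ptime_times_const [intro]:
  assumes "ptime D e (\<lambda>x. Atom (f x))"
  shows "ptime D e (\<lambda>x. Atom (real j * f x))"
  by (induction j) (use assms in \<open>auto simp: algebra_simps\<close>)

lemma ptime_numeral [intro]: "ptime D e (\<lambda>x. Atom (numeral j))"
  using ptime_times_const[OF ptime_one, of D e "numeral j"] by simp

lemma ptime_test:
  assumes "ptime D e f" "\<And>n x s. D n x \<Longrightarrow> s 0 = f x \<Longrightarrow> eval_test b s = t x"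
  shows "ptime D e (\<lambda>x. truth (t x))"
proof -
  obtain c p where p: "poly_bounded p" "\<And>n x. D n x \<Longrightarrow> runs c (e x) (p n) (f x)"
    using assms(1) by (rule ptimeE) blast
  have "runs (Cond b (Assign 0 (CellE NullE NullE)) (Assign 0 NullE)) (f x) (Suc 1) (truth (t x))"
    if "D n x" for n x
    unfolding runs_def
    by (intro allI impI wp_Cond wp_Assign) (use assms(2)[OF that] in \<open>auto simp: truth_def\<close>)
  then show ?thesis
    by (intro ptimeI[of "\<lambda>n. p n + Suc 1" _ "Seq c (Cond b (Assign 0 (CellE NullE NullE)) (Assign 0 NullE))"])
      (intro poly_bounded_add poly_bounded_const p(1), rule runs_Seq[OF p(2)])
qed

lemma ptime_less [intro]:
  assumes "ptime D e (\<lambda>x. Atom (f x))" "ptime D e (\<lambda>x. Atom (g x))"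
  shows "ptime D e (\<lambda>x. truth (f x < g x))"
  by (rule ptime_test[OF ptime_Cell[OF assms], where b="Less (Head (Var 0)) (Tail (Var 0))"]) simp

lemma ptime_not [intro]:
  assumes "ptime D e (\<lambda>x. truth (b x))"
  shows "ptime D e (\<lambda>x. truth (\<not> b x))"
  by (rule ptime_test[OF assms, where b="Neg (IsCell (Var 0))"]) (simp add: truth_def)

lemma ptime_conj [intro]:
  assumes "ptime D e (\<lambda>x. truth (b x))" "ptime D e (\<lambda>x. truth (c x))"
  shows "ptime D e (\<lambda>x. truth (b x \<and> c x))"
  by (rule ptime_test[OF ptime_Cell[OF assms], where b="Conj (IsCell (Head (Var 0))) (IsCell (Tail (Var 0)))"])
    (simp add: truth_def)

lemma ptime_disj [intro]:
  assumes "ptime D e (\<lambda>x. truth (b x))" "ptime D e (\<lambda>x. truth (c x))"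
  shows "ptime D e (\<lambda>x. truth (b x \<or> c x))"
  using ptime_not[OF ptime_conj[OF ptime_not[OF assms(1)] ptime_not[OF assms(2)]]] by simp

lemma ptime_le [intro]:
  assumes "ptime D e (\<lambda>x. Atom (f x))" "ptime D e (\<lambda>x. Atom (g x))"
  shows "ptime D e (\<lambda>x. truth (f x \<le> g x))"
  using ptime_not[OF ptime_less[OF assms(2,1)]] by (simp add: not_less)

lemma ptime_eq [intro]:
  fixes f g :: "_ \<Rightarrow> real"
  assumes "ptime D e (\<lambda>x. Atom (f x))" "ptime D e (\<lambda>x. Atom (g x))"
  shows "ptime D e (\<lambda>x. truth (f x = g x))"
  using ptime_conj[OF ptime_le[OF assms] ptime_le[OF assms(2,1)]] by (simp add: eq_iff)

text \<open>\<open>D'\<close> and \<open>e'\<close> describe an inner scope, such as a loop body, in which everything computable in the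
  outer scope can be recomputed; \<open>\<phi>\<close> projects to the outer variables. The premises of \<open>ptime_fold\<close>
  and its consequences know the inner scope only through this property.\<close>

definition extends ::
  "(nat \<Rightarrow> 'x \<Rightarrow> bool) \<Rightarrow> ('x \<Rightarrow> val) \<Rightarrow> (nat \<Rightarrow> 'y \<Rightarrow> bool) \<Rightarrow> ('y \<Rightarrow> val) \<Rightarrow> ('y \<Rightarrow> 'x) \<Rightarrow> bool" where
  "extends D e D' e' \<phi> \<longleftrightarrow>
     (\<forall>g. ptime D e g \<longrightarrow> ptime D' e' (\<lambda>y. g (\<phi> y))) \<and> (\<forall>n y. D' n y \<longrightarrow> D n (\<phi> y))"

lemma ptime_ext: "extends D e D' e' \<phi> \<Longrightarrow> ptime D e g \<Longrightarrow> ptime D' e' (\<lambda>y. g (\<phi> y))"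
  unfolding extends_def by blast

lemma dom_ext: "extends D e D' e' \<phi> \<Longrightarrow> D' n y \<Longrightarrow> D n (\<phi> y)"
  unfolding extends_def by blast

lemma pbound_ext: "extends D e D' e' \<phi> \<Longrightarrow> pbound D f \<Longrightarrow> pbound D' (\<lambda>y. f (\<phi> y))"
  unfolding pbound_def by (elim exE conjE, rule exI, erule conjI) (auto dest: dom_ext)

lemma pbound_mono: "pbound D g \<Longrightarrow> (\<And>n x. D n x \<Longrightarrow> f x \<le> g x) \<Longrightarrow> pbound D f"
proof -
  assume "pbound D g" and le: "\<And>n x. D n x \<Longrightarrow> f x \<le> g x"
  then obtain p where p: "poly_bounded p" "\<And>n x. D n x \<Longrightarrow> g x \<le> p n" unfolding pbound_def by blast
  have "f x \<le> p n" if "D n x" for n x using le[OF that] p(2)[OF that] by simp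
  with p(1) show ?thesis unfolding pbound_def by blast
qed

lemma pbound_add: "pbound D f \<Longrightarrow> pbound D g \<Longrightarrow> pbound D (\<lambda>x. f x + g x)"
proof -
  assume "pbound D f" "pbound D g"
  then obtain p q where p: "poly_bounded p" "poly_bounded q" "\<And>n x. D n x \<Longrightarrow> f x \<le> p n"
    "\<And>n x. D n x \<Longrightarrow> g x \<le> q n"
    unfolding pbound_def by metis
  show ?thesis
    unfolding pbound_def
    by (rule exI[of _ "\<lambda>n. p n + q n"], intro conjI allI impI poly_bounded_add add_mono p)
qed

lemma pbound_const: "pbound D (\<lambda>_. c)"
  unfolding pbound_def by blast

text \<open>Each branch is programmed only for the arguments that reach it, so \<open>hd\<close> may
  be taken after a test for the empty list. The programs of the branches are independent, and their
  time bounds are added.\<close>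

lemma ptime_if:
  assumes "ptime D e (\<lambda>x. truth (b x))"
    and "\<And>D'. extends D e D' e (\<lambda>x. x) \<Longrightarrow> (\<And>n x. D' n x \<Longrightarrow> b x) \<Longrightarrow> ptime D' e f"
    and "\<And>D'. extends D e D' e (\<lambda>x. x) \<Longrightarrow> (\<And>n x. D' n x \<Longrightarrow> \<not> b x) \<Longrightarrow> ptime D' e g"
  shows "ptime D e (\<lambda>x. if b x then f x else g x)"
proof -
  have "ptime (\<lambda>n x. D n x \<and> b x) e f"
    by (rule assms(2)) (auto simp: extends_def ptime_def)
  then obtain c1 p1 where 1: "poly_bounded p1" "\<And>n x. D n x \<Longrightarrow> b x \<Longrightarrow> runs c1 (e x) (p1 n) (f x)"
    unfolding ptime_def by metis
  have "ptime (\<lambda>n x. D n x \<and> \<not> b x) e g"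
    by (rule assms(3)) (auto simp: extends_def ptime_def)
  then obtain c2 p2 where 2: "poly_bounded p2" "\<And>n x. D n x \<Longrightarrow> \<not> b x \<Longrightarrow> runs c2 (e x) (p2 n) (g x)"
    unfolding ptime_def by metis
  obtain c p where p: "poly_bounded p" "\<And>n x. D n x \<Longrightarrow> runs c (e x) (p n) (truth (b x))"
    using assms(1) by (rule ptimeE) blast
  show ?thesis
  proof (rule ptimeI[of "\<lambda>n. (1 + (p n + (1 + (1 + (1 + (1 + (1 + 1))))))) + (1 + (1 + (p1 n + p2 n)))"
        _ "if_com c c1 c2"])
    fix n x assume D: "D n x"
    have "b x \<Longrightarrow> runs c1 (e x) (p1 n + p2 n) (if b x then f x else g x)"
      using runs_mono[OF 1(2)[OF D], of "p1 n + p2 n"] by simp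
    moreover have "\<not> b x \<Longrightarrow> runs c2 (e x) (p1 n + p2 n) (if b x then f x else g x)"
      using runs_mono[OF 2(2)[OF D], of "p1 n + p2 n"] by simp
    ultimately have "runs (if_com c c1 c2) (e x)
         (1 + (p n + (1 + (1 + (1 + (1 + (1 + 1)))))) + Suc (1 + (p1 n + p2 n))) (if b x then f x else g x)"
      by (rule runs_if_com[OF p(2)[OF D]])
    then show "runs (if_com c c1 c2) (e x)
         (1 + (p n + (1 + (1 + (1 + (1 + (1 + 1)))))) + (1 + (1 + (p1 n + p2 n)))) (if b x then f x else g x)"
      by simp
  qed (intro poly_bounded_add poly_bounded_const 1 2 p)
qed

lemma ptime_if_simple [intro]:
  assumes "ptime D e (\<lambda>x. truth (b x))" "ptime D e f" "ptime D e g"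
  shows "ptime D e (\<lambda>x. if b x then f x else g x)"
  by (rule ptime_if[OF assms(1)]) (use assms(2,3) ptime_ext in fastforce)+

text \<open>The last premise of \<open>step\<close>, that the accumulator comes from a prefix of the
  list, is what bounds its size: one polynomial bound must serve all rounds, and an arbitrary
  accumulator would admit none. The inner index consists of the outer index, the element and the
  accumulator, and \<open>e'\<close> has the layout of \<open>fold_com\<close>.\<close>

lemma ptime_fold:
  fixes D :: "nat \<Rightarrow> 'x \<Rightarrow> bool" and ea :: "'a \<Rightarrow> val" and eb :: "'b \<Rightarrow> val"
  assumes xs: "ptime D e (\<lambda>x. enc_list ea (xs x))" and len: "pbound D (\<lambda>x. length (xs x))"
    and init: "ptime D e (\<lambda>x. eb (b0 x))"
    and step: "\<And>D' e' (\<phi> :: 'x \<times> 'a \<times> 'b \<Rightarrow> 'x) a b. extends D e D' e' \<phi> \<Longrightarrow>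
       ptime D' e' (\<lambda>y. ea (a y)) \<Longrightarrow> ptime D' e' (\<lambda>y. eb (b y)) \<Longrightarrow>
       (\<And>n y. D' n y \<Longrightarrow> \<exists>ys zs. xs (\<phi> y) = ys @ a y # zs \<and> b y = fold (f (\<phi> y)) ys (b0 (\<phi> y))) \<Longrightarrow>
       ptime D' e' (\<lambda>y. eb (f (\<phi> y) (a y) (b y)))"
  shows "ptime D e (\<lambda>x. eb (fold (f x) (xs x) (b0 x)))"
proof -
  define D' where "D' n y \<longleftrightarrow> D n (fst y) \<and> (\<exists>ys zs. xs (fst y) = ys @ fst (snd y) # zs \<and>
     snd (snd y) = fold (f (fst y)) ys (b0 (fst y)))" for n and y :: "'x \<times> 'a \<times> 'b"
  define e' where "e' y = Cell (ea (fst (snd y))) (Cell (eb (snd (snd y))) (e (fst y)))" for y :: "'x \<times> 'a \<times> 'b"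
  have ext: "extends D e D' e' fst"
    unfolding extends_def
  proof (intro conjI allI impI)
    fix g assume "ptime D e g"
    then obtain c p where p: "poly_bounded p" "\<And>n x. D n x \<Longrightarrow> runs c (e x) (p n) (g x)"
      by (rule ptimeE) blast
    show "ptime D' e' (\<lambda>y. g (fst y))"
      by (rule ptimeI[of "\<lambda>n. 1 + p n" _ "Seq (Assign 0 (Tail (Tail (Var 0)))) c"],
          intro poly_bounded_add poly_bounded_const p(1), rule runs_Seq[OF runs_Assign p(2)])
        (auto simp: e'_def D'_def)
  qed (simp add: D'_def)
  have "ptime D' e' (\<lambda>y. eb (f (fst y) (fst (snd y)) (snd (snd y))))"
  proof (rule step[OF ext])
    show "ptime D' e' (\<lambda>y. ea (fst (snd y)))"
      by (rule ptime_Head[OF ptime_self]) (simp add: e'_def)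
    show "ptime D' e' (\<lambda>y. eb (snd (snd y)))"
      by (rule ptime_expr[OF ptime_self, where E="Head (Tail (Var 0))"]) (simp add: e'_def)
    show "\<exists>ys zs. xs (fst y) = ys @ fst (snd y) # zs \<and> snd (snd y) = fold (f (fst y)) ys (b0 (fst y))"
      if "D' n y" for n y using that by (simp add: D'_def)
  qed
  then obtain c p where p: "poly_bounded p"
    "\<And>n y. D' n y \<Longrightarrow> runs c (e' y) (p n) (eb (f (fst y) (fst (snd y)) (snd (snd y))))"
    by (rule ptimeE) blast
  obtain q where q: "poly_bounded q" "\<And>n x. D n x \<Longrightarrow> length (xs x) \<le> q n"
    using len unfolding pbound_def by blast
  have "ptime D e (\<lambda>x. Cell (enc_list ea (xs x)) (Cell (eb (b0 x)) (e x)))"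
    by (intro ptime_Cell xs init ptime_self)
  then obtain c0 p0 where p0: "poly_bounded p0"
    "\<And>n x. D n x \<Longrightarrow> runs c0 (e x) (p0 n) (Cell (enc_list ea (xs x)) (Cell (eb (b0 x)) (e x)))"
    by (rule ptimeE) blast
  have "ptime D e (\<lambda>x. Cell Null (Cell (eb (fold (f x) (xs x) (b0 x))) (e x)))"
  proof (rule ptimeI[of "\<lambda>n. p0 n + (q n * (p n + 5) + 1)" _ "Seq c0 (fold_com c)"])
    fix n x assume D: "D n x"
    have "runs c (Cell (ea a) (Cell (eb (fold (f x) ys (b0 x))) (e x))) (p n)
        (eb (f x a (fold (f x) ys (b0 x))))" if "xs x = ys @ a # zs" for ys a zs
      using p(2)[of n "(x, a, fold (f x) ys (b0 x))"] D that by (auto simp: D'_def e'_def)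
    then have "runs (fold_com c) (Cell (enc_list ea (xs x)) (Cell (eb (b0 x)) (e x)))
       (length (xs x) * (p n + 5) + 1) (Cell Null (Cell (eb (fold (f x) (xs x) (b0 x))) (e x)))"
      by (rule runs_fold_com)
    then have "runs (fold_com c) (Cell (enc_list ea (xs x)) (Cell (eb (b0 x)) (e x)))
       (q n * (p n + 5) + 1) (Cell Null (Cell (eb (fold (f x) (xs x) (b0 x))) (e x)))"
      by (rule runs_mono) (use q(2)[OF D] in \<open>simp del: add_mult_distrib2\<close>)
    with p0(2)[OF D] show "runs (Seq c0 (fold_com c)) (e x) (p0 n + (q n * (p n + 5) + 1))
        (Cell Null (Cell (eb (fold (f x) (xs x) (b0 x))) (e x)))"
      by (rule runs_Seq)
  qed (intro poly_bounded_add poly_bounded_mult poly_bounded_const p q p0)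
  then show ?thesis
    by (rule ptime_expr[where E="Head (Tail (Var 0))"]) simp
qed

end

section \<open>The algorithms as programs\<close>

lemma ptime_rev:
  assumes "ptime D e (\<lambda>x. enc_list ea (xs x))" "pbound D (\<lambda>x. length (xs x))"
  shows "ptime D e (\<lambda>x. enc_list ea (rev (xs x)))"
  unfolding rev_conv_fold
proof (rule ptime_fold[where f = "\<lambda>_. Cons" and eb = "enc_list ea", OF assms])
  show "ptime D e (\<lambda>x. enc_list ea [])" using ptime_Null by simp
qed (simp add: ptime_Cell)

lemma ptime_append:
  assumes "ptime D e (\<lambda>x. enc_list ea (xs x))" "pbound D (\<lambda>x. length (xs x))"
    "ptime D e (\<lambda>x. enc_list ea (ys x))"
  shows "ptime D e (\<lambda>x. enc_list ea (xs x @ ys x))"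
proof -
  have "ptime D e (\<lambda>x. enc_list ea (fold Cons (rev (xs x)) (ys x)))"
    by (rule ptime_fold[where f = "\<lambda>_. Cons" and eb = "enc_list ea", OF ptime_rev[OF assms(1,2)]])
      (use assms in \<open>simp_all add: ptime_Cell\<close>)
  then show ?thesis by (simp add: fold_Cons_rev)
qed

lemma ptime_filter:
  fixes D :: "nat \<Rightarrow> 'x \<Rightarrow> bool" and ea :: "'a \<Rightarrow> val"
  assumes xs: "ptime D e (\<lambda>x. enc_list ea (xs x))" and len: "pbound D (\<lambda>x. length (xs x))"
    and step: "\<And>D' e' (\<phi> :: 'x \<times> 'a \<times> 'a list \<Rightarrow> 'x) a. extends D e D' e' \<phi> \<Longrightarrow>
       ptime D' e' (\<lambda>y. ea (a y)) \<Longrightarrow> (\<And>n y. D' n y \<Longrightarrow> a y \<in> set (xs (\<phi> y))) \<Longrightarrow>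
       ptime D' e' (\<lambda>y. truth (P (\<phi> y) (a y)))"
  shows "ptime D e (\<lambda>x. enc_list ea (filter (P x) (xs x)))"
proof -
  have fold: "fold (\<lambda>a b. if Q a then a # b else b) ys b0 = rev (filter Q ys) @ b0" for Q ys and b0 :: "'a list"
    by (induction ys arbitrary: b0) auto
  have "ptime D e (\<lambda>x. enc_list ea (fold (\<lambda>a b. if P x a then a # b else b) (xs x) []))"
  proof (rule ptime_fold[where f = "\<lambda>x a b. if P x a then a # b else b" and eb = "enc_list ea", OF xs len])
    show "ptime D e (\<lambda>x. enc_list ea [])" using ptime_Null by simp
  next
    fix D' e' a b and \<phi> :: "'x \<times> 'a \<times> 'a list \<Rightarrow> 'x"
    assume ext: "extends D e D' e' \<phi>" and a: "ptime D' e' (\<lambda>y. ea (a y))"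
      and b: "ptime D' e' (\<lambda>y. enc_list ea (b y))"
      and mem: "\<And>n y. D' n y \<Longrightarrow> \<exists>ys zs. xs (\<phi> y) = ys @ a y # zs \<and>
        b y = fold (\<lambda>a b. if P (\<phi> y) a then a # b else b) ys []"
    have "ptime D' e' (\<lambda>y. truth (P (\<phi> y) (a y)))"
      using mem by (intro step[OF ext a]) force
    then have "ptime D' e' (\<lambda>y. if P (\<phi> y) (a y) then Cell (ea (a y)) (enc_list ea (b y)) else enc_list ea (b y))"
      using a b by (intro ptime_if_simple ptime_Cell)
    then show "ptime D' e' (\<lambda>y. enc_list ea (if P (\<phi> y) (a y) then a y # b y else b y))"
      by (rule ptime_cong) simp
  qed
  then have "ptime D e (\<lambda>x. enc_list ea (rev (filter (P x) (xs x))))" by (simp add: fold)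
  moreover have "pbound D (\<lambda>x. length (rev (filter (P x) (xs x))))"
    using len by (rule pbound_mono) simp
  ultimately have "ptime D e (\<lambda>x. enc_list ea (rev (rev (filter (P x) (xs x)))))" by (rule ptime_rev)
  then show ?thesis by simp
qed

lemma ptime_map:
  fixes D :: "nat \<Rightarrow> 'x \<Rightarrow> bool" and ea :: "'a \<Rightarrow> val" and eb :: "'b \<Rightarrow> val"
  assumes xs: "ptime D e (\<lambda>x. enc_list ea (xs x))" and len: "pbound D (\<lambda>x. length (xs x))"
    and step: "\<And>D' e' (\<phi> :: 'x \<times> 'a \<times> 'b list \<Rightarrow> 'x) a. extends D e D' e' \<phi> \<Longrightarrow>
       ptime D' e' (\<lambda>y. ea (a y)) \<Longrightarrow> (\<And>n y. D' n y \<Longrightarrow> a y \<in> set (xs (\<phi> y))) \<Longrightarrow>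
       ptime D' e' (\<lambda>y. eb (h (\<phi> y) (a y)))"
  shows "ptime D e (\<lambda>x. enc_list eb (map (h x) (xs x)))"
proof -
  have fold: "fold (\<lambda>a b. f a # b) ys b0 = rev (map f ys) @ b0" for f :: "'a \<Rightarrow> 'b" and ys b0
    by (induction ys arbitrary: b0) auto
  have "ptime D e (\<lambda>x. enc_list eb (fold (\<lambda>a b. h x a # b) (xs x) []))"
  proof (rule ptime_fold[where f = "\<lambda>x a b. h x a # b" and eb = "enc_list eb", OF xs len])
    show "ptime D e (\<lambda>x. enc_list eb [])" using ptime_Null by simp
  next
    fix D' e' a b and \<phi> :: "'x \<times> 'a \<times> 'b list \<Rightarrow> 'x"
    assume ext: "extends D e D' e' \<phi>" and a: "ptime D' e' (\<lambda>y. ea (a y))"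
      and b: "ptime D' e' (\<lambda>y. enc_list eb (b y))"
      and mem: "\<And>n y. D' n y \<Longrightarrow> \<exists>ys zs. xs (\<phi> y) = ys @ a y # zs \<and>
        b y = fold (\<lambda>a b. h (\<phi> y) a # b) ys []"
    have "ptime D' e' (\<lambda>y. eb (h (\<phi> y) (a y)))"
      using mem by (intro step[OF ext a]) force
    then show "ptime D' e' (\<lambda>y. enc_list eb (h (\<phi> y) (a y) # b y))"
      using b by (simp add: ptime_Cell)
  qed
  then have "ptime D e (\<lambda>x. enc_list eb (rev (map (h x) (xs x))))" by (simp add: fold)
  moreover have "pbound D (\<lambda>x. length (rev (map (h x) (xs x))))"
    using len by (rule pbound_mono) simp
  ultimately have "ptime D e (\<lambda>x. enc_list eb (rev (rev (map (h x) (xs x)))))" by (rule ptime_rev)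
  then show ?thesis by simp
qed

lemma ptime_sum_list:
  fixes D :: "nat \<Rightarrow> 'x \<Rightarrow> bool" and ea :: "'a \<Rightarrow> val"
  assumes xs: "ptime D e (\<lambda>x. enc_list ea (xs x))" and len: "pbound D (\<lambda>x. length (xs x))"
    and step: "\<And>D' e' (\<phi> :: 'x \<times> 'a \<times> real \<Rightarrow> 'x) a. extends D e D' e' \<phi> \<Longrightarrow>
       ptime D' e' (\<lambda>y. ea (a y)) \<Longrightarrow> (\<And>n y. D' n y \<Longrightarrow> a y \<in> set (xs (\<phi> y))) \<Longrightarrow>
       ptime D' e' (\<lambda>y. Atom (h (\<phi> y) (a y)))"
  shows "ptime D e (\<lambda>x. Atom (\<Sum>a\<leftarrow>xs x. h x a))"
proof -
  have fold: "fold (\<lambda>a b. b + f a) ys b0 = b0 + (\<Sum>a\<leftarrow>ys. f a)" for f :: "'a \<Rightarrow> real" and ys b0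
    by (induction ys arbitrary: b0) auto
  have "ptime D e (\<lambda>x. Atom (fold (\<lambda>a b. b + h x a) (xs x) 0))"
  proof (rule ptime_fold[where f = "\<lambda>x a b. b + h x a" and eb = Atom, OF xs len ptime_zero])
    fix D' e' a b and \<phi> :: "'x \<times> 'a \<times> real \<Rightarrow> 'x"
    assume ext: "extends D e D' e' \<phi>" and a: "ptime D' e' (\<lambda>y. ea (a y))"
      and b: "ptime D' e' (\<lambda>y. Atom (b y))"
      and mem: "\<And>n y. D' n y \<Longrightarrow> \<exists>ys zs. xs (\<phi> y) = ys @ a y # zs \<and>
        b y = fold (\<lambda>a b. b + h (\<phi> y) a) ys 0"
    have "ptime D' e' (\<lambda>y. Atom (h (\<phi> y) (a y)))"
      using mem by (intro step[OF ext a]) force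
    then show "ptime D' e' (\<lambda>y. Atom (b y + h (\<phi> y) (a y)))" by (rule ptime_add[OF b])
  qed
  then show ?thesis by (simp add: fold)
qed

lemma ptime_all:
  fixes D :: "nat \<Rightarrow> 'x \<Rightarrow> bool" and ea :: "'a \<Rightarrow> val"
  assumes xs: "ptime D e (\<lambda>x. enc_list ea (xs x))" and len: "pbound D (\<lambda>x. length (xs x))"
    and step: "\<And>D' e' (\<phi> :: 'x \<times> 'a \<times> bool \<Rightarrow> 'x) a. extends D e D' e' \<phi> \<Longrightarrow>
       ptime D' e' (\<lambda>y. ea (a y)) \<Longrightarrow> (\<And>n y. D' n y \<Longrightarrow> a y \<in> set (xs (\<phi> y))) \<Longrightarrow>
       ptime D' e' (\<lambda>y. truth (P (\<phi> y) (a y)))"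
  shows "ptime D e (\<lambda>x. truth (\<forall>a\<in>set (xs x). P x a))"
proof -
  have fold: "fold (\<lambda>a b. b \<and> Q a) ys b0 = (b0 \<and> (\<forall>a\<in>set ys. Q a))" for Q :: "'a \<Rightarrow> bool" and ys b0
    by (induction ys arbitrary: b0) auto
  have "ptime D e (\<lambda>x. truth (fold (\<lambda>a b. b \<and> P x a) (xs x) True))"
  proof (rule ptime_fold[where f = "\<lambda>x a b. b \<and> P x a" and eb = truth, OF xs len])
    show "ptime D e (\<lambda>x. truth True)" unfolding truth_def by (simp add: ptime_Cell ptime_Null)
  next
    fix D' e' a b and \<phi> :: "'x \<times> 'a \<times> bool \<Rightarrow> 'x"
    assume ext: "extends D e D' e' \<phi>" and a: "ptime D' e' (\<lambda>y. ea (a y))"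
      and b: "ptime D' e' (\<lambda>y. truth (b y))"
      and mem: "\<And>n y. D' n y \<Longrightarrow> \<exists>ys zs. xs (\<phi> y) = ys @ a y # zs \<and>
        b y = fold (\<lambda>a b. b \<and> P (\<phi> y) a) ys True"
    have "ptime D' e' (\<lambda>y. truth (P (\<phi> y) (a y)))"
      using mem by (intro step[OF ext a]) force
    then show "ptime D' e' (\<lambda>y. truth (b y \<and> P (\<phi> y) (a y)))" by (rule ptime_conj[OF b])
  qed
  then show ?thesis by (simp add: fold)
qed

lemma ptime_ex:
  fixes D :: "nat \<Rightarrow> 'x \<Rightarrow> bool" and ea :: "'a \<Rightarrow> val"
  assumes xs: "ptime D e (\<lambda>x. enc_list ea (xs x))" and len: "pbound D (\<lambda>x. length (xs x))"
    and step: "\<And>D' e' (\<phi> :: 'x \<times> 'a \<times> bool \<Rightarrow> 'x) a. extends D e D' e' \<phi> \<Longrightarrow>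
       ptime D' e' (\<lambda>y. ea (a y)) \<Longrightarrow> (\<And>n y. D' n y \<Longrightarrow> a y \<in> set (xs (\<phi> y))) \<Longrightarrow>
       ptime D' e' (\<lambda>y. truth (P (\<phi> y) (a y)))"
  shows "ptime D e (\<lambda>x. truth (\<exists>a\<in>set (xs x). P x a))"
proof -
  have "ptime D e (\<lambda>x. truth (\<forall>a\<in>set (xs x). \<not> P x a))"
    by (rule ptime_all[OF xs len]) (rule ptime_not, rule step)
  from ptime_not[OF this] show ?thesis by simp
qed

text \<open>A variable factor enters the programs as a list of that length, and the product is a sum
  over the list.\<close>

lemma ptime_times_length:
  assumes "ptime D e (\<lambda>x. enc_list ea (xs x))" "pbound D (\<lambda>x. length (xs x))" "ptime D e (\<lambda>x. Atom (p x))"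
  shows "ptime D e (\<lambda>x. Atom (real (length (xs x)) * p x))"
proof -
  have "ptime D e (\<lambda>x. Atom (\<Sum>a\<leftarrow>xs x. p x))"
    by (rule ptime_sum_list[OF assms(1,2)]) (rule ptime_ext[OF _ assms(3)])
  then show ?thesis by (simp add: sum_list_triv)
qed

lemma ptime_is_Nil:
  assumes "ptime D e (\<lambda>x. enc_list ea (xs x))"
  shows "ptime D e (\<lambda>x. truth (xs x = []))"
proof (rule ptime_test[OF assms, where b = "Neg (IsCell (Var 0))"])
  fix n x and s :: store assume "s 0 = enc_list ea (xs x)"
  then show "eval_test (Neg (IsCell (Var 0))) s = (xs x = [])" by (cases "xs x") auto
qed

lemma ptime_hd:
  assumes "ptime D e (\<lambda>x. enc_list ea (xs x))" "\<And>n x. D n x \<Longrightarrow> xs x \<noteq> []"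
  shows "ptime D e (\<lambda>x. ea (hd (xs x)))"
proof (rule ptime_Head[OF assms(1)])
  fix n x assume "D n x"
  then show "\<exists>u. enc_list ea (xs x) = Cell (ea (hd (xs x))) u" using assms(2)[of n x] by (cases "xs x") auto
qed

lemma ptime_tl:
  assumes "ptime D e (\<lambda>x. enc_list ea (xs x))" "\<And>n x. D n x \<Longrightarrow> xs x \<noteq> []"
  shows "ptime D e (\<lambda>x. enc_list ea (tl (xs x)))"
proof (rule ptime_Tail[OF assms(1)])
  fix n x assume "D n x"
  then show "\<exists>u. enc_list ea (xs x) = Cell u (enc_list ea (tl (xs x)))" using assms(2)[of n x] by (cases "xs x") auto
qed

section \<open>Encodings of items and groups, and elementary operations on them\<close>

definition item_val :: "item \<Rightarrow> val" where
  "item_val x = Cell (Atom (real (fst x))) (request_val (snd x))"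

abbreviation items_val :: "item list \<Rightarrow> val" where
  "items_val \<equiv> enc_list item_val"

abbreviation groups_val :: "item list list \<Rightarrow> val" where
  "groups_val \<equiv> enc_list items_val"

lemma ptime_item:
  assumes "ptime D e (\<lambda>x. item_val (a x))"
  shows "ptime D e (\<lambda>x. Atom (real (fst (a x))))" "ptime D e (\<lambda>x. Atom (item_start (a x)))"
    "ptime D e (\<lambda>x. Atom (item_finish (a x)))" "ptime D e (\<lambda>x. Atom (item_weight (a x)))"
    "ptime D e (\<lambda>x. Atom (item_dur (a x)))"
proof -
  show "ptime D e (\<lambda>x. Atom (real (fst (a x))))"
    by (rule ptime_Head[OF assms]) (simp add: item_val_def)
  show s: "ptime D e (\<lambda>x. Atom (item_start (a x)))"
    by (rule ptime_expr[OF assms, where E = "Head (Tail (Var 0))"]) (simp add: item_val_def request_val_def)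
  show f: "ptime D e (\<lambda>x. Atom (item_finish (a x)))"
    by (rule ptime_expr[OF assms, where E = "Head (Tail (Tail (Var 0)))"]) (simp add: item_val_def request_val_def)
  show "ptime D e (\<lambda>x. Atom (item_weight (a x)))"
    by (rule ptime_expr[OF assms, where E = "Head (Tail (Tail (Tail (Var 0))))"]) (simp add: item_val_def request_val_def)
  show "ptime D e (\<lambda>x. Atom (item_dur (a x)))"
    unfolding duration_def by (rule ptime_diff[OF f s])
qed

lemma ptime_same_index:
  assumes "ptime D e (\<lambda>x. item_val (a x))" "ptime D e (\<lambda>x. item_val (b x))"
  shows "ptime D e (\<lambda>x. truth (fst (a x) = fst (b x)))"
  using ptime_eq[OF ptime_item(1)[OF assms(1)] ptime_item(1)[OF assms(2)]] by simp

lemma ptime_active: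
  assumes "ptime D e (\<lambda>x. item_val (a x))" "ptime D e (\<lambda>x. Atom (t x))"
  shows "ptime D e (\<lambda>x. truth (item_active (a x) (t x)))"
  unfolding active_def using ptime_item[OF assms(1)] assms(2) by (intro ptime_conj ptime_le ptime_less)

lemma ptime_load:
  fixes D :: "nat \<Rightarrow> 'x \<Rightarrow> bool"
  assumes xs: "ptime D e (\<lambda>x. items_val (xs x))" "pbound D (\<lambda>x. length (xs x))"
    and t: "ptime D e (\<lambda>x. Atom (t x))"
    and v: "\<And>D' e' (a :: 'x \<times> item \<times> real \<Rightarrow> item). ptime D' e' (\<lambda>y. item_val (a y)) \<Longrightarrow>
      ptime D' e' (\<lambda>y. Atom (v (a y)))"
  shows "ptime D e (\<lambda>x. Atom (load v (xs x) (t x)))"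
  unfolding load_def
proof (rule ptime_sum_list[OF xs])
  fix D' e' a and \<phi> :: "'x \<times> item \<times> real \<Rightarrow> 'x"
  assume ext: "extends D e D' e' \<phi>" and a: "ptime D' e' (\<lambda>y. item_val (a y))"
  have "ptime D' e' (\<lambda>y. if item_active (a y) (t (\<phi> y)) then Atom (v (a y)) else Atom 0)"
    by (intro ptime_if_simple ptime_active a v ptime_zero ptime_ext[OF ext t])
  then show "ptime D' e' (\<lambda>y. Atom (if item_active (a y) (t (\<phi> y)) then v (a y) else 0))"
    by (rule ptime_cong) simp
qed

lemma ptime_block_weight:
  assumes "ptime D e (\<lambda>x. item_val (a x))"
  shows "ptime D e (\<lambda>x. Atom (block_weight u (a x)))"
proof -
  note w = ptime_item(4)[OF assms]
  have 2: "ptime D e (\<lambda>x. Atom (2 * item_weight (a x)))" using ptime_times_const[OF w, of 2] by simp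
  have 4: "ptime D e (\<lambda>x. Atom (4 * item_weight (a x)))" using ptime_times_const[OF w, of 4] by simp
  have 8: "ptime D e (\<lambda>x. Atom (8 * item_weight (a x)))" using ptime_times_const[OF w, of 8] by simp
  have "ptime D e (\<lambda>x. if 4 * item_weight (a x) \<le> 1 then Atom (8 * item_weight (a x)) else Atom 2)"
    by (intro ptime_if_simple ptime_le ptime_one ptime_numeral 4 8)
  then have "ptime D e (\<lambda>x. Atom (if 4 * item_weight (a x) \<le> 1 then 8 * item_weight (a x) else 2))"
    by (rule ptime_cong) simp
  with 2 show ?thesis unfolding block_weight_def by (cases u) simp_all
qed

lemma ptime_fits:
  assumes "ptime D e (\<lambda>x. items_val (g x))" "pbound D (\<lambda>x. length (g x))" "ptime D e (\<lambda>x. item_val (i x))"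
  shows "ptime D e (\<lambda>x. truth (fits (g x) (i x)))"
  unfolding fits_def
  by (intro ptime_le ptime_add ptime_load assms ptime_item ptime_one)

section \<open>Programs for the layered machines\<close>

lemma length_le_concat: "g \<in> set gs \<Longrightarrow> length g \<le> length (concat gs)"
  by (induction gs) auto

lemma length_groups_le: "[] \<notin> set gs \<Longrightarrow> length gs \<le> length (concat gs)"
proof (induction gs)
  case (Cons g gs)
  then have "0 < length g" "length gs \<le> length (concat gs)" by auto
  then show ?case unfolding concat.simps length_append list.size by linarith
qed simp

lemma ptime_place:
  fixes D :: "nat \<Rightarrow> 'x \<Rightarrow> bool"
  assumes i: "ptime D e (\<lambda>x. item_val (i x))"
    and gs: "ptime D e (\<lambda>x. groups_val (gs x))" "pbound D (\<lambda>x. length (gs x))" "pbound D (\<lambda>x. length (concat (gs x)))"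
  shows "ptime D e (\<lambda>x. groups_val (place (i x) (gs x)))"
proof -
  let ?eb = "\<lambda>s. Cell (truth (fst s)) (groups_val (snd s))"
  have fold: "ptime D e (\<lambda>x. ?eb (fold (place_step (i x)) (gs x) (False, [])))"
  proof (rule ptime_fold[where f = "\<lambda>x. place_step (i x)" and eb = ?eb, OF gs(1,2)])
    show "ptime D e (\<lambda>x. ?eb (False, []))" by (simp add: truth_def ptime_Cell ptime_Null)
  next
    fix D' e' a b and \<phi> :: "'x \<times> item list \<times> bool \<times> item list list \<Rightarrow> 'x"
    assume ext: "extends D e D' e' \<phi>" and a: "ptime D' e' (\<lambda>y. items_val (a y))"
      and b: "ptime D' e' (\<lambda>y. ?eb (b y))"
      and mem: "\<And>n y. D' n y \<Longrightarrow> \<exists>ys zs. gs (\<phi> y) = ys @ a y # zs \<and>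
        b y = fold (place_step (i (\<phi> y))) ys (False, [])"
    have p: "ptime D' e' (\<lambda>y. truth (fst (b y)))" by (rule ptime_Head[OF b]) simp
    have out: "ptime D' e' (\<lambda>y. groups_val (snd (b y)))" by (rule ptime_Tail[OF b]) simp
    note i' = ptime_ext[OF ext i]
    have la: "pbound D' (\<lambda>y. length (a y))"
      using pbound_ext[OF ext gs(3)] by (rule pbound_mono) (use mem in \<open>fastforce intro: length_le_concat\<close>)
    have "ptime D' e' (\<lambda>y. truth True)" unfolding truth_def by (simp add: ptime_Cell ptime_Null)
    then have "ptime D' e' (\<lambda>y. if \<not> fst (b y) \<and> fits (a y) (i (\<phi> y))
        then Cell (truth True) (Cell (Cell (item_val (i (\<phi> y))) (items_val (a y))) (groups_val (snd (b y))))
        else Cell (truth (fst (b y))) (Cell (items_val (a y)) (groups_val (snd (b y)))))"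
      by (intro ptime_if_simple ptime_conj ptime_not ptime_fits ptime_Cell p out i' a la)
    then show "ptime D' e' (\<lambda>y. ?eb (place_step (i (\<phi> y)) (a y) (b y)))"
      by (rule ptime_cong) (simp add: place_step_def)
  qed
  have "ptime D e (\<lambda>x. truth (fst (fold (place_step (i x)) (gs x) (False, []))))"
    by (rule ptime_Head[OF fold]) simp
  moreover have "ptime D e (\<lambda>x. groups_val (snd (fold (place_step (i x)) (gs x) (False, []))))"
    by (rule ptime_Tail[OF fold]) simp
  ultimately have "ptime D e (\<lambda>x. if fst (fold (place_step (i x)) (gs x) (False, []))
      then groups_val (snd (fold (place_step (i x)) (gs x) (False, [])))
      else Cell (Cell (item_val (i x)) Null) (groups_val (snd (fold (place_step (i x)) (gs x) (False, [])))))"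
    by (intro ptime_if_simple ptime_Cell i ptime_Null)
  then show ?thesis by (rule ptime_cong) (simp add: place_def Let_def)
qed

lemma length_concat_any_fit: "length (concat (any_fit xs)) = length xs"
  by (rule mset_eq_length[OF mset_concat_any_fit])

lemma length_any_fit: "length (any_fit xs) \<le> length xs"
  using length_groups_le[OF any_fit_not_Nil[of xs]] length_concat_any_fit[of xs] by simp

lemma ptime_any_fit:
  fixes D :: "nat \<Rightarrow> 'x \<Rightarrow> bool"
  assumes xs: "ptime D e (\<lambda>x. items_val (xs x))" and len: "pbound D (\<lambda>x. length (xs x))"
  shows "ptime D e (\<lambda>x. groups_val (any_fit (xs x)))"
  unfolding any_fit_def
proof (rule ptime_fold[where f = "\<lambda>_. place" and eb = groups_val, OF xs len])
  show "ptime D e (\<lambda>x. groups_val [])" by (simp add: ptime_Null)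
next
  fix D' e' a b and \<phi> :: "'x \<times> item \<times> item list list \<Rightarrow> 'x"
  assume ext: "extends D e D' e' \<phi>" and a: "ptime D' e' (\<lambda>y. item_val (a y))"
    and b: "ptime D' e' (\<lambda>y. groups_val (b y))"
    and mem: "\<And>n y. D' n y \<Longrightarrow> \<exists>ys zs. xs (\<phi> y) = ys @ a y # zs \<and> b y = fold place ys []"
  have size: "length (b y) \<le> length (xs (\<phi> y)) \<and> length (concat (b y)) \<le> length (xs (\<phi> y))" if D: "D' n y" for n y
  proof -
    from mem[OF D] obtain ys zs where "xs (\<phi> y) = ys @ a y # zs" "b y = any_fit ys" unfolding any_fit_def by blast
    with length_any_fit[of ys] length_concat_any_fit[of ys] show ?thesis by simp
  qed
  have "pbound D' (\<lambda>y. length (b y))" "pbound D' (\<lambda>y. length (concat (b y)))"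
    using pbound_ext[OF ext len] by (rule pbound_mono, use size in blast)+
  then show "ptime D' e' (\<lambda>y. groups_val (place (a y) (b y)))"
    by (intro ptime_place a b)
qed

lemma ptime_remove_item:
  assumes "ptime D e (\<lambda>x. item_val (i x))" "ptime D e (\<lambda>x. items_val (xs x))" "pbound D (\<lambda>x. length (xs x))"
  shows "ptime D e (\<lambda>x. items_val (remove_item (i x) (xs x)))"
  unfolding remove_item_def
  by (rule ptime_filter[OF assms(2,3)]) (intro ptime_not ptime_same_index ptime_ext[OF _ assms(1)])

lemma ptime_covers:
  fixes D :: "nat \<Rightarrow> 'x \<Rightarrow> bool"
  assumes c: "ptime D e (\<lambda>x. Atom (c x))"
    and R: "ptime D e (\<lambda>x. items_val (R x))" "pbound D (\<lambda>x. length (R x))"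
    and Q: "ptime D e (\<lambda>x. items_val (Q x))" "pbound D (\<lambda>x. length (Q x))"
  shows "ptime D e (\<lambda>x. truth (covers (block_weight u) (c x) (R x) (Q x)))"
  unfolding covers_def covers_at_def
proof (rule ptime_all[OF R])
  fix D' e' a and \<phi> :: "'x \<times> item \<times> bool \<Rightarrow> 'x"
  assume ext: "extends D e D' e' \<phi>" and a: "ptime D' e' (\<lambda>y. item_val (a y))"
  show "ptime D' e' (\<lambda>y. truth
      ((c (\<phi> y) \<le> load (block_weight u) (Q (\<phi> y)) (item_start (a y)) \<or>
        load (block_weight u) (R (\<phi> y)) (item_start (a y)) \<le> load (block_weight u) (Q (\<phi> y)) (item_start (a y))) \<and>
       (c (\<phi> y) \<le> load (block_weight u) (Q (\<phi> y)) (item_finish (a y)) \<or>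
        load (block_weight u) (R (\<phi> y)) (item_finish (a y)) \<le> load (block_weight u) (Q (\<phi> y)) (item_finish (a y)))))"
    by (intro ptime_conj ptime_disj ptime_le ptime_load ptime_block_weight ptime_item(2,3)[OF a]
        ptime_ext[OF ext c] ptime_ext[OF ext R(1)] ptime_ext[OF ext Q(1)] pbound_ext[OF ext R(2)] pbound_ext[OF ext Q(2)])
qed

lemma length_prune: "length (prune v c R) \<le> length R"
  using prune_filter[of v c R] by auto

lemma ptime_prune:
  fixes D :: "nat \<Rightarrow> 'x \<Rightarrow> bool"
  assumes c: "ptime D e (\<lambda>x. Atom (c x))"
    and R: "ptime D e (\<lambda>x. items_val (R x))" "pbound D (\<lambda>x. length (R x))"
  shows "ptime D e (\<lambda>x. items_val (prune (block_weight u) (c x) (R x)))"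
  unfolding prune_def
proof (rule ptime_fold[where f = "\<lambda>x. prune_step (block_weight u) (c x) (R x)" and eb = items_val, OF R R(1)])
  fix D' e' a b and \<phi> :: "'x \<times> item \<times> item list \<Rightarrow> 'x"
  assume ext: "extends D e D' e' \<phi>" and a: "ptime D' e' (\<lambda>y. item_val (a y))"
    and b: "ptime D' e' (\<lambda>y. items_val (b y))"
    and mem: "\<And>n y. D' n y \<Longrightarrow> \<exists>ys zs. R (\<phi> y) = ys @ a y # zs \<and>
      b y = fold (prune_step (block_weight u) (c (\<phi> y)) (R (\<phi> y))) ys (R (\<phi> y))"
  have "length (fold (prune_step v c R) ys Q) \<le> length Q" for v c R ys Q
  proof (induction ys arbitrary: Q)
    case (Cons z ys)
    have "length (prune_step v c R z Q) \<le> length Q" by (simp add: prune_step_def remove_item_def)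
    with Cons[of "prune_step v c R z Q"] show ?case by simp
  qed simp
  then have "length (b y) \<le> length (R (\<phi> y))" if "D' n y" for n y using mem[OF that] by metis
  then have lb: "pbound D' (\<lambda>y. length (b y))" by (rule pbound_mono[OF pbound_ext[OF ext R(2)]])
  then have lr: "pbound D' (\<lambda>y. length (remove_item (a y) (b y)))"
    by (rule pbound_mono) (simp add: remove_item_def)
  have "ptime D' e' (\<lambda>y. if covers (block_weight u) (c (\<phi> y)) (R (\<phi> y)) (remove_item (a y) (b y))
      then items_val (remove_item (a y) (b y)) else items_val (b y))"
    by (intro ptime_if_simple ptime_covers ptime_remove_item a b lb lr ptime_ext[OF ext c] ptime_ext[OF ext R(1)]
        pbound_ext[OF ext R(2)])
  then show "ptime D' e' (\<lambda>y. items_val (prune_step (block_weight u) (c (\<phi> y)) (R (\<phi> y)) (a y) (b y)))"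
    by (rule ptime_cong) (simp add: prune_step_def)
qed

lemma ptime_remove_items:
  fixes D :: "nat \<Rightarrow> 'x \<Rightarrow> bool"
  assumes Q: "ptime D e (\<lambda>x. items_val (Q x))" "pbound D (\<lambda>x. length (Q x))"
    and R: "ptime D e (\<lambda>x. items_val (R x))" "pbound D (\<lambda>x. length (R x))"
  shows "ptime D e (\<lambda>x. items_val (remove_items (Q x) (R x)))"
  unfolding remove_items_def
proof (rule ptime_filter[OF R], rule ptime_not)
  fix D' e' a and \<phi> :: "'x \<times> item \<times> item list \<Rightarrow> 'x"
  assume ext: "extends D e D' e' \<phi>" and a: "ptime D' e' (\<lambda>y. item_val (a y))"
  show "ptime D' e' (\<lambda>y. truth (\<exists>z\<in>set (Q (\<phi> y)). fst z = fst (a y)))"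
    by (rule ptime_ex[OF ptime_ext[OF ext Q(1)] pbound_ext[OF ext Q(2)]])
      (intro ptime_same_index ptime_ext[OF _ a])
qed

lemma length_fold_peel_step:
  "length (fst (fold (\<lambda>_. peel_step sel pack) ys s)) \<le> length (fst s)"
proof (induction ys arbitrary: s)
  case (Cons y ys)
  have "length (fst (peel_step sel pack s)) \<le> length (fst s)"
    by (simp add: peel_step_def remove_items_def)
  with Cons[of "peel_step sel pack s"] show ?case by simp
qed simp

text \<open>\<open>sel\<close> may depend on the outer index because the threshold of the layers and
  the list representing \<open>m\<close> vary with the input. \<open>len_pack\<close> bounds the
  list over which the concatenation iterates.\<close>

lemma ptime_peel_groups:
  fixes D :: "nat \<Rightarrow> 'x \<Rightarrow> bool"
  assumes xs: "ptime D e (\<lambda>x. items_val (xs x))" "pbound D (\<lambda>x. length (xs x))"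
    and sel: "\<And>D' e' R (\<phi> :: 'x \<times> item \<times> item list \<times> item list list \<Rightarrow> 'x). extends D e D' e' \<phi> \<Longrightarrow>
      ptime D' e' (\<lambda>y. items_val (R y)) \<Longrightarrow> pbound D' (\<lambda>y. length (R y)) \<Longrightarrow>
      ptime D' e' (\<lambda>y. items_val (sel (\<phi> y) (R y)))" "\<And>x R. length (sel x R) \<le> length R"
    and pack: "\<And>D' e' R (\<phi> :: 'x \<times> item \<times> item list \<times> item list list \<Rightarrow> 'x). extends D e D' e' \<phi> \<Longrightarrow>
      ptime D' e' (\<lambda>y. items_val (R y)) \<Longrightarrow> pbound D' (\<lambda>y. length (R y)) \<Longrightarrow>
      ptime D' e' (\<lambda>y. groups_val (pack (R y)))"
    and len_pack: "\<And>R. length (pack R) \<le> a * length R"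
  shows "ptime D e (\<lambda>x. groups_val (peel_groups (sel x) pack (xs x)))"
proof -
  let ?eb = "\<lambda>s. Cell (items_val (fst s)) (groups_val (snd s))"
  have "ptime D e (\<lambda>x. ?eb (fold (\<lambda>_. peel_step (sel x) pack) (xs x) (xs x, [])))"
  proof (rule ptime_fold[where f = "\<lambda>x _. peel_step (sel x) pack" and eb = ?eb, OF xs])
    show "ptime D e (\<lambda>x. ?eb (xs x, []))" using xs(1) by (simp add: ptime_Cell ptime_Null)
  next
    fix D' e' a' b and \<phi> :: "'x \<times> item \<times> item list \<times> item list list \<Rightarrow> 'x"
    assume ext: "extends D e D' e' \<phi>" and b: "ptime D' e' (\<lambda>y. ?eb (b y))"
      and mem: "\<And>n y. D' n y \<Longrightarrow> \<exists>ys zs. xs (\<phi> y) = ys @ a' y # zs \<and>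
        b y = fold (\<lambda>_. peel_step (sel (\<phi> y)) pack) ys (xs (\<phi> y), [])"
    have R: "ptime D' e' (\<lambda>y. items_val (fst (b y)))" by (rule ptime_Head[OF b]) simp
    have acc: "ptime D' e' (\<lambda>y. groups_val (snd (b y)))" by (rule ptime_Tail[OF b]) simp
    have "length (fst (b y)) \<le> length (xs (\<phi> y))" if "D' n y" for n y
      using mem[OF that] length_fold_peel_step[of "sel (\<phi> y)" pack _ "(xs (\<phi> y), [])"] by auto
    then have lR: "pbound D' (\<lambda>y. length (fst (b y)))"
      by (rule pbound_mono[OF pbound_ext[OF ext xs(2)]])
    let ?S = "\<lambda>y. sel (\<phi> y) (fst (b y))"
    have S: "ptime D' e' (\<lambda>y. items_val (?S y))" by (rule sel(1)[OF ext R lR])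
    have lS: "pbound D' (\<lambda>y. length (?S y))" using lR by (rule pbound_mono) (rule sel(2))
    have "pbound D' (\<lambda>y. length (?S y) * a)"
    proof -
      obtain p where "poly_bounded p" "\<And>n y. D' n y \<Longrightarrow> length (?S y) \<le> p n" using lS unfolding pbound_def by blast
      then show ?thesis unfolding pbound_def
        by (intro exI[of _ "\<lambda>n. p n * a"]) (auto intro!: poly_bounded_mult poly_bounded_const mult_le_mono1)
    qed
    then have lP: "pbound D' (\<lambda>y. length (pack (?S y)))"
      by (rule pbound_mono) (metis len_pack mult.commute)
    have "ptime D' e' (\<lambda>y. Cell (items_val (remove_items (?S y) (fst (b y)))) (groups_val (pack (?S y) @ snd (b y))))"
      by (intro ptime_Cell ptime_remove_items ptime_append S lS R lR pack[OF ext] lP acc)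
    then show "ptime D' e' (\<lambda>y. ?eb (peel_step (sel (\<phi> y)) pack (b y)))"
      by (simp add: peel_step_def)
  qed
  then show ?thesis unfolding peel_groups_def by (rule ptime_Tail) simp
qed

lemma ptime_layers:
  fixes D :: "nat \<Rightarrow> 'x \<Rightarrow> bool"
  assumes c: "ptime D e (\<lambda>x. Atom (c x))"
    and L: "ptime D e (\<lambda>x. items_val (L x))" "pbound D (\<lambda>x. length (L x))"
  shows "ptime D e (\<lambda>x. groups_val (layers u (c x) (L x)))"
  unfolding layers_def
proof (rule ptime_peel_groups[OF L _ length_prune, where a = 1])
  show "length (any_fit R) \<le> 1 * length R" for R using length_any_fit by simp
qed (auto intro: ptime_prune ptime_any_fit ptime_ext[OF _ c])

section \<open>Programs for the harmonic machines\<close>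

lemma pbound_Suc: "pbound D f \<Longrightarrow> pbound D (\<lambda>x. Suc (f x))"
  using pbound_add[OF _ pbound_const[of D 1]] by simp

lemma ptime_nf_step:
  fixes D :: "nat \<Rightarrow> 'x \<Rightarrow> bool"
  assumes i: "ptime D e (\<lambda>x. item_val (i x))"
    and gs: "ptime D e (\<lambda>x. groups_val (gs x))" "pbound D (\<lambda>x. length (concat (gs x)))"
  shows "ptime D e (\<lambda>x. groups_val (nf_step (i x) (gs x)))"
proof -
  have "ptime D e (\<lambda>x. if gs x = [] then Cell (Cell (item_val (i x)) Null) Null
     else if sum_list (map item_weight (hd (gs x))) + item_weight (i x) \<le> 1
       then Cell (Cell (item_val (i x)) (items_val (hd (gs x)))) (groups_val (tl (gs x)))
       else Cell (Cell (item_val (i x)) Null) (groups_val (gs x)))"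
  proof (rule ptime_if[OF ptime_is_Nil[OF gs(1)]])
    fix D' assume ext: "extends D e D' e (\<lambda>x. x)"
    show "ptime D' e (\<lambda>x. Cell (Cell (item_val (i x)) Null) Null)"
      by (intro ptime_Cell ptime_Null ptime_ext[OF ext i])
  next
    fix D' assume ext: "extends D e D' e (\<lambda>x. x)" and ne: "\<And>n x. D' n x \<Longrightarrow> gs x \<noteq> []"
    note gs' = ptime_ext[OF ext gs(1)] and i' = ptime_ext[OF ext i]
    have h: "ptime D' e (\<lambda>x. items_val (hd (gs x)))" by (rule ptime_hd[OF gs' ne])
    have "length (hd (gs x)) \<le> length (concat (gs x))" if "D' n x" for n x
      using ne[OF that] by (intro length_le_concat) simp
    then have lh: "pbound D' (\<lambda>x. length (hd (gs x)))"
      by (rule pbound_mono[OF pbound_ext[OF ext gs(2)]])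
    have "ptime D' e (\<lambda>x. Atom (\<Sum>y\<leftarrow>hd (gs x). item_weight y))"
      by (rule ptime_sum_list[OF h lh]) (rule ptime_item)
    then show "ptime D' e (\<lambda>x. if sum_list (map item_weight (hd (gs x))) + item_weight (i x) \<le> 1
       then Cell (Cell (item_val (i x)) (items_val (hd (gs x)))) (groups_val (tl (gs x)))
       else Cell (Cell (item_val (i x)) Null) (groups_val (gs x)))"
      by (intro ptime_if_simple ptime_le ptime_add ptime_one ptime_Cell ptime_Null ptime_item(4) h i' gs' ptime_tl[OF gs' ne])
  qed
  then show ?thesis by (rule ptime_cong) (simp add: nf_step_def)
qed

lemma mset_concat_nf_step: "mset (concat (nf_step x gs)) = add_mset x (mset (concat gs))"
  by (cases gs) (auto simp: nf_step_def)

lemma nf_step_not_Nil: "[] \<notin> set gs \<Longrightarrow> [] \<notin> set (nf_step x gs)"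
  by (cases gs) (auto simp: nf_step_def)

lemma nf_groups_snoc: "nf_groups (xs @ [x]) = nf_step x (nf_groups xs)"
  by (simp add: nf_groups_def)

lemma length_concat_nf_groups: "length (concat (nf_groups xs)) = length xs"
proof -
  have "mset (concat (nf_groups xs)) = mset xs"
    by (induction xs rule: rev_induct) (simp_all add: nf_groups_snoc mset_concat_nf_step)
  then show ?thesis by (rule mset_eq_length)
qed

lemma length_nf_groups: "length (nf_groups xs) \<le> length xs"
proof -
  have "[] \<notin> set (nf_groups xs)"
    by (induction xs rule: rev_induct) (simp_all add: nf_groups_snoc nf_step_not_Nil)
  from length_groups_le[OF this] length_concat_nf_groups[of xs] show ?thesis by simp
qed

lemma ptime_nf_groups:
  fixes D :: "nat \<Rightarrow> 'x \<Rightarrow> bool"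
  assumes xs: "ptime D e (\<lambda>x. items_val (xs x))" and len: "pbound D (\<lambda>x. length (xs x))"
  shows "ptime D e (\<lambda>x. groups_val (nf_groups (xs x)))"
  unfolding nf_groups_def
proof (rule ptime_fold[where f = "\<lambda>_. nf_step" and eb = groups_val, OF xs len])
  show "ptime D e (\<lambda>x. groups_val [])" by (simp add: ptime_Null)
next
  fix D' e' a b and \<phi> :: "'x \<times> item \<times> item list list \<Rightarrow> 'x"
  assume ext: "extends D e D' e' \<phi>" and a: "ptime D' e' (\<lambda>y. item_val (a y))"
    and b: "ptime D' e' (\<lambda>y. groups_val (b y))"
    and mem: "\<And>n y. D' n y \<Longrightarrow> \<exists>ys zs. xs (\<phi> y) = ys @ a y # zs \<and> b y = fold nf_step ys []"
  have "length (concat (b y)) \<le> length (xs (\<phi> y))" if D: "D' n y" for n y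
  proof -
    from mem[OF D] obtain ys zs where "xs (\<phi> y) = ys @ a y # zs" "b y = nf_groups ys" unfolding nf_groups_def by blast
    with length_concat_nf_groups[of ys] show ?thesis by simp
  qed
  then have "pbound D' (\<lambda>y. length (concat (b y)))" by (rule pbound_mono[OF pbound_ext[OF ext len]])
  then show "ptime D' e' (\<lambda>y. groups_val (nf_step (a y) (b y)))" by (intro ptime_nf_step a b)
qed

lemma in_harmonic_class_mult:
  assumes "1 \<le> j" "0 < k"
  shows "in_harmonic_class k j x \<longleftrightarrow> (if j < k then 1 < real (j + 1) * x \<and> real j * x \<le> 1 else 0 < x \<and> real k * x \<le> 1)"
  using assms by (auto simp: in_harmonic_class_def field_simps)

lemma ptime_in_harmonic_class:
  assumes "ptime D e (\<lambda>x. Atom (w x))" "1 \<le> j" "0 < k"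
  shows "ptime D e (\<lambda>x. truth (in_harmonic_class k j (w x)))"
proof (cases "j < k")
  case True
  have "ptime D e (\<lambda>x. truth (1 < real (j + 1) * w x \<and> real j * w x \<le> 1))"
    by (intro ptime_conj ptime_less ptime_le ptime_one ptime_times_const assms(1))
  with True show ?thesis unfolding in_harmonic_class_mult[OF assms(2,3)] by simp
next
  case False
  have "ptime D e (\<lambda>x. truth (0 < w x \<and> real k * w x \<le> 1))"
    by (intro ptime_conj ptime_less ptime_le ptime_one ptime_zero ptime_times_const assms(1))
  with False show ?thesis unfolding in_harmonic_class_mult[OF assms(2,3)] by simp
qed

lemma length_harmonic_pack: "length (harmonic_pack k j Q) \<le> j * length Q"
proof (induction j)
  case (Suc j)
  have "length (nf_groups (filter (\<lambda>x. in_harmonic_class k (Suc j) (item_weight x)) Q)) \<le> length Q"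
    using length_nf_groups length_filter_le by (rule order_trans)
  with Suc show ?case by simp
qed simp

text \<open>\<open>k\<close> and \<open>j\<close> are fixed numbers, so the recursion over the
  classes is unrolled: there is one program for each \<open>k\<close>, as the theorem
  permits.\<close>

lemma ptime_harmonic_pack:
  fixes D :: "nat \<Rightarrow> 'x \<Rightarrow> bool"
  assumes Q: "ptime D e (\<lambda>x. items_val (Q x))" "pbound D (\<lambda>x. length (Q x))" and k: "0 < k"
  shows "ptime D e (\<lambda>x. groups_val (harmonic_pack k j (Q x)))"
proof (induction j)
  case 0
  show ?case by (simp add: ptime_Null)
next
  case (Suc j)
  have f: "ptime D e (\<lambda>x. items_val (filter (\<lambda>y. in_harmonic_class k (Suc j) (item_weight y)) (Q x)))"
    by (rule ptime_filter[OF Q]) (intro ptime_in_harmonic_class ptime_item k, assumption, simp)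
  have lf: "pbound D (\<lambda>x. length (filter (\<lambda>y. in_harmonic_class k (Suc j) (item_weight y)) (Q x)))"
    using Q(2) by (rule pbound_mono) simp
  have "pbound D (\<lambda>x. length (nf_groups (filter (\<lambda>y. in_harmonic_class k (Suc j) (item_weight y)) (Q x))))"
    using lf by (rule pbound_mono) (rule length_nf_groups)
  then show ?case
    unfolding harmonic_pack.simps by (intro ptime_append ptime_nf_groups f lf Suc)
qed

lemma ptime_similar:
  fixes D :: "nat \<Rightarrow> 'x \<Rightarrow> bool"
  assumes u: "ptime D e (\<lambda>x. enc_list ea (us x))" "pbound D (\<lambda>x. length (us x))"
    and R: "ptime D e (\<lambda>x. items_val (R x))" "pbound D (\<lambda>x. length (R x))"
  shows "ptime D e (\<lambda>x. items_val (similar (length (us x)) (R x)))"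
  unfolding similar_def
proof (rule ptime_filter[OF R])
  fix D' e' a and \<phi> :: "'x \<times> item \<times> item list \<Rightarrow> 'x"
  assume ext: "extends D e D' e' \<phi>" and a: "ptime D' e' (\<lambda>y. item_val (a y))"
  note u' = ptime_ext[OF ext u(1)] pbound_ext[OF ext u(2)]
  show "ptime D' e' (\<lambda>y. truth (\<forall>z\<in>set (R (\<phi> y)). real (length (us (\<phi> y))) * item_dur (a y)
      \<le> real (length (us (\<phi> y))) * item_dur z + item_dur z))"
  proof (rule ptime_all[OF ptime_ext[OF ext R(1)] pbound_ext[OF ext R(2)]])
    fix D'' e'' c and \<psi> :: "('x \<times> item \<times> item list) \<times> item \<times> bool \<Rightarrow> 'x \<times> item \<times> item list"
    assume ext2: "extends D' e' D'' e'' \<psi>" and c: "ptime D'' e'' (\<lambda>z. item_val (c z))"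
    show "ptime D'' e'' (\<lambda>z. truth (real (length (us (\<phi> (\<psi> z)))) * item_dur (a (\<psi> z))
      \<le> real (length (us (\<phi> (\<psi> z)))) * item_dur (c z) + item_dur (c z)))"
      by (intro ptime_le ptime_add ptime_times_length[OF ptime_ext[OF ext2 u'(1)] pbound_ext[OF ext2 u'(2)]]
          ptime_item(5) ptime_ext[OF ext2 a] c)
  qed
qed

lemma ptime_harmonic_machines:
  fixes D :: "nat \<Rightarrow> 'x \<Rightarrow> bool"
  assumes u: "ptime D e (\<lambda>x. enc_list ea (us x))" "pbound D (\<lambda>x. length (us x))"
    and L: "ptime D e (\<lambda>x. items_val (L x))" "pbound D (\<lambda>x. length (L x))" and k: "0 < k"
  shows "ptime D e (\<lambda>x. groups_val (harmonic_machines k (length (us x)) (L x)))"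
  unfolding harmonic_machines_def
proof (rule ptime_peel_groups[OF L, where a = k])
  show "length (similar (length (us x)) R) \<le> length R" for x R by (simp add: similar_def)
  show "length (harmonic_pack k k R) \<le> k * length R" for R by (rule length_harmonic_pack)
qed (auto intro!: ptime_harmonic_pack k intro: ptime_similar ptime_ext[OF _ u(1)] pbound_ext[OF _ u(2)])

text \<open>\<open>ok_items\<close> rules out empty groups, and so bounds the lists of groups that
  are concatenated.\<close>

lemma ptime_mixed_machines:
  fixes D :: "nat \<Rightarrow> 'x \<Rightarrow> bool"
  assumes L: "ptime D e (\<lambda>x. items_val (L x))" "pbound D (\<lambda>x. length (L x))"
    and ok: "\<And>n x. D n x \<Longrightarrow> ok_items (L x)"
  shows "ptime D e (\<lambda>x. groups_val (mixed_machines (L x)))"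
proof -
  have 3: "ptime D' e' (\<lambda>y. Atom (3 * item_weight (a y)))" and 4: "ptime D' e' (\<lambda>y. Atom (4 * item_weight (a y)))"
    if "ptime D' e' (\<lambda>y. item_val (a y))" for D' e' and a :: "'x \<times> item \<times> item list \<Rightarrow> item"
    using ptime_times_const[OF ptime_item(4)[OF that], of 3] ptime_times_const[OF ptime_item(4)[OF that], of 4] by simp_all
  have lf: "pbound D (\<lambda>x. length (filter P (L x)))" for P
    using L(2) by (rule pbound_mono) simp
  have ll: "pbound D (\<lambda>x. length (layers False 5 (filter P (L x))))" for P
    using L(2)
  proof (rule pbound_mono)
    fix n x assume "D n x"
    note lm = layers_machines[OF ok_items_filter[OF ok[OF this], of P], of 5 False]
    have "length (layers False 5 (filter P (L x))) \<le> length (concat (layers False 5 (filter P (L x))))"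
      using lm(2) by (intro length_groups_le) auto
    also have "\<dots> = length (filter P (L x))" using lm(1) by (intro mset_eq_length) simp
    finally show "length (layers False 5 (filter P (L x))) \<le> length (L x)"
      using length_filter_le order_trans by blast
  qed
  have A: "ptime D e (\<lambda>x. items_val (filter (\<lambda>x. 1 < 3 * item_weight x) (L x)))"
    by (rule ptime_filter[OF L]) (intro ptime_less ptime_one 3)
  have B: "ptime D e (\<lambda>x. items_val (filter (\<lambda>x. 3 * item_weight x \<le> 1 \<and> 1 < 4 * item_weight x) (L x)))"
    by (rule ptime_filter[OF L]) (intro ptime_conj ptime_le ptime_less ptime_one 3 4)
  have C: "ptime D e (\<lambda>x. items_val (filter (\<lambda>x. 4 * item_weight x \<le> 1) (L x)))"
    by (rule ptime_filter[OF L]) (intro ptime_le ptime_one 4)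
  show ?thesis
    unfolding mixed_machines_def by (intro ptime_append ptime_layers ptime_numeral lf ll A B C)
qed

lemma ptime_uniform_machines:
  fixes D :: "nat \<Rightarrow> 'x \<Rightarrow> bool"
  assumes L: "ptime D e (\<lambda>x. items_val (L x))" "pbound D (\<lambda>x. length (L x))"
    and ne: "\<And>n x. D n x \<Longrightarrow> L x \<noteq> []"
  shows "ptime D e (\<lambda>x. groups_val (uniform_machines (L x)))"
  unfolding uniform_machines_def
  by (intro ptime_layers ptime_diff ptime_numeral ptime_item(4) ptime_hd[OF L(1) ne] L)

section \<open>Programs for sorting, evaluating costs and choosing the best candidate\<close>

lemma ptime_insert_item:
  fixes D :: "nat \<Rightarrow> 'x \<Rightarrow> bool"
  assumes i: "ptime D e (\<lambda>x. item_val (i x))"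
    and xs: "ptime D e (\<lambda>x. items_val (xs x))" "pbound D (\<lambda>x. length (xs x))"
  shows "ptime D e (\<lambda>x. items_val (insert_item (i x) (xs x)))"
proof -
  have "pbound D (\<lambda>x. length (filter (\<lambda>y. item_start y < item_start (i x)) (xs x)))"
    using xs(2) by (rule pbound_mono) simp
  moreover have "ptime D e (\<lambda>x. items_val (filter (\<lambda>y. item_start y < item_start (i x)) (xs x)))"
    by (rule ptime_filter[OF xs]) (intro ptime_less ptime_item(2) ptime_ext[OF _ i])
  moreover have "ptime D e (\<lambda>x. items_val (filter (\<lambda>y. \<not> item_start y < item_start (i x)) (xs x)))"
    by (rule ptime_filter[OF xs]) (intro ptime_not ptime_less ptime_item(2) ptime_ext[OF _ i])
  ultimately show ?thesis
    unfolding insert_item_def by (intro ptime_append) (simp_all add: ptime_Cell i)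
qed

lemma length_sort_items: "length (sort_items xs) = length xs"
  by (rule mset_eq_length[OF mset_sort_items])

lemma ptime_sort_items:
  fixes D :: "nat \<Rightarrow> 'x \<Rightarrow> bool"
  assumes xs: "ptime D e (\<lambda>x. items_val (xs x))" "pbound D (\<lambda>x. length (xs x))"
  shows "ptime D e (\<lambda>x. items_val (sort_items (xs x)))"
  unfolding sort_items_def
proof (rule ptime_fold[where f = "\<lambda>_. insert_item" and eb = items_val, OF xs])
  show "ptime D e (\<lambda>x. items_val [])" by (simp add: ptime_Null)
next
  fix D' e' a b and \<phi> :: "'x \<times> item \<times> item list \<Rightarrow> 'x"
  assume ext: "extends D e D' e' \<phi>" and a: "ptime D' e' (\<lambda>y. item_val (a y))"
    and b: "ptime D' e' (\<lambda>y. items_val (b y))"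
    and mem: "\<And>n y. D' n y \<Longrightarrow> \<exists>ys zs. xs (\<phi> y) = ys @ a y # zs \<and> b y = fold insert_item ys []"
  have "length (b y) \<le> length (xs (\<phi> y))" if "D' n y" for n y
    using mem[OF that] length_sort_items unfolding sort_items_def by fastforce
  then have "pbound D' (\<lambda>y. length (b y))" by (rule pbound_mono[OF pbound_ext[OF ext xs(2)]])
  then show "ptime D' e' (\<lambda>y. items_val (insert_item (a y) (b y)))" by (intro ptime_insert_item a b)
qed

lemma ptime_sweep:
  fixes D :: "nat \<Rightarrow> 'x \<Rightarrow> bool"
  assumes xs: "ptime D e (\<lambda>x. items_val (xs x))" "pbound D (\<lambda>x. length (xs x))"
  shows "ptime D e (\<lambda>x. Atom (sweep (xs x)))"
proof -
  let ?eb = "\<lambda>s. Cell (Atom (fst s)) (Atom (snd s))"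
  have "pbound D (\<lambda>x. length (sort_items (xs x)))" using xs(2) by (simp add: length_sort_items)
  with ptime_sort_items[OF xs]
  have "ptime D e (\<lambda>x. ?eb (fold sweep_step (sort_items (xs x)) (0, 0)))"
  proof (rule ptime_fold[where f = "\<lambda>_. sweep_step" and eb = ?eb])
    show "ptime D e (\<lambda>x. ?eb (0, 0))" by (simp add: ptime_Cell ptime_zero)
  next
    fix D' e' a b and \<phi> :: "'x \<times> item \<times> real \<times> real \<Rightarrow> 'x"
    assume a: "ptime D' e' (\<lambda>y. item_val (a y))" and b: "ptime D' e' (\<lambda>y. ?eb (b y))"
    have f: "ptime D' e' (\<lambda>y. Atom (fst (b y)))" by (rule ptime_Head[OF b]) simp
    have s: "ptime D' e' (\<lambda>y. Atom (snd (b y)))" by (rule ptime_Tail[OF b]) simp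
    define t where "t y = (if fst (b y) < item_start (a y) then item_start (a y) else fst (b y))" for y
    have "ptime D' e' (\<lambda>y. if fst (b y) < item_start (a y) then Atom (item_start (a y)) else Atom (fst (b y)))"
      by (intro ptime_if_simple ptime_less ptime_item(2) f a)
    then have t: "ptime D' e' (\<lambda>y. Atom (t y))" by (rule ptime_cong) (simp add: t_def)
    have "ptime D' e' (\<lambda>y. if t y < item_finish (a y)
        then Cell (Atom (item_finish (a y))) (Atom (snd (b y) + (item_finish (a y) - t y)))
        else Cell (Atom (fst (b y))) (Atom (snd (b y))))"
      by (intro ptime_if_simple ptime_less ptime_Cell ptime_add ptime_diff ptime_item(3) t f s a)
    then show "ptime D' e' (\<lambda>y. ?eb (sweep_step (a y) (b y)))"
      by (rule ptime_cong) (simp add: sweep_step_def Let_def t_def)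
  qed
  then show ?thesis unfolding sweep_def by (rule ptime_Tail) simp
qed

lemma ptime_better:
  fixes D :: "nat \<Rightarrow> 'x \<Rightarrow> bool"
  assumes gs: "ptime D e (\<lambda>x. groups_val (gs x))" "pbound D (\<lambda>x. length (gs x))" "pbound D (\<lambda>x. length (concat (gs x)))"
    and hs: "ptime D e (\<lambda>x. groups_val (hs x))" "pbound D (\<lambda>x. length (hs x))" "pbound D (\<lambda>x. length (concat (hs x)))"
  shows "ptime D e (\<lambda>x. groups_val (better (gs x) (hs x)))"
proof -
  have *: "ptime D e (\<lambda>x. Atom (total_sweep (gs x)))"
    if gs: "ptime D e (\<lambda>x. groups_val (gs x))" "pbound D (\<lambda>x. length (gs x))" "pbound D (\<lambda>x. length (concat (gs x)))" for gs
    unfolding total_sweep_def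
  proof (rule ptime_sum_list[OF gs(1,2)])
    fix D' e' a and \<phi> :: "'x \<times> item list \<times> real \<Rightarrow> 'x"
    assume ext: "extends D e D' e' \<phi>" and a: "ptime D' e' (\<lambda>y. items_val (a y))"
      and mem: "\<And>n y. D' n y \<Longrightarrow> a y \<in> set (gs (\<phi> y))"
    have "pbound D' (\<lambda>y. length (a y))"
      using pbound_ext[OF ext gs(3)] by (rule pbound_mono) (rule length_le_concat[OF mem])
    with a show "ptime D' e' (\<lambda>y. Atom (sweep (a y)))" by (rule ptime_sweep)
  qed
  have "ptime D e (\<lambda>x. if total_sweep (hs x) < total_sweep (gs x) then groups_val (hs x) else groups_val (gs x))"
    by (intro ptime_if_simple ptime_less * gs hs)
  then show ?thesis by (rule ptime_cong) (simp add: better_def)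
qed

lemma valid_machines_length:
  assumes "valid_machines L gs"
  shows "length gs \<le> length L" "length (concat gs) \<le> length L"
proof -
  have eq: "length (concat gs) = length L" using assms unfolding valid_machines_def by (intro mset_eq_length) simp
  then show "length (concat gs) \<le> length L" by simp
  show "length gs \<le> length L" using length_groups_le[of gs] assms eq unfolding valid_machines_def by auto
qed

lemma valid_machines_mixed: "ok_items L \<Longrightarrow> valid_machines L (mixed_machines L)"
  unfolding valid_machines_def by (intro conjI mixed_machines)

lemma valid_machines_uniform: "ok_items L \<Longrightarrow> L \<noteq> [] \<Longrightarrow> valid_machines L (uniform_machines L)"
  unfolding valid_machines_def by (intro conjI uniform_machines)

lemma valid_machines_harmonic: "ok_items L \<Longrightarrow> 1 \<le> k \<Longrightarrow> valid_machines L (harmonic_machines k m L)"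
  unfolding valid_machines_def by (intro conjI harmonic_machines)

lemma ptime_two_approx_machines:
  fixes D :: "nat \<Rightarrow> 'x \<Rightarrow> bool"
  assumes L: "ptime D e (\<lambda>x. items_val (L x))" "pbound D (\<lambda>x. length (L x))"
    and ok: "\<And>n x. D n x \<Longrightarrow> ok_items (L x) \<and> L x \<noteq> []"
  shows "ptime D e (\<lambda>x. groups_val (two_approx_machines (L x)))"
proof -
  have m: "valid_machines (L x) (mixed_machines (L x))" and u: "valid_machines (L x) (uniform_machines (L x))"
    if "D n x" for n x
    using ok[OF that] valid_machines_mixed valid_machines_uniform by blast+
  note len = pbound_mono[OF L(2) valid_machines_length(1)] pbound_mono[OF L(2) valid_machines_length(2)]
  have "ptime D e (\<lambda>x. groups_val (mixed_machines (L x)))"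
    by (rule ptime_mixed_machines[OF L]) (use ok in blast)
  moreover have "ptime D e (\<lambda>x. groups_val (uniform_machines (L x)))"
    by (rule ptime_uniform_machines[OF L]) (use ok in blast)
  ultimately show ?thesis
    unfolding two_approx_machines_def by (intro ptime_better len[OF m] len[OF u])
qed

text \<open>The current best is always a valid grouping of the same items, so its size stays bounded
  however many candidates have been compared.\<close>

lemma ptime_best_machines:
  fixes D :: "nat \<Rightarrow> 'x \<Rightarrow> bool"
  assumes L: "ptime D e (\<lambda>x. items_val (L x))" "pbound D (\<lambda>x. length (L x))"
    and ok: "\<And>n x. D n x \<Longrightarrow> ok_items (L x)" and k: "1 \<le> k"
  shows "ptime D e (\<lambda>x. groups_val (best_machines k (L x)))"
proof -
  let ?eb = "\<lambda>s. Cell (items_val (fst s)) (groups_val (snd s))"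
  have "ptime D e (\<lambda>x. ?eb (fold (best_step k (L x)) (L x) ([], mixed_machines (L x))))"
  proof (rule ptime_fold[where f = "\<lambda>x. best_step k (L x)" and eb = ?eb, OF L])
    show "ptime D e (\<lambda>x. ?eb ([], mixed_machines (L x)))"
      using ptime_mixed_machines[OF L ok] by (simp add: ptime_Cell ptime_Null)
  next
    fix D' e' a b and \<phi> :: "'x \<times> item \<times> item list \<times> item list list \<Rightarrow> 'x"
    assume ext: "extends D e D' e' \<phi>" and a: "ptime D' e' (\<lambda>y. item_val (a y))" and b: "ptime D' e' (\<lambda>y. ?eb (b y))"
      and mem: "\<And>n y. D' n y \<Longrightarrow> \<exists>ys zs. L (\<phi> y) = ys @ a y # zs \<and>
        b y = fold (best_step k (L (\<phi> y))) ys ([], mixed_machines (L (\<phi> y)))"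
    note L' = ptime_ext[OF ext L(1)] pbound_ext[OF ext L(2)]
    have u: "ptime D' e' (\<lambda>y. items_val (a y # fst (b y)))"
      using ptime_Cell[OF a ptime_Head[OF b, of "\<lambda>y. items_val (fst (b y))"]] by simp
    have g: "ptime D' e' (\<lambda>y. groups_val (snd (b y)))" by (rule ptime_Tail[OF b]) simp
    have inv: "length (fst (b y)) \<le> length (L (\<phi> y)) \<and> valid_machines (L (\<phi> y)) (snd (b y))" if D: "D' n y" for n y
    proof -
      from mem[OF D] obtain ys zs where ys: "L (\<phi> y) = ys @ a y # zs"
        "b y = fold (best_step k (L (\<phi> y))) ys ([], mixed_machines (L (\<phi> y)))" by blast
      have "ok_items (L (\<phi> y))" by (rule ok[OF dom_ext[OF ext D]])
      then have "valid_machines (L (\<phi> y)) (snd (b y))"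
        using fold_best_step(4)[of k "L (\<phi> y)" ys] valid_machines_mixed valid_machines_harmonic[OF _ k]
        unfolding ys(2)[symmetric] by metis
      moreover have "length (fst (b y)) = length ys" unfolding ys(2) by (rule fold_best_step(1))
      ultimately show ?thesis using arg_cong[OF ys(1), of length] by simp
    qed
    have lu: "pbound D' (\<lambda>y. length (a y # fst (b y)))"
      using pbound_Suc[OF L'(2)] by (rule pbound_mono) (use inv in simp)
    have h: "ptime D' e' (\<lambda>y. groups_val (harmonic_machines k (length (a y # fst (b y))) (L (\<phi> y))))"
      using k by (intro ptime_harmonic_machines[OF u lu] L') simp
    have vg: "valid_machines (L (\<phi> y)) (snd (b y))" if "D' n y" for n y using inv[OF that] by blast
    have vh: "valid_machines (L (\<phi> y)) (harmonic_machines k (length (a y # fst (b y))) (L (\<phi> y)))" if "D' n y" for n y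
      by (rule valid_machines_harmonic[OF ok[OF dom_ext[OF ext that]] k])
    note len = pbound_mono[OF L'(2) valid_machines_length(1)] pbound_mono[OF L'(2) valid_machines_length(2)]
    show "ptime D' e' (\<lambda>y. ?eb (best_step k (L (\<phi> y)) (a y) (b y)))"
      unfolding best_step_def fst_conv snd_conv
      by (intro ptime_Cell u ptime_better g h len[OF vg] len[OF vh])
  qed
  then show ?thesis unfolding best_machines_def by (rule ptime_Tail) simp
qed

text \<open>The length of the accumulator is the next index, so no counter has to be carried
  along.\<close>

lemma items_fold: "items I = rev (fold (\<lambda>r acc. (length acc, r) # acc) I [])"
proof -
  have "fold (\<lambda>r acc. (length acc, r) # acc) I acc = rev (List.enumerate (length acc) I) @ acc"
    for acc :: "item list"
    by (induction I arbitrary: acc) auto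
  then show ?thesis by (simp add: items_def)
qed

lemma ptime_items:
  fixes D :: "nat \<Rightarrow> 'x \<Rightarrow> bool"
  assumes I: "ptime D e (\<lambda>x. enc_list request_val (I x))" "pbound D (\<lambda>x. length (I x))"
  shows "ptime D e (\<lambda>x. items_val (items (I x)))"
proof -
  let ?f = "\<lambda>r acc. (length acc, r) # acc :: item list"
  have len: "length (fold ?f I acc) = length I + length acc" for I acc
    by (induction I arbitrary: acc) auto
  have "ptime D e (\<lambda>x. items_val (fold ?f (I x) []))"
  proof (rule ptime_fold[where f = "\<lambda>_. ?f" and eb = items_val, OF I])
    show "ptime D e (\<lambda>x. items_val [])" by (simp add: ptime_Null)
  next
    fix D' e' a b and \<phi> :: "'x \<times> request \<times> item list \<Rightarrow> 'x"
    assume ext: "extends D e D' e' \<phi>" and a: "ptime D' e' (\<lambda>y. request_val (a y))"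
      and b: "ptime D' e' (\<lambda>y. items_val (b y))"
      and mem: "\<And>n y. D' n y \<Longrightarrow> \<exists>ys zs. I (\<phi> y) = ys @ a y # zs \<and> b y = fold ?f ys []"
    have "length (b y) \<le> length (I (\<phi> y))" if "D' n y" for n y
      using mem[OF that] len by fastforce
    then have "pbound D' (\<lambda>y. length (b y))" by (rule pbound_mono[OF pbound_ext[OF ext I(2)]])
    from ptime_times_length[OF b this ptime_one] have "ptime D' e' (\<lambda>y. Atom (real (length (b y))))" by simp
    then show "ptime D' e' (\<lambda>y. items_val ((length (b y), a y) # b y))"
      using a b by (simp add: item_val_def ptime_Cell)
  qed
  moreover have "pbound D (\<lambda>x. length (fold ?f (I x) []))" using I(2) by (simp add: len)
  ultimately show ?thesis unfolding items_fold by (rule ptime_rev)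
qed

text \<open>The flag freezes the counter after the first hit, since a fold runs through all
  groups.\<close>

definition position_step :: "nat \<Rightarrow> item list \<Rightarrow> bool \<times> nat \<Rightarrow> bool \<times> nat" where
  "position_step i g s = (if fst s \<or> (\<exists>x\<in>set g. fst x = i) then (True, snd s) else (False, Suc (snd s)))"

lemma position_fold: "position i gs = snd (fold (position_step i) gs (False, 0))"
proof -
  have found: "fold (position_step i) gs (True, n) = (True, n)" for gs n
    by (induction gs) (auto simp: position_step_def)
  have "snd (fold (position_step i) gs (False, n)) = n + position i gs" for n
  proof (induction gs arbitrary: n)
    case (Cons g gs)
    show ?case
    proof (cases "\<exists>x\<in>set g. fst x = i")
      case True
      then have "position_step i g (False, n) = (True, n)" "position i (g # gs) = 0"
        by (simp_all add: position_step_def position_def)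
      then show ?thesis by (simp add: found)
    next
      case False
      then show ?thesis using Cons by (auto simp: position_step_def position_def)
    qed
  qed (simp add: position_def)
  then show ?thesis by simp
qed

lemma ptime_position:
  fixes D :: "nat \<Rightarrow> 'x \<Rightarrow> bool"
  assumes i: "ptime D e (\<lambda>x. item_val (i x))"
    and gs: "ptime D e (\<lambda>x. groups_val (gs x))" "pbound D (\<lambda>x. length (gs x))" "pbound D (\<lambda>x. length (concat (gs x)))"
  shows "ptime D e (\<lambda>x. Atom (real (position (fst (i x)) (gs x))))"
proof -
  let ?eb = "\<lambda>s. Cell (truth (fst s)) (Atom (real (snd s)))"
  have "ptime D e (\<lambda>x. ?eb (fold (position_step (fst (i x))) (gs x) (False, 0)))"
  proof (rule ptime_fold[where f = "\<lambda>x. position_step (fst (i x))" and eb = ?eb, OF gs(1,2)])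
    show "ptime D e (\<lambda>x. ?eb (False, 0))" by (simp add: truth_def ptime_Cell ptime_Null ptime_zero)
  next
    fix D' e' a b and \<phi> :: "'x \<times> item list \<times> bool \<times> nat \<Rightarrow> 'x"
    assume ext: "extends D e D' e' \<phi>" and a: "ptime D' e' (\<lambda>y. items_val (a y))" and b: "ptime D' e' (\<lambda>y. ?eb (b y))"
      and mem: "\<And>n y. D' n y \<Longrightarrow> \<exists>ys zs. gs (\<phi> y) = ys @ a y # zs \<and>
        b y = fold (position_step (fst (i (\<phi> y)))) ys (False, 0)"
    have f: "ptime D' e' (\<lambda>y. truth (fst (b y)))" by (rule ptime_Head[OF b]) simp
    have s: "ptime D' e' (\<lambda>y. Atom (real (snd (b y))))" by (rule ptime_Tail[OF b]) simp
    have "a y \<in> set (gs (\<phi> y))" if "D' n y" for n y using mem[OF that] by auto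
    then have "length (a y) \<le> length (concat (gs (\<phi> y)))" if "D' n y" for n y
      using length_le_concat that by blast
    then have la: "pbound D' (\<lambda>y. length (a y))" by (rule pbound_mono[OF pbound_ext[OF ext gs(3)]])
    have "ptime D' e' (\<lambda>y. truth (\<exists>x\<in>set (a y). fst x = fst (i (\<phi> y))))"
      by (rule ptime_ex[OF a la]) (intro ptime_same_index ptime_ext[OF _ ptime_ext[OF ext i]])
    then have "ptime D' e' (\<lambda>y. if fst (b y) \<or> (\<exists>x\<in>set (a y). fst x = fst (i (\<phi> y)))
        then Cell (Cell Null Null) (Atom (real (snd (b y)))) else Cell Null (Atom (real (snd (b y)) + 1)))"
      by (intro ptime_if_simple ptime_disj ptime_Cell ptime_Null ptime_add ptime_one f s)
    then show "ptime D' e' (\<lambda>y. ?eb (position_step (fst (i (\<phi> y))) (a y) (b y)))"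
      by (rule ptime_cong) (auto simp: position_step_def truth_def)
  qed
  then show ?thesis unfolding position_fold by (rule ptime_Tail) simp
qed

definition instance_dom :: "nat \<Rightarrow> request list \<Rightarrow> bool" where
  "instance_dom n I \<longleftrightarrow> n = length I \<and> (\<exists>T. valid_instance T I)"

text \<open>The last stage common to both algorithms: groups are formed from the sorted items, but
  machine numbers are looked up in the original order of the instance.\<close>

lemma computes_schedule:
  assumes "ptime instance_dom (enc_list request_val) (\<lambda>I. groups_val (f (sorted_items I)))"
    and vm: "\<And>T I. valid_instance T I \<Longrightarrow> valid_machines (sorted_items I) (f (sorted_items I))"
  shows "poly_time_scheduler (\<lambda>I. schedule_of I (f (sorted_items I)))"
proof -
  let ?D = instance_dom and ?e = "enc_list request_val"
  have len: "pbound ?D (\<lambda>I. length I)"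
    unfolding pbound_def by (rule exI[of _ "\<lambda>n. n"]) (auto simp: instance_dom_def)
  have len_items: "length (items I) = length I" for I by (simp add: items_def)
  have "pbound ?D (\<lambda>I. length (f (sorted_items I)))" "pbound ?D (\<lambda>I. length (concat (f (sorted_items I))))"
    by (rule pbound_mono[OF len], use valid_machines_length vm in
        \<open>fastforce simp: instance_dom_def length_sort_items len_items\<close>)+
  note gs = assms(1) this
  have "ptime ?D ?e (\<lambda>I. enc_list (\<lambda>m. Atom (real m)) (map (\<lambda>x. position (fst x) (f (sorted_items I))) (items I)))"
  proof (rule ptime_map[where ea = item_val])
    show "ptime ?D ?e (\<lambda>I. items_val (items I))" by (intro ptime_items ptime_self len)
    show "pbound ?D (\<lambda>I. length (items I))" using len by (simp add: len_items)
  qed (intro ptime_position ptime_ext[OF _ gs(1)] pbound_ext[OF _ gs(2)] pbound_ext[OF _ gs(3)])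
  then have "ptime ?D ?e (\<lambda>I. schedule_val (schedule_of I (f (sorted_items I))))"
    by (simp add: schedule_val_def schedule_of_def enc_list_def comp_def)
  then obtain c p where "poly_bounded p" and run: "\<And>n I. ?D n I \<Longrightarrow> runs c (?e I) (p n) (schedule_val (schedule_of I (f (sorted_items I))))"
    by (rule ptimeE) blast
  then obtain a d where p: "\<And>n. p n \<le> a * Suc n ^ d" unfolding poly_bounded_def by blast
  have "computes_in_poly_time c (\<lambda>I. schedule_of I (f (sorted_items I)))"
    unfolding computes_in_poly_time_def
  proof (rule exI[of _ "a * 2 ^ d"], rule exI[of _ d], intro allI impI)
    fix T I assume v: "valid_instance T I"
    then have "I \<noteq> []" by (force simp: valid_instance_def)
    \<comment> \<open>Time bounds were kept in terms of \<open>Suc n\<close>, the goal has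
      \<open>length I ^ d\<close>. A valid instance is nonempty, so the shift is absorbed by the
      factor \<open>2 ^ d\<close>.\<close>
    then have n: "Suc (length I) \<le> 2 * length I" by (cases I) auto
    have "input_store I 0 = ?e I" by (simp add: input_store_def enc_list_def)
    then have "wp c (p (length I)) (\<lambda>s'. s' 0 = schedule_val (schedule_of I (f (sorted_items I))) \<and> s' 1 = input_store I 1) (input_store I)"
      using run[of "length I" I] v unfolding runs_def instance_dom_def by blast
    then obtain n s where "exec c (input_store I) n s" "n \<le> p (length I)" "s 0 = schedule_val (schedule_of I (f (sorted_items I)))"
      unfolding wp_def by blast
    moreover have "p (length I) \<le> a * 2 ^ d * length I ^ d"
    proof -
      have "a * Suc (length I) ^ d \<le> a * (2 * length I) ^ d" using n by (intro mult_le_mono2 power_mono) auto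
      with p[of "length I"] have "p (length I) \<le> a * (2 * length I) ^ d" by (rule order_trans)
      then show ?thesis by (simp only: power_mult_distrib mult.assoc)
    qed
    ultimately show "\<exists>n s. exec c (input_store I) n s \<and> s 0 = schedule_val (schedule_of I (f (sorted_items I))) \<and>
        n \<le> a * 2 ^ d * length I ^ d"
      using order_trans by blast
  qed
  moreover have "feasible I (schedule_of I (f (sorted_items I)))" if "valid_instance T I" for T I
    by (rule feasible_schedule_of[OF valid_machinesD[OF vm[OF that]]])
  ultimately show ?thesis unfolding poly_time_scheduler_def by blast
qed

lemma ptime_sorted_instance:
  "ptime instance_dom (enc_list request_val) (\<lambda>I. items_val (sorted_items I))"
  "pbound instance_dom (\<lambda>I. length (sorted_items I))"
  "instance_dom n I \<Longrightarrow> ok_items (sorted_items I) \<and> sorted_items I \<noteq> []"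
proof -
  have len: "pbound instance_dom (\<lambda>I. length I)"
    unfolding pbound_def by (rule exI[of _ "\<lambda>n. n"]) (auto simp: instance_dom_def)
  have len_items: "length (items I) = length I" for I by (simp add: items_def)
  show "ptime instance_dom (enc_list request_val) (\<lambda>I. items_val (sorted_items I))"
    using len by (intro ptime_sort_items ptime_items ptime_self) (simp_all add: len_items)
  show "pbound instance_dom (\<lambda>I. length (sorted_items I))"
    using len by (simp add: length_sort_items len_items)
  show "instance_dom n I \<Longrightarrow> ok_items (sorted_items I) \<and> sorted_items I \<noteq> []"
    using ok_items_sort_items items_ne unfolding instance_dom_def by blast
qed

lemma poly_time_two_approx: "poly_time_scheduler two_approx"
proof -
  have "poly_time_scheduler (\<lambda>I. schedule_of I (two_approx_machines (sorted_items I)))"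
    by (rule computes_schedule[OF ptime_two_approx_machines[OF ptime_sorted_instance]])
      (auto intro: valid_machines_algorithms)
  then show ?thesis unfolding two_approx_def[abs_def] .
qed

lemma poly_time_near_optimal:
  assumes "1 \<le> k"
  shows "poly_time_scheduler (near_optimal k)"
proof -
  have "poly_time_scheduler (\<lambda>I. schedule_of I (best_machines k (sorted_items I)))"
    by (rule computes_schedule[OF ptime_best_machines[OF ptime_sorted_instance(1,2) _ assms]])
      (use assms ptime_sorted_instance(3) in \<open>auto intro: valid_machines_algorithms\<close>)
  then show ?thesis unfolding near_optimal_def[abs_def] .
qed

theorem theorem1p1:
  "\<exists>C>0. \<forall>k::nat. k \<ge> 3 \<longrightarrow>
     (\<exists>A. poly_time_scheduler A \<and>
        (\<forall>T I. valid_instance T I \<longrightarrow>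
           avg_cost T I (A I) \<le> harmonic_ratio k * opt_avg T I
             + C * sqrt (opt_avg T I * real k * max 1 (log 2 (max_duration I))) \<and>
           (uniform_size I \<longrightarrow>
              avg_cost T I (A I) \<le> opt_avg T I
                + C * sqrt (opt_avg T I * max 1 (log 2 (max_duration I)))))) \<and>
     (\<exists>A. poly_time_scheduler A \<and>
        (\<forall>T I. valid_instance T I \<longrightarrow>
           avg_cost T I (A I)
             \<le> 2 * harmonic_ratio k * (1 + 1 / (real k - 2)) * opt_avg T I + real k \<and>
           (uniform_size I \<longrightarrow> avg_cost T I (A I) \<le> 2 * opt_avg T I)))"
\<comment> \<open>The constant of \<open>sqrt_tradeoff\<close> depends neither on \<open>k\<close>
  nor on which of the two size cases applies.\<close>
proof (intro exI[of _ 30] conjI allI impI)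
  fix k :: nat assume k: "3 \<le> k"
  then have "poly_time_scheduler (near_optimal k)" by (intro poly_time_near_optimal) simp
  with near_optimal_bounds[OF _ k]
  show "\<exists>A. poly_time_scheduler A \<and>
        (\<forall>T I. valid_instance T I \<longrightarrow>
           avg_cost T I (A I) \<le> harmonic_ratio k * opt_avg T I
             + 30 * sqrt (opt_avg T I * real k * max 1 (log 2 (max_duration I))) \<and>
           (uniform_size I \<longrightarrow>
              avg_cost T I (A I) \<le> opt_avg T I
                + 30 * sqrt (opt_avg T I * max 1 (log 2 (max_duration I)))))"
    by blast
  show "\<exists>A. poly_time_scheduler A \<and>
        (\<forall>T I. valid_instance T I \<longrightarrow>
           avg_cost T I (A I)
             \<le> 2 * harmonic_ratio k * (1 + 1 / (real k - 2)) * opt_avg T I + real k \<and>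
           (uniform_size I \<longrightarrow> avg_cost T I (A I) \<le> 2 * opt_avg T I))"
    using poly_time_two_approx two_approx_bounds[OF _ k] by blast
qed simp

end
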